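(* Let $(X_t)_{t\ge0}$ be an exchangeable Markov process on $[k]^{\mathbb N}$ with cadlag sample paths, and let $(Y_t)_{t\ge 0}$ be its projection to the simplex $\Delta_k$. Then there exists a compatible random semigroup $(Q_{s,t})_{0\le s\le t}$ for $(Y_t)_{t\ge0}$ such that (i) for each pair $s\le t$ the random matrix $Q_{s,t}$ is measurable with respect to the exchangeable $\sigma$-algebra $\mathcal E_{\{s,t\}}$; and (ii) conditional on the exchangeable $\sigma$-algebra $\mathcal E_{[0,\infty)}$, the coordinate processes $(X^i_t)_{t\ge 0}$, $i\in\mathbb N$, are independent realizations of a time-inhomogeneous Markov chain on $[k]$ with transition probability matrices $Q_{s,t}$, that is, $$P\left(X_t^i=b\,\middle|\,X_s^i=a;\ \mathcal E_{[0,\infty)}\right)=Q_{s,t}(a,b).$$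
   Context: $k\ge 1$ is an integer, $[k]=\{1,\dots,k\}$, and $[k]^{\mathbb N}$ carries the product-discrete topology; its elements are written $x=(x^n)_{n\in\mathbb N}$ (superscripts are coordinates, subscripts are time). $\Delta_k$ (the "$k$-simplex") is the set of probability distributions on $[k]$, regarded as row vectors. A permutation of $\mathbb N$ is a bijection $\sigma:\mathbb N\to\mathbb N$ fixing all but finitely many elements; it acts on $[k]^{\mathbb N}$ by $(\sigma x)^i=x^{\sigma(i)}$ and on subsets by $\sigma A=\{\sigma x:x\in A\}$. A random variable $X$ in $[k]^{\mathbb N}$ is exchangeable if $\sigma X$ has the same distribution as $X$ for every permutation $\sigma$. A (time-homogeneous) Markov process $(X_t)$ on $[k]^{\mathbb N}$ with transition kernel $p_t(x,dy)$ is exchangeable if (a) $X_0$ is exchangeable and (b) $p_t(\sigma x,\sigma A)=p_t(x,A)$ for all $t\ge 0$, all $x$, all measurable $A$ and all permutations $\sigma$. A path $(x_t)$ in $[k]^{\mathbb N}$ is cadlag if each coordinate path is piecewise constant (finitely many jumps in each bounded time interval) and right-continuous. The projection of $(X_t)$ is $Y_t=(Y_t^j)_{j\in[k]}$, $Y_t^j=\lim_{n\to\infty}n^{-1}\sum_{m=1}^n\mathbf 1\{X_t^m=j\}$; with probability one these limits exist for all $t\ge0$ and all $j$. For a finite subset or interval $A\subseteq[0,\infty)$, write $X_A^i=(X_t^i)_{t\in A}$ and $X_A=(X_A^1,X_A^2,\dots)$. The exchangeable $\sigma$-algebra $\mathcal E_A$ consists of all events that are measurable with respect to $X_A$ and are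 invariant under every permutation $\sigma$ of $\mathbb N$ (acting on the sequence $X_A^1,X_A^2,\dots$ by permuting indices). Given a process $(Y_t)_{t\ge0}$ in $\Delta_k$, a compatible random semigroup is a two-parameter family $(Q_{s,t})_{0\le s\le t}$ of random $k\times k$ stochastic matrices satisfying, almost surely, the cocycle relation $Q_{r,t}=Q_{r,s}Q_{s,t}$ for all $r\le s\le t$ and the compatibility relation $Y_sQ_{s,t}=Y_t$ for all $s\le t$. *)

theory Defs
  imports "HOL-Probability.Probability" "HOL-Combinatorics.Permutations"
begin

text \<open>
  The set \<open>[k]\<close> is a finite type \<open>'k\<close>, so that \<open>k = CARD('k) \<ge> 1\<close>; a sequence in
  \<open>[k]\<close> is a function \<open>nat \<Rightarrow> 'k\<close>, the index set of the natural numbers starting at 0.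
  Time is the set of nonnegative reals; processes are functions of a real time whose values at
  negative times are never used. Finitary permutations of \<open>nat\<close> are the library's
  \<^const>\<open>permutation\<close>: bijections moving only finitely many points (fact \<open>permutation\<close>).
\<close>

text \<open>Since \<open>'k\<close> is finite, this is the Borel \<open>\<sigma>\<close>-algebra of the product-discrete topology.\<close>

definition seq_space :: "(nat \<Rightarrow> 'k::finite) measure" where
  "seq_space = (\<Pi>\<^sub>M i\<in>UNIV. count_space UNIV)"

definition perm_act :: "(nat \<Rightarrow> nat) \<Rightarrow> (nat \<Rightarrow> 'b) \<Rightarrow> (nat \<Rightarrow> 'b)" where
  "perm_act \<sigma> x = (\<lambda>i. x (\<sigma> i))"


subsection \<open>Conditional probabilities and generated \<open>\<sigma>\<close>-algebras\<close>

definition cond_pr :: "'a measure \<Rightarrow> 'a measure \<Rightarrow> 'a set \<Rightarrow> 'a \<Rightarrow> real" where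
  "cond_pr M F A = real_cond_exp M F (indicat_real A)"

text \<open>The \<open>\<sigma>\<close>-algebra generated by the family \<open>(Z t)\<close>, \<open>t \<in> T\<close>, of random elements of \<open>N\<close>.\<close>

definition generated_algebra ::
    "'a measure \<Rightarrow> 'b measure \<Rightarrow> real set \<Rightarrow> (real \<Rightarrow> 'a \<Rightarrow> 'b) \<Rightarrow> 'a measure" where
  "generated_algebra M N T Z =
     vimage_algebra (space M) (\<lambda>\<omega>. \<lambda>t\<in>T. Z t \<omega>) (\<Pi>\<^sub>M t\<in>T. N)"

definition join_algebra :: "'a measure \<Rightarrow> 'a measure \<Rightarrow> 'a measure \<Rightarrow> 'a measure" where
  "join_algebra M F G = sigma (space M) (sets F \<union> sets G)"


subsection \<open>Exchangeable Markov processes\<close>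

definition markov_process ::
    "'a measure \<Rightarrow> 'b measure \<Rightarrow> (real \<Rightarrow> 'b \<Rightarrow> 'b measure) \<Rightarrow> (real \<Rightarrow> 'a \<Rightarrow> 'b) \<Rightarrow> bool" where
  "markov_process M S p X \<longleftrightarrow>
     prob_space M \<and>
     (\<forall>t\<ge>0. X t \<in> measurable M S) \<and>
     (\<forall>t\<ge>0. p t \<in> measurable S (prob_algebra S)) \<and>
     (\<forall>s\<ge>0. \<forall>t\<ge>0. \<forall>A\<in>sets S.
        AE \<omega> in M. cond_pr M (generated_algebra M S {0..s} X) {\<omega>\<in>space M. X (s + t) \<omega> \<in> A} \<omega>
          = measure (p t (X s \<omega>)) A)"

definition exchangeable :: "'a measure \<Rightarrow> ('a \<Rightarrow> nat \<Rightarrow> 'k::finite) \<Rightarrow> bool" where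
  "exchangeable M Z \<longleftrightarrow>
     (\<forall>\<sigma>. permutation \<sigma> \<longrightarrow>
        distr M seq_space (\<lambda>\<omega>. perm_act \<sigma> (Z \<omega>)) = distr M seq_space Z)"

definition exchangeable_markov_process ::
    "'a measure \<Rightarrow> (real \<Rightarrow> (nat \<Rightarrow> 'k::finite) \<Rightarrow> (nat \<Rightarrow> 'k) measure) \<Rightarrow>
     (real \<Rightarrow> 'a \<Rightarrow> nat \<Rightarrow> 'k) \<Rightarrow> bool" where
  "exchangeable_markov_process M p X \<longleftrightarrow>
     markov_process M seq_space p X \<and>
     exchangeable M (X 0) \<and>
     (\<forall>t\<ge>0. \<forall>x. \<forall>A\<in>sets seq_space. \<forall>\<sigma>. permutation \<sigma> \<longrightarrow>
        measure (p t (perm_act \<sigma> x)) (perm_act \<sigma> ` A) = measure (p t x) A)"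

text \<open>
  Right-continuity is with respect to the discrete topology. The finite set \<open>D\<close> contains the
  jump times up to time \<open>T\<close>.
\<close>

definition cadlag_coordinate :: "(real \<Rightarrow> 'k) \<Rightarrow> bool" where
  "cadlag_coordinate f \<longleftrightarrow>
     (\<forall>T\<ge>0. \<exists>D. finite D \<and>
        (\<forall>s t. 0 \<le> s \<and> s \<le> t \<and> t \<le> T \<and> {s..t} \<inter> D = {} \<longrightarrow> f s = f t)) \<and>
     (\<forall>t\<ge>0. eventually (\<lambda>u. f u = f t) (at_right t))"

definition cadlag_path :: "(real \<Rightarrow> nat \<Rightarrow> 'k) \<Rightarrow> bool" where
  "cadlag_path x \<longleftrightarrow> (\<forall>i. cadlag_coordinate (\<lambda>t. x t i))"


subsection \<open>The projection to the simplex and compatible random semigroups\<close>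

definition prob_simplex :: "(real ^ 'k::finite) set" where
  "prob_simplex = {v. (\<forall>j. 0 \<le> v $ j) \<and> (\<Sum>j\<in>UNIV. v $ j) = 1}"

definition projection :: "(real \<Rightarrow> 'a \<Rightarrow> nat \<Rightarrow> 'k::finite) \<Rightarrow> real \<Rightarrow> 'a \<Rightarrow> real ^ 'k" where
  "projection X t \<omega> = (\<chi> j. lim (\<lambda>n. (\<Sum>m<n. of_bool (X t \<omega> m = j)) / real n))"

definition stochastic_matrix :: "real ^ 'k ^ 'k::finite \<Rightarrow> bool" where
  "stochastic_matrix P \<longleftrightarrow> (\<forall>a. P $ a \<in> prob_simplex)"

definition compatible_random_semigroup ::
    "'a measure \<Rightarrow> (real \<Rightarrow> 'a \<Rightarrow> real ^ 'k) \<Rightarrow> (real \<Rightarrow> real \<Rightarrow> 'a \<Rightarrow> real ^ 'k ^ 'k::finite) \<Rightarrow> bool"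
  where
  "compatible_random_semigroup M Y Q \<longleftrightarrow>
     (\<forall>s t. 0 \<le> s \<and> s \<le> t \<longrightarrow>
        Q s t \<in> borel_measurable M \<and> (\<forall>\<omega>\<in>space M. stochastic_matrix (Q s t \<omega>))) \<and>
     (AE \<omega> in M.
        (\<forall>r s t. 0 \<le> r \<and> r \<le> s \<and> s \<le> t \<longrightarrow> Q r t \<omega> = Q r s \<omega> ** Q s t \<omega>) \<and>
        (\<forall>s t. 0 \<le> s \<and> s \<le> t \<longrightarrow> Y s \<omega> v* Q s t \<omega> = Y t \<omega>))"


subsection \<open>The exchangeable \<open>\<sigma>\<close>-algebra\<close>

definition path_space :: "real set \<Rightarrow> (real \<Rightarrow> 'k) measure" where
  "path_space T = (\<Pi>\<^sub>M t\<in>T. count_space UNIV)"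

definition coord_path ::
    "(real \<Rightarrow> 'a \<Rightarrow> nat \<Rightarrow> 'k) \<Rightarrow> real set \<Rightarrow> nat \<Rightarrow> 'a \<Rightarrow> (real \<Rightarrow> 'k)" where
  "coord_path X T i \<omega> = (\<lambda>t\<in>T. X t \<omega> i)"

definition invariant_algebra :: "'b measure \<Rightarrow> (nat \<Rightarrow> 'b) measure" where
  "invariant_algebra N = sigma (space (\<Pi>\<^sub>M i\<in>UNIV. N))
     {B \<in> sets (\<Pi>\<^sub>M i\<in>UNIV. N). \<forall>\<sigma>. permutation \<sigma> \<longrightarrow> perm_act \<sigma> ` B = B}"

definition exch_algebra ::
    "'a measure \<Rightarrow> (real \<Rightarrow> 'a \<Rightarrow> nat \<Rightarrow> 'k) \<Rightarrow> real set \<Rightarrow> 'a measure" where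
  "exch_algebra M X T =
     vimage_algebra (space M) (\<lambda>\<omega> i. coord_path X T i \<omega>) (invariant_algebra (path_space T))"

text \<open>The invariant sets already form a \<open>\<sigma>\<close>-algebra, so \<^const>\<open>sigma\<close> adds nothing.\<close>

lemma sets_invariant_algebra:
  "sets (invariant_algebra N) =
     {B \<in> sets (\<Pi>\<^sub>M i\<in>UNIV. N). \<forall>\<sigma>. permutation \<sigma> \<longrightarrow> perm_act \<sigma> ` B = B}"
    (is "_ = ?I")
proof -
  let ?P = "\<Pi>\<^sub>M i\<in>(UNIV::nat set). N"
  have bij: "bij (perm_act \<sigma> :: (nat \<Rightarrow> 'a) \<Rightarrow> _)" if "permutation \<sigma>" for \<sigma>
  proof (rule o_bij)
    have b: "bij \<sigma>" using that by (simp add: permutation)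
    show "perm_act (inv \<sigma>) \<circ> perm_act \<sigma> = (id :: (nat \<Rightarrow> 'a) \<Rightarrow> _)"
      using b by (auto simp: perm_act_def fun_eq_iff bij_def surj_f_inv_f)
    show "perm_act \<sigma> \<circ> perm_act (inv \<sigma>) = (id :: (nat \<Rightarrow> 'a) \<Rightarrow> _)"
      using b by (auto simp: perm_act_def fun_eq_iff bij_def inv_f_f)
  qed
  have sp: "perm_act \<sigma> ` space ?P = space ?P" if "permutation \<sigma>" for \<sigma>
  proof
    show "perm_act \<sigma> ` space ?P \<subseteq> space ?P"
      by (auto simp: space_PiM perm_act_def)
    show "space ?P \<subseteq> perm_act \<sigma> ` space ?P"
    proof
      fix x assume x: "x \<in> space ?P"
      have "x = perm_act \<sigma> (perm_act (inv \<sigma>) x)"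
        using that by (auto simp: perm_act_def fun_eq_iff permutation bij_def inv_f_f)
      moreover have "perm_act (inv \<sigma>) x \<in> space ?P"
        using x by (auto simp: space_PiM perm_act_def)
      ultimately show "x \<in> perm_act \<sigma> ` space ?P" by blast
    qed
  qed
  have "sigma_algebra (space ?P) ?I"
    unfolding sigma_algebra_iff2
  proof (intro conjI ballI allI impI)
    show "?I \<subseteq> Pow (space ?P)" by (auto dest: sets.sets_into_space)
    show "{} \<in> ?I" by simp
    show "space ?P - B \<in> ?I" if "B \<in> ?I" for B
      using that sp bij by (auto simp: image_set_diff bij_is_inj)
    show "(\<Union>i. A i) \<in> ?I" if "range A \<subseteq> ?I" for A :: "nat \<Rightarrow> _"
    proof -
      have A: "A i \<in> sets ?P" "permutation \<sigma> \<Longrightarrow> perm_act \<sigma> ` A i = A i" for i \<sigma>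
        using that by blast+
      then have "perm_act \<sigma> ` (\<Union>i. A i) = (\<Union>i. A i)" if "permutation \<sigma>" for \<sigma>
        using that by (simp add: image_UN)
      with A(1) show ?thesis by auto
    qed
  qed
  then show ?thesis
    unfolding invariant_algebra_def by (simp add: sigma_algebra.sets_measure_of_eq)
qed


subsection \<open>Conditionally independent Markov chains\<close>

definition cond_indep_vars ::
    "'a measure \<Rightarrow> 'a measure \<Rightarrow> 'b measure \<Rightarrow> ('i \<Rightarrow> 'a \<Rightarrow> 'b) \<Rightarrow> 'i set \<Rightarrow> bool" where
  "cond_indep_vars M F N Z I \<longleftrightarrow>
     (\<forall>J\<subseteq>I. finite J \<longrightarrow> (\<forall>A \<in> J \<rightarrow> sets N.
        AE \<omega> in M. cond_pr M F {\<omega>\<in>space M. \<forall>i\<in>J. Z i \<omega> \<in> A i} \<omega>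
          = (\<Prod>i\<in>J. cond_pr M F {\<omega>\<in>space M. Z i \<omega> \<in> A i} \<omega>)))"

definition cond_ident_distributed ::
    "'a measure \<Rightarrow> 'a measure \<Rightarrow> 'b measure \<Rightarrow> ('i \<Rightarrow> 'a \<Rightarrow> 'b) \<Rightarrow> 'i set \<Rightarrow> bool" where
  "cond_ident_distributed M F N Z I \<longleftrightarrow>
     (\<forall>i\<in>I. \<forall>j\<in>I. \<forall>A\<in>sets N.
        AE \<omega> in M. cond_pr M F {\<omega>\<in>space M. Z i \<omega> \<in> A} \<omega> = cond_pr M F {\<omega>\<in>space M. Z j \<omega> \<in> A} \<omega>)"

text \<open>
  Conditionally on \<open>F\<close>, the process \<open>Z\<close> is a time-inhomogeneous Markov chain with the
  (\<open>F\<close>-measurable) random transition matrices \<open>Q s t\<close>: given \<open>F\<close> and the whole past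
  \<open>(Z u)\<close>, \<open>u \<le> s\<close>, the law of \<open>Z t\<close> is row \<open>Z s\<close> of \<open>Q s t\<close>.
\<close>

definition cond_markov_chain ::
    "'a measure \<Rightarrow> 'a measure \<Rightarrow> (real \<Rightarrow> real \<Rightarrow> 'a \<Rightarrow> real ^ 'k ^ 'k) \<Rightarrow>
     (real \<Rightarrow> 'a \<Rightarrow> 'k::finite) \<Rightarrow> bool" where
  "cond_markov_chain M F Q Z \<longleftrightarrow>
     (\<forall>s t b. 0 \<le> s \<and> s \<le> t \<longrightarrow>
        (AE \<omega> in M.
           cond_pr M (join_algebra M F (generated_algebra M (count_space UNIV) {0..s} Z))
             {\<omega>\<in>space M. Z t \<omega> = b} \<omega>
           = Q s t \<omega> $ Z s \<omega> $ b))"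

end

theory Submission
  imports Defs "HOL-Real_Asymp.Real_Asymp"
begin

text \<open>
  Let \<open>q(a,b)\<close> be the limiting proportion of the indices \<open>i\<close> with \<open>X s i = a\<close> and \<open>X t i = b\<close>, and
  let \<open>Y s a\<close> be that of the indices with \<open>X s i = a\<close>. The semigroup is
  \<open>Q s t (a,b) = q(a,b) / Y s a\<close>; when \<open>Y s a = 0\<close>, row \<open>a\<close> is taken to be \<open>Y t\<close>. This choice for the
  null rows is what makes the cocycle relation hold in every row: row \<open>a\<close> of \<open>Q r s\<close> is then
  \<open>Y s\<close>, and \<open>Y s Q s t = Y t\<close> is again row \<open>a\<close> of \<open>Q r t\<close>. As a function of \<open>X s\<close> and \<open>X t\<close> that
  ignores finitary permutations, \<open>Q s t\<close> is measurable for the exchangeable algebra of \<open>{s, t}\<close>.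

  Since the initial law is exchangeable and the kernel commutes with permutations, the coordinate
  paths form an exchangeable sequence (\<open>law_exchangeable\<close>). For an exchangeable sequence the
  proportion of the indices whose path lies in \<open>A\<close> converges to the conditional probability, given
  the exchangeable algebra, that one path lies in \<open>A\<close> (\<open>law_of_large_numbers\<close>), and this directing
  measure of \<open>A\<close> multiplies over different indices (\<open>real_cond_exp_prod_directing\<close>). That is the
  conditional i.i.d. statement.

  The Markov property of a single coordinate comes from the Markov property of the whole sequence.
  Given the past up to time \<open>s\<close>, the law of the future is unchanged when two coordinates which agree
  at time \<open>s\<close> are swapped. Hence, among the coordinates in state \<open>a\<close> at time \<open>s\<close>, those with a
  prescribed past move to \<open>b\<close> in the same proportion \<open>Q s t (a,b)\<close> as all of them. The second moment
  of the difference of the two proportions involves four different coordinates and vanishes by two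
  such swaps (\<open>directing_markov\<close>).

  Limits and identities hold almost surely for each fixed choice of times, hence for all rational
  times at once. To pass to all real times one must exclude that at some exceptional time \<open>t\<close> a
  positive proportion of the coordinates jumps immediately after \<open>t\<close>. A positive proportion may
  jump exactly at a random time, so a deterministic grid is of no use. Instead the time axis is cut
  at successive random times, chosen as late as possible subject to only a proportion \<open>\<epsilon>\<close> of the
  coordinates jumping strictly between two of them. These times are symmetric functions of the
  coordinates, so the law of large numbers applies to jumps between them; if they accumulated at
  a finite time, one coordinate would make infinitely many jumps before it with positive
  probability (\<open>stop_unbounded\<close>). Between consecutive times the claim is clear
  (\<open>thin_before_stop\<close>), and all identities extend to real times by right-continuity
  (\<open>markov_at_real_times\<close>).
\<close>

section \<open>Running means\<close>

definition running_mean :: "(nat \<Rightarrow> real) \<Rightarrow> nat \<Rightarrow> real" where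
  "running_mean c n = (\<Sum>m<n. c m) / real n"

text \<open>
  Means over a sufficiently long initial segment are not only close but equal: \<open>\<sigma>\<close> permutes every
  initial segment that contains its support. So each property of the tail of the sequence of means
  is exactly invariant.
\<close>

lemma running_mean_permutation:
  assumes "permutation \<sigma>"
  shows "eventually (\<lambda>n. running_mean (\<lambda>m. c (\<sigma> m)) n = running_mean c n) sequentially"
proof -
  have fin: "finite {x. \<sigma> x \<noteq> x}" and b: "bij \<sigma>" using assms by (auto simp: permutation)
  obtain K where K: "\<And>x. \<sigma> x \<noteq> x \<Longrightarrow> x < K"
    using fin unfolding finite_nat_set_iff_bounded by blast
  have "running_mean (\<lambda>m. c (\<sigma> m)) n = running_mean c n" if "n \<ge> K" for n
  proof -
    have "\<sigma> permutes {..<n}"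
      unfolding permutes_def
    proof (intro conjI allI impI)
      show "\<sigma> x = x" if "x \<notin> {..<n}" for x using K[of x] that \<open>n \<ge> K\<close> by fastforce
      show "\<exists>!x. \<sigma> x = y" for y using b by (metis bij_pointE)
    qed
    then have "(\<Sum>m<n. c (\<sigma> m)) = (\<Sum>m<n. c m)"
      using sum.permute[of \<sigma> "{..<n}" c] by (simp add: o_def)
    then show ?thesis by (simp add: running_mean_def)
  qed
  then show ?thesis by (auto simp: eventually_sequentially)
qed

lemma lim_cong_eventually:
  assumes "eventually (\<lambda>n. f n = g n) sequentially"
  shows "lim f = lim g"
  unfolding lim_def by (rule arg_cong[where f = The]) (auto simp: fun_eq_iff tendsto_cong[OF assms])

lemma abs_running_mean_le:
  assumes "\<And>m. \<bar>c m\<bar> \<le> C"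
  shows "\<bar>running_mean c n\<bar> \<le> C"
proof (cases "n = 0")
  case True
  with assms[of 0] show ?thesis by (simp add: running_mean_def)
next
  case False
  have "\<bar>\<Sum>m<n. c m\<bar> \<le> (\<Sum>m<n. \<bar>c m\<bar>)" by (rule sum_abs)
  also have "\<dots> \<le> real n * C" using sum_bounded_above[of "{..<n}" "\<lambda>m. \<bar>c m\<bar>" C] assms by simp
  finally show ?thesis using False by (simp add: running_mean_def divide_simps mult.commute)
qed

lemma running_mean_eventually_const:
  assumes "\<And>m. m \<ge> K \<Longrightarrow> c m = c'"
  shows "running_mean c \<longlonglongrightarrow> c'"
proof -
  let ?S = "\<Sum>m<K. c m - c'"
  have "running_mean c n = c' + ?S / real n" if "n \<ge> K" "n > 0" for n
  proof -
    have "(\<Sum>m<n. c m - c') = ?S"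
      using that assms by (intro sum.mono_neutral_right) auto
    then have "(\<Sum>m<n. c m) = real n * c' + ?S" by (simp add: sum_subtractf)
    then show ?thesis using that by (simp add: running_mean_def add_divide_distrib)
  qed
  then have "eventually (\<lambda>n. c' + ?S / real n = running_mean c n) sequentially"
    unfolding eventually_sequentially by (intro exI[of _ "Suc K"]) auto
  moreover have "(\<lambda>n. c' + ?S / real n) \<longlonglongrightarrow> c' + 0"
    by (intro tendsto_intros lim_const_over_n)
  ultimately show ?thesis by (auto intro: Lim_transform_eventually)
qed

lemma running_mean_mono: "(\<And>i. c i \<le> d i) \<Longrightarrow> running_mean c n \<le> running_mean d n"
  by (simp add: running_mean_def divide_right_mono sum_mono)

lemma of_bool_mono: "p \<longrightarrow> q \<Longrightarrow> of_bool p \<le> (of_bool q :: real)"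
  by simp

lemma running_mean_add: "running_mean (\<lambda>i. c i + d i) n = running_mean c n + running_mean d n"
  by (simp add: running_mean_def sum.distrib add_divide_distrib)

lemma running_mean_diff: "running_mean (\<lambda>i. c i - d i) n = running_mean c n - running_mean d n"
  by (simp add: running_mean_def sum_subtractf diff_divide_distrib)

lemma abs_running_mean_diff_le:
  assumes "\<And>i. \<bar>c i - d i\<bar> \<le> e i"
  shows "\<bar>running_mean c n - running_mean d n\<bar> \<le> running_mean e n"
proof -
  have "running_mean (\<lambda>i. c i - d i) n \<le> running_mean e n" "running_mean (\<lambda>i. d i - c i) n \<le> running_mean e n"
    using assms by (auto intro!: running_mean_mono simp: abs_le_iff)
  then show ?thesis by (simp add: running_mean_diff abs_le_iff)
qed

lemma running_mean_diff_le:
  assumes "\<And>m. \<bar>c m\<bar> \<le> C" "n \<le> m" "0 < n"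
  shows "\<bar>running_mean c m - running_mean c n\<bar> \<le> 2 * C * (real m - real n) / real n"
proof -
  let ?D = "\<Sum>i=n..<m. c i"
  have D: "\<bar>?D\<bar> \<le> C * (real m - real n)"
  proof -
    have "\<bar>?D\<bar> \<le> (\<Sum>i=n..<m. \<bar>c i\<bar>)" by (rule sum_abs)
    also have "\<dots> \<le> of_nat (card {n..<m}) * C" by (rule sum_bounded_above) (use assms in auto)
    finally show ?thesis using assms by (simp add: of_nat_diff mult.commute)
  qed
  have S: "(\<Sum>i<m. c i) = (\<Sum>i<n. c i) + ?D"
    using assms(2) by (metis sum.atLeastLessThan_concat lessThan_atLeast0 zero_le)
  have C: "C \<ge> 0" using assms(1)[of 0] by linarith
  have eq: "real m * (running_mean c m - running_mean c n) = ?D - (real m - real n) * running_mean c n"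
    using assms(2,3) by (simp add: running_mean_def S field_simps)
  have "real m * \<bar>running_mean c m - running_mean c n\<bar> = \<bar>?D - (real m - real n) * running_mean c n\<bar>"
    using eq by (metis abs_mult abs_of_nat)
  also have "\<dots> \<le> C * (real m - real n) + (real m - real n) * C"
  proof -
    have "\<bar>(real m - real n) * running_mean c n\<bar> \<le> (real m - real n) * C"
      using assms by (auto simp: abs_mult intro!: mult_left_mono abs_running_mean_le)
    then show ?thesis using D by linarith
  qed
  finally have "\<bar>running_mean c m - running_mean c n\<bar> \<le> 2 * C * (real m - real n) / real m"
    using assms by (simp add: field_simps)
  also have "\<dots> \<le> 2 * C * (real m - real n) / real n"
    using assms C by (intro divide_left_mono) auto
  finally show ?thesis .
qed

text \<open>
  Means of a bounded sequence vary little between consecutive fourth powers, as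
  \<open>(r + 1) ^ 4 / r ^ 4\<close> tends to 1. Along the fourth powers, second-moment bounds are summable.
\<close>

lemma running_mean_convergent_fourth_powers:
  assumes bd: "\<And>m. \<bar>c m\<bar> \<le> C"
    and conv: "(\<lambda>n. running_mean c (n ^ 4)) \<longlonglongrightarrow> l"
  shows "running_mean c \<longlonglongrightarrow> l"
proof -
  define r where "r m = nat \<lfloor>root 4 (real m)\<rfloor>" for m
  have r_top: "filterlim r at_top sequentially"
    unfolding r_def by real_asymp
  have le: "real (r m) \<le> root 4 (real m)" and lt: "root 4 (real m) < real (r m) + 1" for m
    unfolding r_def by (auto simp: real_root_ge_zero)
  have r4: "r m ^ 4 \<le> m" for m
  proof -
    have "real (r m) ^ 4 \<le> root 4 (real m) ^ 4" using le by (intro power_mono) auto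
    then have "real (r m ^ 4) \<le> real m" by simp
    then show ?thesis by linarith
  qed
  have m_lt: "real m \<le> (real (r m) + 1) ^ 4" for m
  proof -
    have "root 4 (real m) ^ 4 \<le> (real (r m) + 1) ^ 4"
      using lt[of m] by (intro power_mono) (auto simp: real_root_ge_zero)
    then show ?thesis by simp
  qed
  have C: "C \<ge> 0" using bd[of 0] by linarith
  have lim: "(\<lambda>m. 2 * C * ((real (r m) + 1) ^ 4 - real (r m) ^ 4) / real (r m) ^ 4) \<longlonglongrightarrow> 0"
  proof -
    have "(\<lambda>k::nat. 2 * C * ((real k + 1) ^ 4 - real k ^ 4) / real k ^ 4) \<longlonglongrightarrow> 0"
      by real_asymp
    then show ?thesis by (rule filterlim_compose[OF _ r_top])
  qed
  have "eventually (\<lambda>m. r m > 0) sequentially"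
    by (rule eventually_compose_filterlim[OF eventually_gt_at_top r_top])
  then have "eventually (\<lambda>m. norm (running_mean c m - running_mean c (r m ^ 4))
      \<le> 2 * C * ((real (r m) + 1) ^ 4 - real (r m) ^ 4) / real (r m) ^ 4) sequentially"
  proof eventually_elim
    case (elim m)
    have "\<bar>running_mean c m - running_mean c (r m ^ 4)\<bar> \<le> 2 * C * (real m - real (r m ^ 4)) / real (r m ^ 4)"
      by (rule running_mean_diff_le[OF bd r4]) (use elim in simp)
    also have "\<dots> \<le> 2 * C * ((real (r m) + 1) ^ 4 - real (r m) ^ 4) / real (r m) ^ 4"
      using m_lt[of m] C by (auto intro!: divide_right_mono mult_left_mono)
    finally show ?case by simp
  qed
  then have "(\<lambda>m. running_mean c m - running_mean c (r m ^ 4)) \<longlonglongrightarrow> 0"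
    by (rule Lim_null_comparison[OF _ lim])
  moreover have "(\<lambda>m. running_mean c (r m ^ 4)) \<longlonglongrightarrow> l"
    by (rule filterlim_compose[OF conv r_top])
  ultimately show ?thesis
    using tendsto_add by fastforce
qed

section \<open>Exchangeable sequences and the strong law of large numbers\<close>

lemma perm_act_in_space:
  "z \<in> space (PiM UNIV (\<lambda>_. N)) \<Longrightarrow> perm_act \<sigma> z \<in> space (PiM UNIV (\<lambda>_. N))"
  by (auto simp: space_PiM perm_act_def)

lemma measurable_perm_act [measurable]:
  "perm_act \<sigma> \<in> PiM UNIV (\<lambda>_::nat. N) \<rightarrow>\<^sub>M PiM UNIV (\<lambda>_. N)"
  unfolding perm_act_def by (intro measurable_PiM_single') (auto simp: space_PiM)

lemma space_invariant_algebra [simp]: "space (invariant_algebra N) = space (PiM UNIV (\<lambda>_. N))"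
  by (simp add: invariant_algebra_def space_measure_of_conv)

text \<open>
  This is how measurability with respect to the exchangeable algebra is established throughout:
  by exhibiting a measurable function that ignores finitary permutations.
\<close>

lemma measurable_invariant_algebraI:
  assumes f: "f \<in> PiM UNIV (\<lambda>_. N) \<rightarrow>\<^sub>M K"
    and inv: "\<And>\<sigma> z. permutation \<sigma> \<Longrightarrow> z \<in> space (PiM UNIV (\<lambda>_. N)) \<Longrightarrow> f (perm_act \<sigma> z) = f z"
  shows "f \<in> invariant_algebra N \<rightarrow>\<^sub>M K"
proof (rule measurableI)
  have sp: "space (invariant_algebra N) = space (PiM UNIV (\<lambda>_. N))"
    by simp
  show "f z \<in> space K" if "z \<in> space (invariant_algebra N)" for z
    using that measurable_space[OF f] by (simp add: sp)
  show "f -` A \<inter> space (invariant_algebra N) \<in> sets (invariant_algebra N)" if A: "A \<in> sets K" for A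
  proof -
    let ?B = "f -` A \<inter> space (PiM UNIV (\<lambda>_. N))"
    have "perm_act \<sigma> ` ?B = ?B" if s: "permutation \<sigma>" for \<sigma>
    proof
      show "perm_act \<sigma> ` ?B \<subseteq> ?B" using inv[OF s] by (auto intro: perm_act_in_space)
      show "?B \<subseteq> perm_act \<sigma> ` ?B"
      proof
        fix z assume z: "z \<in> ?B"
        have b: "bij \<sigma>" using s by (simp add: permutation_bijective)
        have "z = perm_act \<sigma> (perm_act (inv \<sigma>) z)"
          using b by (auto simp: perm_act_def fun_eq_iff bij_def inv_f_f)
        moreover have "perm_act (inv \<sigma>) z \<in> ?B"
          using inv[OF permutation_inverse[OF s]] z by (auto intro: perm_act_in_space)
        ultimately show "z \<in> perm_act \<sigma> ` ?B" by blast
      qed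
    qed
    then show ?thesis
      using measurable_sets[OF f A] by (simp add: sets_invariant_algebra sp)
  qed
qed

text \<open>
  A family \<open>h\<close> of observables, the \<open>i\<close>-th of which looks at the \<open>i\<close>-th coordinate and may in addition
  depend on the whole sequence in a symmetric way. The symmetric dependence is essential for
  observing a coordinate at a random time that is itself a symmetric function of the sequence.
\<close>

definition equivariant :: "'b measure \<Rightarrow> (nat \<Rightarrow> (nat \<Rightarrow> 'b) \<Rightarrow> real) \<Rightarrow> bool" where
  "equivariant N h \<longleftrightarrow>
     (\<forall>i. h i \<in> borel_measurable (PiM UNIV (\<lambda>_. N))) \<and>
     (\<forall>\<sigma> i. \<forall>z\<in>space (PiM UNIV (\<lambda>_. N)). permutation \<sigma> \<longrightarrow> h i (perm_act \<sigma> z) = h (\<sigma> i) z) \<and>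
     (\<exists>C. \<forall>i z. \<bar>h i z\<bar> \<le> C)"

lemma equivariant_measurable: "equivariant N h \<Longrightarrow> h i \<in> borel_measurable (PiM UNIV (\<lambda>_. N))"
  by (simp add: equivariant_def)

lemma equivariant_perm_act:
  "equivariant N h \<Longrightarrow> permutation \<sigma> \<Longrightarrow> z \<in> space (PiM UNIV (\<lambda>_. N)) \<Longrightarrow>
    h i (perm_act \<sigma> z) = h (\<sigma> i) z"
  by (simp add: equivariant_def)

lemma equivariant_bounded:
  assumes "equivariant N h"
  obtains C where "C > 0" "\<And>i z. \<bar>h i z\<bar> \<le> C"
proof -
  obtain C where C: "\<And>i z. \<bar>h i z\<bar> \<le> C" using assms by (auto simp: equivariant_def)
  have "\<bar>C\<bar> + 1 > 0" "\<bar>h i z\<bar> \<le> \<bar>C\<bar> + 1" for i z using C[of i z] by auto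
  then show thesis by (rule that)
qed

lemma equivariant_indicator:
  assumes "A \<in> sets N"
  shows "equivariant N (\<lambda>i z. indicat_real A (z i))"
  unfolding equivariant_def
proof (intro conjI allI ballI impI)
  show "(\<lambda>z. indicat_real A (z i)) \<in> borel_measurable (PiM UNIV (\<lambda>_. N))" for i
    using assms by measurable
  show "\<exists>C. \<forall>i z. \<bar>indicat_real A (z i)\<bar> \<le> C"
    by (rule exI[of _ 1]) (auto simp: indicator_def)
qed (simp add: perm_act_def)

text \<open>
  The measurable space \<open>N\<close> is arbitrary. It will be the space of paths over an uncountable time
  set, where regular conditional laws are not at hand; the directing measure of the sequence is
  therefore treated one set at a time.
\<close>

locale exchangeable_sequence = prob_space M for M :: "'a measure" +
  fixes N :: "'b measure" and Z :: "'a \<Rightarrow> nat \<Rightarrow> 'b"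
  assumes Z_measurable [measurable]: "Z \<in> M \<rightarrow>\<^sub>M PiM UNIV (\<lambda>_. N)"
    and exch: "permutation \<sigma> \<Longrightarrow>
      distr M (PiM UNIV (\<lambda>_. N)) (\<lambda>\<omega>. perm_act \<sigma> (Z \<omega>)) = distr M (PiM UNIV (\<lambda>_. N)) Z"
begin

abbreviation "P \<equiv> PiM (UNIV::nat set) (\<lambda>_. N)"

text \<open>
  The exchangeable \<open>\<sigma>\<close>-algebra of the sequence.
\<close>

definition "E = vimage_algebra (space M) Z (invariant_algebra N)"

lemma Z_space: "\<omega> \<in> space M \<Longrightarrow> Z \<omega> \<in> space P"
  using measurable_space[OF Z_measurable] .

lemma space_E [simp]: "space E = space M"
  by (simp add: E_def)

lemma invariant_measurable_E:
  assumes "f \<in> P \<rightarrow>\<^sub>M K"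
    and "\<And>\<sigma> z. permutation \<sigma> \<Longrightarrow> z \<in> space P \<Longrightarrow> f (perm_act \<sigma> z) = f z"
  shows "(\<lambda>\<omega>. f (Z \<omega>)) \<in> E \<rightarrow>\<^sub>M K"
proof -
  have "Z \<in> E \<rightarrow>\<^sub>M invariant_algebra N"
    unfolding E_def by (rule measurable_vimage_algebra1) (auto simp: Z_space)
  from measurable_compose[OF this measurable_invariant_algebraI[OF assms]] show ?thesis .
qed

lemma E_setE:
  assumes "B \<in> sets E"
  obtains C where "C \<in> sets P" "B = Z -` C \<inter> space M"
    "\<And>\<sigma> z. permutation \<sigma> \<Longrightarrow> z \<in> space P \<Longrightarrow> perm_act \<sigma> z \<in> C \<longleftrightarrow> z \<in> C"
proof -
  have "Z \<in> space M \<rightarrow> space (invariant_algebra N)"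
    using Z_space by auto
  then obtain C where C: "C \<in> sets (invariant_algebra N)" "B = Z -` C \<inter> space M"
    using assms by (auto simp: E_def sets_vimage_algebra2)
  have "perm_act \<sigma> z \<in> C \<longleftrightarrow> z \<in> C" if s: "permutation \<sigma>" for \<sigma> z
  proof
    have im: "perm_act \<sigma> ` C = C" using C(1) s by (simp add: sets_invariant_algebra)
    show "perm_act \<sigma> z \<in> C" if "z \<in> C" using im that by blast
    assume "perm_act \<sigma> z \<in> C"
    then obtain y where y: "y \<in> C" "perm_act \<sigma> z = perm_act \<sigma> y" using im by auto
    have "surj \<sigma>" using permutation_bijective[OF s] by (simp add: bij_def)
    then have "z = y"
    proof -
      have "z i = y i" for i
      proof -
        obtain j where "i = \<sigma> j" using \<open>surj \<sigma>\<close> by (metis surjD)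
        then show ?thesis using fun_cong[OF y(2), of j] by (simp add: perm_act_def)
      qed
      then show ?thesis by (simp add: fun_eq_iff)
    qed
    with y show "z \<in> C" by simp
  qed
  with C show thesis by (intro that) (auto simp: sets_invariant_algebra)
qed

lemma subalgebra_E: "subalgebra M E"
  unfolding subalgebra_def
proof safe
  fix B assume "B \<in> sets E"
  then obtain C where "C \<in> sets P" "B = Z -` C \<inter> space M" by (rule E_setE)
  then show "B \<in> sets M" using measurable_sets[OF Z_measurable] by simp
qed simp_all

sublocale finite_measure_subalgebra M E
  by unfold_locales (rule subalgebra_E)

lemma integral_perm:
  fixes f :: "(nat \<Rightarrow> 'b) \<Rightarrow> real"
  assumes [measurable]: "f \<in> borel_measurable P" and "permutation \<sigma>"
  shows "(\<integral>\<omega>. f (perm_act \<sigma> (Z \<omega>)) \<partial>M) = (\<integral>\<omega>. f (Z \<omega>) \<partial>M)"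
proof -
  have "(\<integral>\<omega>. f (perm_act \<sigma> (Z \<omega>)) \<partial>M) = (\<integral>z. f z \<partial>distr M P (\<lambda>\<omega>. perm_act \<sigma> (Z \<omega>)))"
    by (rule integral_distr[symmetric]) measurable
  also have "\<dots> = (\<integral>z. f z \<partial>distr M P Z)" using exch[OF assms(2)] by simp
  also have "\<dots> = (\<integral>\<omega>. f (Z \<omega>) \<partial>M)" by (rule integral_distr) measurable
  finally show ?thesis .
qed

lemma equivariant_measurable_M:
  "equivariant N h \<Longrightarrow> (\<lambda>\<omega>. h i (Z \<omega>)) \<in> borel_measurable M"
  by (rule measurable_compose[OF Z_measurable equivariant_measurable])

lemma integrable_bounded_measurable:
  fixes f :: "'a \<Rightarrow> real"
  assumes "f \<in> borel_measurable M" "\<And>\<omega>. \<omega> \<in> space M \<Longrightarrow> \<bar>f \<omega>\<bar> \<le> C"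
  shows "integrable M f"
  by (rule integrable_const_bound[where B = C]) (use assms in auto)

text \<open>
  Transposing \<open>i\<close> and \<open>j\<close> preserves the law and the invariant event \<open>B\<close>, and turns \<open>h i\<close> into
  \<open>h j\<close>.
\<close>

lemma integral_E_equivariant:
  assumes h: "equivariant N h" and B: "B \<in> sets E"
  shows "(\<integral>\<omega>. indicat_real B \<omega> * h i (Z \<omega>) \<partial>M) = (\<integral>\<omega>. indicat_real B \<omega> * h j (Z \<omega>) \<partial>M)"
proof -
  obtain C where C: "C \<in> sets P" "B = Z -` C \<inter> space M"
    "\<And>\<sigma> z. permutation \<sigma> \<Longrightarrow> z \<in> space P \<Longrightarrow> perm_act \<sigma> z \<in> C \<longleftrightarrow> z \<in> C"
    using B by (rule E_setE) blast
  let ?\<sigma> = "Transposition.transpose i j"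
  let ?f = "\<lambda>z. indicat_real C z * h i z"
  have p: "permutation ?\<sigma>" by (rule permutation_swap_id)
  have f: "?f \<in> borel_measurable P"
    using C(1) equivariant_measurable[OF h] by measurable
  have "(\<integral>\<omega>. indicat_real B \<omega> * h i (Z \<omega>) \<partial>M) = (\<integral>\<omega>. ?f (Z \<omega>) \<partial>M)"
    by (intro Bochner_Integration.integral_cong) (auto simp: C indicator_def)
  also have "\<dots> = (\<integral>\<omega>. ?f (perm_act ?\<sigma> (Z \<omega>)) \<partial>M)"
    by (rule integral_perm[OF f p, symmetric])
  also have "\<dots> = (\<integral>\<omega>. indicat_real B \<omega> * h j (Z \<omega>) \<partial>M)"
    by (intro Bochner_Integration.integral_cong)
      (auto simp: C(2) C(3)[OF p] indicator_def Z_space equivariant_perm_act[OF h p])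
  finally show ?thesis .
qed

text \<open>
  All pairs of different indices have the same joint second moment, because some finitary
  permutation takes \<open>(0, 1)\<close> to \<open>(i, j)\<close>.
\<close>

lemma integral_mult_equivariant:
  assumes h: "equivariant N h" and "i \<noteq> j"
  shows "(\<integral>\<omega>. h i (Z \<omega>) * h j (Z \<omega>) \<partial>M) = (\<integral>\<omega>. h 0 (Z \<omega>) * h 1 (Z \<omega>) \<partial>M)"
proof -
  let ?j = "Transposition.transpose 0 i j"
  let ?\<sigma> = "Transposition.transpose 0 i \<circ> Transposition.transpose 1 ?j"
  have p: "permutation ?\<sigma>" by (intro permutation_compose permutation_swap_id)
  have "?j \<noteq> 0" using assms(2) by (auto simp: Transposition.transpose_def split: if_splits)
  then have s: "?\<sigma> 0 = i" "?\<sigma> 1 = j" by (auto simp: transpose_apply_other)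
  have m: "(\<lambda>z. h 0 z * h 1 z) \<in> borel_measurable P"
    using equivariant_measurable[OF h] by measurable
  show ?thesis
    unfolding integral_perm[OF m p, symmetric]
    by (intro Bochner_Integration.integral_cong refl)
      (simp only: equivariant_perm_act[OF h p] Z_space s)
qed

lemma integral_square_equivariant:
  assumes h: "equivariant N h"
  shows "(\<integral>\<omega>. (h i (Z \<omega>))\<^sup>2 \<partial>M) = (\<integral>\<omega>. (h 0 (Z \<omega>))\<^sup>2 \<partial>M)"
proof -
  let ?\<sigma> = "Transposition.transpose 0 i"
  have p: "permutation ?\<sigma>" by (rule permutation_swap_id)
  have m: "(\<lambda>z. (h 0 z)\<^sup>2) \<in> borel_measurable P"
    using equivariant_measurable[OF h] by measurable
  show ?thesis
    unfolding integral_perm[OF m p, symmetric]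
    by (intro Bochner_Integration.integral_cong refl)
      (simp add: equivariant_perm_act[OF h p] Z_space)
qed

text \<open>
  With equal variances and equal covariances, the quadratic form is diagonal on the weights of
  total mass zero.
\<close>

lemma integral_square_linear_combination:
  assumes h: "equivariant N h" and fin: "finite I" and w: "sum w I = 0"
  shows "(\<integral>\<omega>. (\<Sum>i\<in>I. w i * h i (Z \<omega>))\<^sup>2 \<partial>M) =
    ((\<integral>\<omega>. (h 0 (Z \<omega>))\<^sup>2 \<partial>M) - (\<integral>\<omega>. h 0 (Z \<omega>) * h 1 (Z \<omega>) \<partial>M)) * (\<Sum>i\<in>I. (w i)\<^sup>2)"
proof -
  obtain C where C: "C > 0" "\<And>i z. \<bar>h i z\<bar> \<le> C" using equivariant_bounded[OF h] by blast
  let ?d = "\<integral>\<omega>. (h 0 (Z \<omega>))\<^sup>2 \<partial>M" and ?c = "\<integral>\<omega>. h 0 (Z \<omega>) * h 1 (Z \<omega>) \<partial>M"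
  have int: "integrable M (\<lambda>\<omega>. h i (Z \<omega>) * h j (Z \<omega>))" for i j
    using equivariant_measurable_M[OF h] C(1)
    by (intro integrable_bounded_measurable[where C = "C * C"])
      (auto simp: abs_mult intro!: mult_mono C(2))
  have val: "(\<integral>\<omega>. h i (Z \<omega>) * h j (Z \<omega>) \<partial>M) = ?c + (?d - ?c) * of_bool (i = j)" for i j
    using integral_mult_equivariant[OF h, of i j] integral_square_equivariant[OF h, of i]
    by (cases "i = j") (auto simp: power2_eq_square)
  have "(\<integral>\<omega>. (\<Sum>i\<in>I. w i * h i (Z \<omega>))\<^sup>2 \<partial>M)
      = (\<integral>\<omega>. (\<Sum>i\<in>I. \<Sum>j\<in>I. w i * w j * (h i (Z \<omega>) * h j (Z \<omega>))) \<partial>M)"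
    by (simp add: power2_eq_square sum_product mult_ac)
  also have "\<dots> = (\<Sum>i\<in>I. \<Sum>j\<in>I. w i * w j * (\<integral>\<omega>. h i (Z \<omega>) * h j (Z \<omega>) \<partial>M))"
    using int by (simp add: Bochner_Integration.integral_sum)
  also have "\<dots> = (\<Sum>i\<in>I. \<Sum>j\<in>I. w i * w j * (?c + (?d - ?c) * of_bool (i = j)))"
    by (intro sum.cong refl arg_cong2[where f = "(*)"] val)
  also have "\<dots> = (\<Sum>i\<in>I. \<Sum>j\<in>I. w i * w j) * ?c + (?d - ?c) * (\<Sum>i\<in>I. \<Sum>j\<in>I. w i * w j * of_bool (i = j))"
  proof -
    have "w i * w j * (?c + (?d - ?c) * of_bool (i = j))
        = w i * w j * ?c + (?d - ?c) * (w i * w j * of_bool (i = j))" for i j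
      by (simp only: distrib_left mult_ac)
    then show ?thesis by (simp only: sum.distrib sum_distrib_left sum_distrib_right)
  qed
  also have "(\<Sum>i\<in>I. \<Sum>j\<in>I. w i * w j) = (sum w I)\<^sup>2"
    by (simp add: power2_eq_square sum_product)
  also have "(\<Sum>i\<in>I. \<Sum>j\<in>I. w i * w j * of_bool (i = j)) = (\<Sum>i\<in>I. (w i)\<^sup>2)"
    using fin by (intro sum.cong refl) (simp add: power2_eq_square of_bool_def if_distrib cong: if_cong)
  finally show ?thesis using w by simp
qed

text \<open>
  The difference of two means is a linear combination with weights \<open>w\<close> of total mass zero and
  \<open>(\<Sum>i<m. (w i)\<^sup>2) = 1 / n - 1 / m\<close>.
\<close>

lemma integral_running_mean_diff:
  assumes h: "equivariant N h" and nm: "0 < n" "n \<le> m"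
    and C: "\<And>i z. \<bar>h i z\<bar> \<le> C"
  shows "(\<integral>\<omega>. (running_mean (\<lambda>i. h i (Z \<omega>)) n - running_mean (\<lambda>i. h i (Z \<omega>)) m)\<^sup>2 \<partial>M)
    \<le> 2 * C\<^sup>2 / real n"
proof -
  define w where "w i = of_bool (i < n) / real n - 1 / real m" for i
  let ?d = "\<integral>\<omega>. (h 0 (Z \<omega>))\<^sup>2 \<partial>M" and ?c = "\<integral>\<omega>. h 0 (Z \<omega>) * h 1 (Z \<omega>) \<partial>M"
  have sub: "{..<m} \<inter> {i. i < n} = {..<n}" using nm by auto
  have bsum: "(\<Sum>i<m. of_bool (i < n) * g i) = (\<Sum>i<n. g i)" for g :: "nat \<Rightarrow> real"
    using sub by (simp add: of_bool_def if_distrib[of "\<lambda>x. x * _"] sum.If_cases cong: if_cong)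
  have ws: "(\<Sum>i<m. w i * g i) = running_mean g n - running_mean g m" for g
    by (simp add: w_def left_diff_distrib sum_subtractf bsum running_mean_def sum_divide_distrib[symmetric])
  have w0: "sum w {..<m} = 0" using ws[of "\<lambda>_. 1"] nm by (simp add: running_mean_def)
  have "(\<Sum>i<m. (w i)\<^sup>2) = running_mean w n - running_mean w m"
    using ws[of w] by (simp add: power2_eq_square)
  also have "\<dots> = 1 / real n - 1 / real m"
  proof -
    have "sum w {..<n} = 1 - real n / real m" using nm by (simp add: w_def sum_subtractf right_diff_distrib)
    then show ?thesis using nm w0 by (simp add: running_mean_def field_simps)
  qed
  finally have sq: "(\<Sum>i<m. (w i)\<^sup>2) \<le> 1 / real n" by simp
  have sq0: "(\<Sum>i<m. (w i)\<^sup>2) \<ge> 0" by (rule sum_nonneg) simp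
  have "(\<integral>\<omega>. (running_mean (\<lambda>i. h i (Z \<omega>)) n - running_mean (\<lambda>i. h i (Z \<omega>)) m)\<^sup>2 \<partial>M) =
      (?d - ?c) * (\<Sum>i<m. (w i)\<^sup>2)"
    using integral_square_linear_combination[OF h _ w0] by (simp add: ws)
  also have "\<dots> \<le> 2 * C\<^sup>2 * (1 / real n)"
  proof (rule mult_mono)
    have C0: "C \<ge> 0" using C[of 0 undefined] by linarith
    have bd: "\<bar>h i (Z \<omega>) * h j (Z \<omega>)\<bar> \<le> C\<^sup>2" for i j \<omega>
      using C C0 by (simp add: abs_mult power2_eq_square mult_mono)
    have "\<bar>\<integral>\<omega>. h i (Z \<omega>) * h j (Z \<omega>) \<partial>M\<bar> \<le> C\<^sup>2" for i j
    proof -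
      have "norm (\<integral>\<omega>. h i (Z \<omega>) * h j (Z \<omega>) \<partial>M) \<le> (\<integral>\<omega>. norm (h i (Z \<omega>) * h j (Z \<omega>)) \<partial>M)"
        by (rule integral_norm_bound)
      also have "\<dots> \<le> (\<integral>\<omega>. C\<^sup>2 \<partial>M)"
        using equivariant_measurable_M[OF h] bd
        by (intro integral_mono integrable_bounded_measurable[where C = "C\<^sup>2"]) auto
      also have "\<dots> = C\<^sup>2" by (simp add: prob_space)
      finally show ?thesis by simp
    qed
    from this[of 0 0] this[of 0 1] show "?d - ?c \<le> 2 * C\<^sup>2" by (simp add: power2_eq_square)
  qed (use sq sq0 in auto)
  finally show ?thesis by simp
qed

text \<open>
  Along the fourth powers, consecutive means differ in \<open>L\<^sup>2\<close>, hence in \<open>L\<^sup>1\<close>, by \<open>O(1 / n\<^sup>2)\<close>. These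
  bounds are summable, so that the differences are almost surely absolutely summable.
\<close>

lemma running_mean_AE_convergent:
  assumes h: "equivariant N h"
  shows "AE \<omega> in M. convergent (running_mean (\<lambda>i. h i (Z \<omega>)))"
proof -
  obtain C where C: "C > 0" "\<And>i z. \<bar>h i z\<bar> \<le> C" using equivariant_bounded[OF h] by blast
  note [measurable] = equivariant_measurable_M[OF h]
  define a where "a n \<omega> = running_mean (\<lambda>i. h i (Z \<omega>)) (Suc n ^ 4)" for n \<omega>
  define d where "d n \<omega> = \<bar>a (Suc n) \<omega> - a n \<omega>\<bar>" for n \<omega>
  have a_meas [measurable]: "a n \<in> borel_measurable M" for n
    unfolding a_def running_mean_def by measurable
  have d_meas [measurable]: "d n \<in> borel_measurable M" for n
    unfolding d_def by measurable
  have a_bd: "\<bar>a n \<omega>\<bar> \<le> C" for n \<omega>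
    unfolding a_def by (rule abs_running_mean_le) (rule C)
  have d_bd: "\<bar>d n \<omega>\<bar> \<le> 2 * C" for n \<omega>
    using a_bd[of n \<omega>] a_bd[of "Suc n" \<omega>] by (simp add: d_def)
  have d_int: "integrable M (d n)" for n
    by (rule integrable_bounded_measurable[where C = "2 * C"]) (use d_bd in auto)
  have d_sq_int: "integrable M (\<lambda>\<omega>. (d n \<omega>)\<^sup>2)" for n
  proof (rule integrable_bounded_measurable[where C = "(2 * C)\<^sup>2"])
    show "\<bar>(d n \<omega>)\<^sup>2\<bar> \<le> (2 * C)\<^sup>2" for \<omega>
      using power_mono[OF d_bd[of n \<omega>] abs_ge_zero, of 2] by simp
  qed measurable
  have E_sq: "(\<integral>\<omega>. (d n \<omega>)\<^sup>2 \<partial>M) \<le> 2 * C\<^sup>2 / real (Suc n) ^ 4" for n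
  proof -
    have "(\<integral>\<omega>. (d n \<omega>)\<^sup>2 \<partial>M) = (\<integral>\<omega>. (a n \<omega> - a (Suc n) \<omega>)\<^sup>2 \<partial>M)"
      by (simp add: d_def power2_commute)
    also have "\<dots> \<le> 2 * C\<^sup>2 / real (Suc n ^ 4)"
      unfolding a_def by (rule integral_running_mean_diff[OF h _ _ C(2)]) (auto intro!: power_mono)
    finally show ?thesis by simp
  qed
  have E_d: "(\<integral>\<omega>. d n \<omega> \<partial>M) \<le> 2 * C * (1 / real (Suc n) ^ 2)" for n
  proof -
    have "(\<integral>\<omega>. d n \<omega> \<partial>M)\<^sup>2 \<le> (\<integral>\<omega>. (d n \<omega>)\<^sup>2 \<partial>M)"
    proof -
      have "0 \<le> variance (d n)" by (rule variance_positive)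
      also have "\<dots> = (\<integral>\<omega>. (d n \<omega>)\<^sup>2 \<partial>M) - (\<integral>\<omega>. d n \<omega> \<partial>M)\<^sup>2"
        by (rule variance_eq[OF d_int d_sq_int])
      finally show ?thesis by simp
    qed
    also have "\<dots> \<le> (2 * C * (1 / real (Suc n) ^ 2))\<^sup>2"
    proof -
      define s where "s = real (Suc n)"
      have "(\<integral>\<omega>. (d n \<omega>)\<^sup>2 \<partial>M) \<le> 2 * C\<^sup>2 / s ^ 4" using E_sq[of n] unfolding s_def .
      also have "\<dots> \<le> 4 * C\<^sup>2 / s ^ 4" by (intro divide_right_mono) auto
      also have "\<dots> = (2 * C * (1 / s ^ 2))\<^sup>2"
        by (simp add: power_mult_distrib power_divide flip: power_mult)
      finally show ?thesis unfolding s_def .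
    qed
    finally show ?thesis
      by (rule power2_le_imp_le) (use C(1) in simp)
  qed
  have summ: "summable (\<lambda>n. 2 * C * (1 / real (Suc n) ^ 2))"
    using summable_mult[OF summable_ignore_initial_segment[OF inverse_power_summable[of 2], of 1], of "2 * C"]
    by (simp add: inverse_eq_divide)
  have "(\<integral>\<^sup>+\<omega>. (\<Sum>n. ennreal (d n \<omega>)) \<partial>M) = (\<Sum>n. \<integral>\<^sup>+\<omega>. ennreal (d n \<omega>) \<partial>M)"
    by (rule nn_integral_suminf) measurable
  also have "\<dots> = (\<Sum>n. ennreal (\<integral>\<omega>. d n \<omega> \<partial>M))"
    by (intro suminf_cong nn_integral_eq_integral d_int) (simp add: d_def)
  also have "\<dots> \<le> (\<Sum>n. ennreal (2 * C * (1 / real (Suc n) ^ 2)))"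
    by (intro suminf_le ennreal_leI E_d) auto
  also have "\<dots> < \<infinity>"
    by (subst suminf_ennreal2[OF _ summ]) (use C(1) in simp_all)
  finally have "AE \<omega> in M. (\<Sum>n. ennreal (d n \<omega>)) \<noteq> \<infinity>"
    by (intro nn_integral_PInf_AE) (auto simp: less_top)
  then show ?thesis
  proof eventually_elim
    case (elim \<omega>)
    have "summable (\<lambda>n. d n \<omega>)"
      using elim by (intro summable_suminf_not_top) (auto simp: d_def)
    then have "summable (\<lambda>n. a (Suc n) \<omega> - a n \<omega>)"
      unfolding d_def by (rule summable_rabs_cancel)
    then have "convergent (\<lambda>n. \<Sum>i<n. a (Suc i) \<omega> - a i \<omega>)"
      by (simp add: summable_iff_convergent)
    then obtain l where "(\<lambda>n. a n \<omega> - a 0 \<omega>) \<longlonglongrightarrow> l"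
      unfolding sum_lessThan_telescope[of "\<lambda>n. a n \<omega>"] by (auto simp: convergent_def)
    then have "(\<lambda>n. a n \<omega>) \<longlonglongrightarrow> l + a 0 \<omega>"
      using tendsto_add[OF _ tendsto_const, of "\<lambda>n. a n \<omega> - a 0 \<omega>" l sequentially "a 0 \<omega>"] by simp
    then have "(\<lambda>n. running_mean (\<lambda>i. h i (Z \<omega>)) (n ^ 4)) \<longlonglongrightarrow> l + a 0 \<omega>"
      unfolding a_def by (rule LIMSEQ_imp_Suc)
    then have "running_mean (\<lambda>i. h i (Z \<omega>)) \<longlonglongrightarrow> l + a 0 \<omega>"
      by (rule running_mean_convergent_fourth_powers[OF C(2)])
    then show ?case by (auto simp: convergent_def)
  qed
qed

text \<open>
  The limit is invariant under finitary permutations. Over an invariant event the mean has the same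
  integral as every single term, and by dominated convergence so has the limit; this characterizes
  the conditional expectation.
\<close>

theorem law_of_large_numbers:
  assumes h: "equivariant N h"
  shows "AE \<omega> in M. running_mean (\<lambda>m. h m (Z \<omega>)) \<longlonglongrightarrow> real_cond_exp M E (\<lambda>\<omega>. h i (Z \<omega>)) \<omega>"
proof -
  let ?mean = "\<lambda>\<omega>. running_mean (\<lambda>m. h m (Z \<omega>))"
  obtain C where C: "C > 0" "\<And>i z. \<bar>h i z\<bar> \<le> C" using equivariant_bounded[OF h] by blast
  note hP = equivariant_measurable[OF h]
  note [measurable] = equivariant_measurable_M[OF h]
  define L where "L z = lim (running_mean (\<lambda>m. h m z))" for z
  have L_meas: "L \<in> borel_measurable P"
    unfolding L_def running_mean_def using hP by measurable
  have L_inv: "L (perm_act \<sigma> z) = L z" if "permutation \<sigma>" "z \<in> space P" for \<sigma> z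
    unfolding L_def using that
    by (intro lim_cong_eventually)
      (simp add: equivariant_perm_act[OF h] running_mean_permutation[where c = "\<lambda>m. h m z"])
  have LE: "(\<lambda>\<omega>. L (Z \<omega>)) \<in> borel_measurable E"
    by (rule invariant_measurable_E[OF L_meas L_inv])
  have LM [measurable]: "(\<lambda>\<omega>. L (Z \<omega>)) \<in> borel_measurable M"
    by (rule measurable_compose[OF Z_measurable L_meas])
  have conv: "AE \<omega> in M. ?mean \<omega> \<longlonglongrightarrow> L (Z \<omega>)"
    using running_mean_AE_convergent[OF h] by eventually_elim (simp add: L_def convergent_LIMSEQ_iff)
  have "AE \<omega> in M. \<bar>L (Z \<omega>)\<bar> \<le> C"
    using conv
  proof eventually_elim
    case (elim \<omega>)
    then have "(\<lambda>n. \<bar>?mean \<omega> n\<bar>) \<longlonglongrightarrow> \<bar>L (Z \<omega>)\<bar>" by (rule tendsto_rabs)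
    then show ?case by (rule LIMSEQ_le_const2) (auto intro!: abs_running_mean_le C)
  qed
  then have L_int: "integrable M (\<lambda>\<omega>. L (Z \<omega>))"
    by (intro integrable_const_bound[where B = C]) auto
  have h_int: "integrable M (\<lambda>\<omega>. h i (Z \<omega>))" for i
    by (rule integrable_bounded_measurable[where C = C]) (auto simp: C)
  have "AE \<omega> in M. real_cond_exp M E (\<lambda>\<omega>. h i (Z \<omega>)) \<omega> = L (Z \<omega>)"
  proof (rule real_cond_exp_charact[OF _ h_int L_int LE])
    fix B assume B: "B \<in> sets E"
    have BM [measurable]: "B \<in> sets M" using B subalgebra_E by (auto simp: subalgebra_def)
    have ind_int: "integrable M (\<lambda>\<omega>. indicat_real B \<omega> * h m (Z \<omega>))" for m
      using integrable_mult_indicator[OF BM h_int] by simp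
    have mean: "(\<integral>\<omega>. indicat_real B \<omega> * ?mean \<omega> (Suc n) \<partial>M)
        = (\<integral>\<omega>. indicat_real B \<omega> * h i (Z \<omega>) \<partial>M)" for n
    proof -
      have "(\<integral>\<omega>. indicat_real B \<omega> * ?mean \<omega> (Suc n) \<partial>M)
          = (\<integral>\<omega>. (\<Sum>m<Suc n. indicat_real B \<omega> * h m (Z \<omega>)) / real (Suc n) \<partial>M)"
        by (simp add: running_mean_def sum_distrib_left del: sum.lessThan_Suc)
      also have "\<dots> = (\<Sum>m<Suc n. \<integral>\<omega>. indicat_real B \<omega> * h m (Z \<omega>) \<partial>M) / real (Suc n)"
        by (simp only: integral_divide_zero Bochner_Integration.integral_sum[OF ind_int])
      also have "\<dots> = (\<Sum>m<Suc n. \<integral>\<omega>. indicat_real B \<omega> * h i (Z \<omega>) \<partial>M) / real (Suc n)"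
        by (intro arg_cong2[where f = "(/)"] sum.cong refl integral_E_equivariant[OF h B])
      finally show ?thesis by simp
    qed
    have "(\<lambda>n. \<integral>\<omega>. indicat_real B \<omega> * ?mean \<omega> (Suc n) \<partial>M)
        \<longlonglongrightarrow> (\<integral>\<omega>. indicat_real B \<omega> * L (Z \<omega>) \<partial>M)"
    proof (rule integral_dominated_convergence[where w = "\<lambda>_. C"])
      show "AE \<omega> in M. (\<lambda>n. indicat_real B \<omega> * ?mean \<omega> (Suc n))
          \<longlonglongrightarrow> indicat_real B \<omega> * L (Z \<omega>)"
        using conv by eventually_elim (intro tendsto_intros LIMSEQ_Suc)
      show "AE \<omega> in M. norm (indicat_real B \<omega> * ?mean \<omega> (Suc n)) \<le> C" for n
        using abs_running_mean_le[OF C(2)] C(1) by (auto simp: indicator_def)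
      show "(\<lambda>\<omega>. indicat_real B \<omega> * ?mean \<omega> (Suc n)) \<in> borel_measurable M" for n
        unfolding running_mean_def by measurable
    qed auto
    then show "(\<integral>\<omega>\<in>B. h i (Z \<omega>) \<partial>M) = (\<integral>\<omega>\<in>B. L (Z \<omega>) \<partial>M)"
      unfolding mean set_lebesgue_integral_def by (simp add: LIMSEQ_const_iff)
  qed
  with conv show ?thesis by eventually_elim simp
qed

section \<open>Directing measure and conditional independence\<close>

text \<open>
  The directing random measure of de Finetti's theorem, for one set \<open>A\<close> at a time. Truncation to
  \<open>[0, 1]\<close> changes the conditional expectation on a null set only and makes all bounds hold
  everywhere.
\<close>

definition directing :: "'b set \<Rightarrow> 'a \<Rightarrow> real" where
  "directing A \<omega> = max 0 (min 1 (real_cond_exp M E (\<lambda>\<omega>. indicat_real A (Z \<omega> 0)) \<omega>))"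

lemma directing_measurable_E [measurable]: "directing A \<in> borel_measurable E"
  unfolding directing_def by measurable

lemma directing_measurable [measurable]: "directing A \<in> borel_measurable M"
  by (rule measurable_from_subalg[OF subalgebra_E directing_measurable_E])

lemma directing_bounds: "0 \<le> directing A \<omega>" "directing A \<omega> \<le> 1"
  by (auto simp: directing_def)

lemma directing_limit:
  assumes "A \<in> sets N"
  shows "AE \<omega> in M. running_mean (\<lambda>i. indicat_real A (Z \<omega> i)) \<longlonglongrightarrow> directing A \<omega>"
  using law_of_large_numbers[OF equivariant_indicator[OF assms], of 0]
proof eventually_elim
  case (elim \<omega>)
  let ?c = "running_mean (\<lambda>i. indicat_real A (Z \<omega> i))"
  let ?V = "real_cond_exp M E (\<lambda>\<omega>. indicat_real A (Z \<omega> 0)) \<omega>"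
  have "0 \<le> ?c n" for n
    unfolding running_mean_def by (intro divide_nonneg_nonneg sum_nonneg) auto
  then have "0 \<le> ?V" using elim by (intro LIMSEQ_le_const) auto
  moreover have "?c n \<le> 1" for n
    using abs_running_mean_le[of "\<lambda>i. indicat_real A (Z \<omega> i)" 1 n] by (simp add: indicator_def abs_le_iff)
  then have "?V \<le> 1" using elim by (intro LIMSEQ_le_const2) auto
  ultimately show ?case using elim by (simp add: directing_def)
qed

lemma real_cond_exp_directing:
  assumes "A \<in> sets N"
  shows "AE \<omega> in M. real_cond_exp M E (\<lambda>\<omega>. indicat_real A (Z \<omega> i)) \<omega> = directing A \<omega>"
  using directing_limit[OF assms] law_of_large_numbers[OF equivariant_indicator[OF assms], of i]
  by eventually_elim (rule LIMSEQ_unique)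

lemma measurable_component [measurable]: "(\<lambda>\<omega>. Z \<omega> i) \<in> M \<rightarrow>\<^sub>M N"
  by (rule measurable_compose[OF Z_measurable]) simp

text \<open>
  Induction on \<open>J\<close>. Over an invariant event, and in the presence of the factors for \<open>J\<close>, the factor
  for the new index \<open>i\<close> may be replaced by that of any index outside of \<open>J\<close>, hence by the average over
  many indices, hence in the limit by the directing measure. The latter is measurable for the
  exchangeable algebra, and the induction hypothesis applies to the remaining factors.
\<close>

lemma real_cond_exp_prod_directing:
  assumes "finite J" "\<And>j. j \<in> J \<Longrightarrow> A j \<in> sets N"
  shows "AE \<omega> in M. real_cond_exp M E (\<lambda>\<omega>. \<Prod>j\<in>J. indicat_real (A j) (Z \<omega> j)) \<omega>
    = (\<Prod>j\<in>J. directing (A j) \<omega>)"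
  using assms
proof (induction J rule: finite_induct)
  case empty
  show ?case
    using real_cond_exp_F_meas[of "\<lambda>_. 1"] by simp
next
  case (insert i J)
  have A [measurable]: "A i \<in> sets N" and AJ: "\<And>j. j \<in> J \<Longrightarrow> A j \<in> sets N" using insert.prems by auto
  have IH: "AE \<omega> in M. real_cond_exp M E (\<lambda>\<omega>. \<Prod>j\<in>J. indicat_real (A j) (Z \<omega> j)) \<omega>
      = (\<Prod>j\<in>J. directing (A j) \<omega>)"
    using insert.IH AJ by blast
  define G where "G z = (\<Prod>j\<in>J. indicat_real (A j) (z j))" for z
  have G_P [measurable]: "G \<in> borel_measurable P"
    unfolding G_def using AJ by measurable
  have G_M [measurable]: "(\<lambda>\<omega>. G (Z \<omega>)) \<in> borel_measurable M"
    by (rule measurable_compose[OF Z_measurable G_P])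
  have G01: "0 \<le> G z" "G z \<le> 1" for z
    unfolding G_def by (auto intro!: prod_nonneg prod_le_1)
  have bd: "\<bar>x * y\<bar> \<le> 1" if "0 \<le> x" "x \<le> 1" "0 \<le> y" "y \<le> 1" for x y :: real
    using that by (simp add: mult_le_one)
  let ?D = "\<lambda>\<omega>. \<Prod>j\<in>J. directing (A j) \<omega>"
  let ?c = "\<lambda>m \<omega>. indicat_real (A i) (Z \<omega> m)"
  have "AE \<omega> in M. real_cond_exp M E (\<lambda>\<omega>. ?c i \<omega> * G (Z \<omega>)) \<omega>
      = directing (A i) \<omega> * ?D \<omega>"
  proof (rule real_cond_exp_charact)
    show "integrable M (\<lambda>\<omega>. ?c i \<omega> * G (Z \<omega>))"
      by (rule integrable_bounded_measurable[where C = 1]) (auto intro!: bd G01)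
    have D01: "0 \<le> ?D \<omega>" "?D \<omega> \<le> 1" for \<omega>
      by (auto intro!: prod_nonneg prod_le_1 directing_bounds)
    show "integrable M (\<lambda>\<omega>. directing (A i) \<omega> * ?D \<omega>)"
      by (rule integrable_bounded_measurable[where C = 1]) (auto intro!: bd D01 directing_bounds)
    show "(\<lambda>\<omega>. directing (A i) \<omega> * ?D \<omega>) \<in> borel_measurable E"
      by measurable
    fix B assume B: "B \<in> sets E"
    then obtain C where C: "C \<in> sets P" "B = Z -` C \<inter> space M"
      "\<And>\<sigma> z. permutation \<sigma> \<Longrightarrow> z \<in> space P \<Longrightarrow> perm_act \<sigma> z \<in> C \<longleftrightarrow> z \<in> C"
      by (rule E_setE) blast
    have BM [measurable]: "B \<in> sets M" using B subalgebra_E by (auto simp: subalgebra_def)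
    let ?r = "\<lambda>n \<omega>. indicat_real B \<omega> * (running_mean (\<lambda>m. ?c m \<omega>) n * G (Z \<omega>))"
      and ?d = "\<lambda>\<omega>. indicat_real B \<omega> * (directing (A i) \<omega> * G (Z \<omega>))"
    define e where "e m = (\<integral>\<omega>. indicat_real B \<omega> * (?c m \<omega> * G (Z \<omega>)) \<partial>M)" for m
    have int: "integrable M (\<lambda>\<omega>. indicat_real B \<omega> * (?c m \<omega> * G (Z \<omega>)))" for m
      by (rule integrable_bounded_measurable[where C = 1]) (auto intro!: bd G01 mult_le_one mult_nonneg_nonneg)
    have e_eq: "e m = e i" if "m \<notin> J" for m
    proof -
      let ?\<sigma> = "Transposition.transpose i m"
      let ?f = "\<lambda>z. indicat_real C z * (indicat_real (A i) (z i) * G z)"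
      have p: "permutation ?\<sigma>" by (rule permutation_swap_id)
      have f: "?f \<in> borel_measurable P" using C(1) by measurable
      have s: "?\<sigma> j = j" if "j \<in> J" for j
        using that \<open>m \<notin> J\<close> insert.hyps by (metis transpose_apply_other)
      have "e i = (\<integral>\<omega>. ?f (Z \<omega>) \<partial>M)"
        unfolding e_def by (intro Bochner_Integration.integral_cong) (auto simp: C(2) indicator_def)
      also have "\<dots> = (\<integral>\<omega>. ?f (perm_act ?\<sigma> (Z \<omega>)) \<partial>M)"
        by (rule integral_perm[OF f p, symmetric])
      also have "\<dots> = e m"
        unfolding e_def
      proof (intro Bochner_Integration.integral_cong refl)
        fix \<omega> assume w: "\<omega> \<in> space M"
        have "indicat_real C (perm_act ?\<sigma> (Z \<omega>)) = indicat_real B \<omega>"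
          using w C(3)[OF p Z_space[OF w]] by (auto simp: C(2) indicator_def)
        moreover have "perm_act ?\<sigma> (Z \<omega>) i = Z \<omega> m" "G (perm_act ?\<sigma> (Z \<omega>)) = G (Z \<omega>)"
          by (simp_all add: perm_act_def G_def s)
        ultimately show "?f (perm_act ?\<sigma> (Z \<omega>)) = indicat_real B \<omega> * (?c m \<omega> * G (Z \<omega>))"
          by simp
      qed
      finally show ?thesis by simp
    qed
    have "(\<lambda>n. running_mean e (Suc n)) \<longlonglongrightarrow> e i"
    proof -
      obtain K where K: "\<forall>j\<in>J. j < K" using insert.hyps finite_nat_set_iff_bounded by blast
      have "running_mean e \<longlonglongrightarrow> e i"
        by (rule running_mean_eventually_const[where K = K]) (metis e_eq K not_less)
      then show ?thesis by (rule LIMSEQ_Suc)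
    qed
    moreover have "(\<lambda>n. running_mean e (Suc n)) \<longlonglongrightarrow>
        (\<integral>\<omega>. ?d \<omega> \<partial>M)"
    proof -
      have "(\<lambda>n. \<integral>\<omega>. ?r (Suc n) \<omega> \<partial>M) \<longlonglongrightarrow>
          (\<integral>\<omega>. ?d \<omega> \<partial>M)"
      proof (rule integral_dominated_convergence[where w = "\<lambda>_. 1"])
        show "AE \<omega> in M. (\<lambda>n. ?r (Suc n) \<omega>)
            \<longlonglongrightarrow> ?d \<omega>"
          using directing_limit[OF A] by eventually_elim (intro tendsto_intros LIMSEQ_Suc)
        show "AE \<omega> in M. norm (?r (Suc n) \<omega>) \<le> 1" for n
        proof (rule AE_I2)
          fix \<omega>
          have "\<bar>running_mean (\<lambda>m. ?c m \<omega>) (Suc n)\<bar> \<le> 1"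
            by (rule abs_running_mean_le) (simp add: indicator_def)
          then have "\<bar>running_mean (\<lambda>m. ?c m \<omega>) (Suc n)\<bar> * \<bar>G (Z \<omega>)\<bar> \<le> 1"
            using G01[of "Z \<omega>"] by (intro mult_le_one) auto
          then show "norm (?r (Suc n) \<omega>) \<le> 1"
            by (simp add: indicator_def abs_mult)
        qed
        show "(\<lambda>\<omega>. ?r (Suc n) \<omega>) \<in> borel_measurable M" for n
          unfolding running_mean_def by measurable
      qed auto
      moreover have "(\<integral>\<omega>. ?r n \<omega> \<partial>M) = running_mean e n" for n
      proof -
        have "(\<integral>\<omega>. ?r n \<omega> \<partial>M)
          = (\<integral>\<omega>. (\<Sum>m<n. indicat_real B \<omega> * (?c m \<omega> * G (Z \<omega>))) / real n \<partial>M)"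
          unfolding running_mean_def
          by (simp only: sum_distrib_left sum_distrib_right times_divide_eq_right times_divide_eq_left)
        also have "\<dots> = running_mean e n"
          by (simp only: integral_divide_zero Bochner_Integration.integral_sum[OF int] running_mean_def e_def)
        finally show ?thesis .
      qed
      ultimately show ?thesis by simp
    qed
    ultimately have "e i = (\<integral>\<omega>. ?d \<omega> \<partial>M)"
      by (rule LIMSEQ_unique)
    also have "\<dots> = (\<integral>\<omega>. (indicat_real B \<omega> * directing (A i) \<omega>) * G (Z \<omega>) \<partial>M)"
      by (simp add: mult_ac)
    also have "\<dots> = (\<integral>\<omega>. (indicat_real B \<omega> * directing (A i) \<omega>) * real_cond_exp M E (\<lambda>\<omega>. G (Z \<omega>)) \<omega> \<partial>M)"
    proof (rule real_cond_exp_intg(2)[symmetric])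
      show "integrable M (\<lambda>\<omega>. indicat_real B \<omega> * directing (A i) \<omega> * G (Z \<omega>))"
        by (rule integrable_bounded_measurable[where C = 1])
          (auto intro!: bd G01 mult_le_one mult_nonneg_nonneg directing_bounds)
      show "(\<lambda>\<omega>. indicat_real B \<omega> * directing (A i) \<omega>) \<in> borel_measurable E"
        using B by measurable
    qed measurable
    also have "\<dots> = (\<integral>\<omega>. indicat_real B \<omega> * (directing (A i) \<omega> * ?D \<omega>) \<partial>M)"
      using IH unfolding G_def by (intro integral_cong_AE) (auto simp: mult_ac)
    finally show "(\<integral>\<omega>\<in>B. ?c i \<omega> * G (Z \<omega>) \<partial>M) =
        (\<integral>\<omega>\<in>B. directing (A i) \<omega> * ?D \<omega> \<partial>M)"
      by (simp add: e_def set_lebesgue_integral_def)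
  qed
  then show ?case using insert.hyps by (simp add: G_def)
qed

lemma cond_pr_Ball_directing:
  assumes "finite J" "\<And>j. j \<in> J \<Longrightarrow> A j \<in> sets N"
  shows "AE \<omega> in M. cond_pr M E {\<omega>\<in>space M. \<forall>j\<in>J. Z \<omega> j \<in> A j} \<omega> = (\<Prod>j\<in>J. directing (A j) \<omega>)"
proof -
  let ?S = "{\<omega>\<in>space M. \<forall>j\<in>J. Z \<omega> j \<in> A j}" and ?I = "\<lambda>\<omega>. \<Prod>j\<in>J. indicat_real (A j) (Z \<omega> j)"
  have "AE \<omega> in M. cond_pr M E ?S \<omega>
      = real_cond_exp M E ?I \<omega>"
    unfolding cond_pr_def
  proof (rule real_cond_exp_cong)
    have ind: "indicat_real ?S \<omega> = ?I \<omega>"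
      if "\<omega> \<in> space M" for \<omega>
      using that assms(1) by (auto simp: indicator_def prod_zero_iff intro!: prod.neutral[symmetric])
    then show "AE \<omega> in M. indicat_real ?S \<omega> = ?I \<omega>"
      by auto
    show m: "?I \<in> borel_measurable M"
      using assms by measurable
    show "indicat_real ?S \<in> borel_measurable M"
      by (subst measurable_cong[OF ind]) (use m in auto)
  qed
  moreover have "AE \<omega> in M. real_cond_exp M E ?I \<omega>
      = (\<Prod>j\<in>J. directing (A j) \<omega>)"
    using assms by (rule real_cond_exp_prod_directing)
  ultimately show ?thesis by eventually_elim simp
qed

lemma cond_pr_directing:
  assumes "A \<in> sets N"
  shows "AE \<omega> in M. cond_pr M E {\<omega>\<in>space M. Z \<omega> i \<in> A} \<omega> = directing A \<omega>"
  using cond_pr_Ball_directing[of "{i}" "\<lambda>_. A"] assms by simp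

theorem cond_indep: "cond_indep_vars M E N (\<lambda>i \<omega>. Z \<omega> i) UNIV"
  unfolding cond_indep_vars_def
proof (intro allI impI ballI)
  fix J :: "nat set" and A assume J: "finite J" and A: "A \<in> J \<rightarrow> sets N"
  have "AE \<omega> in M. \<forall>j\<in>J. cond_pr M E {\<omega>\<in>space M. Z \<omega> j \<in> A j} \<omega> = directing (A j) \<omega>"
    using J A by (intro AE_finite_allI cond_pr_directing) auto
  moreover have "AE \<omega> in M. cond_pr M E {\<omega>\<in>space M. \<forall>j\<in>J. Z \<omega> j \<in> A j} \<omega>
      = (\<Prod>j\<in>J. directing (A j) \<omega>)"
    using J A by (intro cond_pr_Ball_directing) auto
  ultimately show "AE \<omega> in M. cond_pr M E {\<omega>\<in>space M. \<forall>i\<in>J. Z \<omega> i \<in> A i} \<omega>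
      = (\<Prod>i\<in>J. cond_pr M E {\<omega>\<in>space M. Z \<omega> i \<in> A i} \<omega>)"
    by eventually_elim simp
qed

theorem cond_ident: "cond_ident_distributed M E N (\<lambda>i \<omega>. Z \<omega> i) UNIV"
  unfolding cond_ident_distributed_def
proof (intro ballI)
  fix i j A assume "A \<in> sets N"
  from cond_pr_directing[OF this, of i] cond_pr_directing[OF this, of j]
  show "AE \<omega> in M. cond_pr M E {\<omega>\<in>space M. Z \<omega> i \<in> A} \<omega> = cond_pr M E {\<omega>\<in>space M. Z \<omega> j \<in> A} \<omega>"
    by eventually_elim simp
qed

end

section \<open>Exchangeability of the coordinate paths\<close>

lemma space_seq_space [simp]: "space seq_space = UNIV"
  by (auto simp: seq_space_def space_PiM)

lemma measurable_perm_act_seq_space [measurable]: "perm_act \<sigma> \<in> seq_space \<rightarrow>\<^sub>M seq_space"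
  unfolding seq_space_def by (rule measurable_perm_act)

lemma measurable_seq_space_component [measurable]: "(\<lambda>x. x i) \<in> seq_space \<rightarrow>\<^sub>M count_space UNIV"
  unfolding seq_space_def by simp

lemma image_perm_act_eq_vimage:
  assumes "permutation \<sigma>"
  shows "perm_act \<sigma> ` (perm_act \<sigma> -` A) = (A :: (nat \<Rightarrow> 'k) set)"
proof -
  have "surj (perm_act \<sigma> :: (nat \<Rightarrow> 'k) \<Rightarrow> _)"
  proof (rule surjI)
    show "perm_act \<sigma> (perm_act (inv \<sigma>) x) = x" for x :: "nat \<Rightarrow> 'k"
      using permutation_bijective[OF assms] by (auto simp: perm_act_def bij_def inv_f_f)
  qed
  then show ?thesis by (simp add: surj_image_vimage_eq)
qed

text \<open>
  Two weighted laws that agree on sets agree on functions. The transition kernel produces functions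
  of the state, while its properties are stated for sets.
\<close>

lemma nn_integral_cong_of_indicators:
  assumes [measurable]: "W1 \<in> borel_measurable M" "W2 \<in> borel_measurable M"
    "Y1 \<in> M \<rightarrow>\<^sub>M S" "Y2 \<in> M \<rightarrow>\<^sub>M S" "f \<in> borel_measurable S"
    and eq: "\<And>B. B \<in> sets S \<Longrightarrow>
      (\<integral>\<^sup>+\<omega>. W1 \<omega> * indicator B (Y1 \<omega>) \<partial>M) = (\<integral>\<^sup>+\<omega>. W2 \<omega> * indicator B (Y2 \<omega>) \<partial>M)"
  shows "(\<integral>\<^sup>+\<omega>. W1 \<omega> * f (Y1 \<omega>) \<partial>M) = (\<integral>\<^sup>+\<omega>. W2 \<omega> * f (Y2 \<omega>) \<partial>M)"
proof -
  have "distr (density M W1) S Y1 = distr (density M W2) S Y2"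
  proof (rule measure_eqI)
    fix B assume "B \<in> sets (distr (density M W1) S Y1)"
    then have B [measurable]: "B \<in> sets S" by simp
    have e: "emeasure (distr (density M W) S Y) B = (\<integral>\<^sup>+\<omega>. W \<omega> * indicator B (Y \<omega>) \<partial>M)"
      if [measurable]: "W \<in> borel_measurable M" "Y \<in> M \<rightarrow>\<^sub>M S" for W Y
    proof -
      have "emeasure (distr (density M W) S Y) B = emeasure (density M W) (Y -` B \<inter> space M)"
        by (subst emeasure_distr) auto
      also have "\<dots> = (\<integral>\<^sup>+\<omega>. W \<omega> * indicator (Y -` B \<inter> space M) \<omega> \<partial>M)"
        by (subst emeasure_density) auto
      also have "\<dots> = (\<integral>\<^sup>+\<omega>. W \<omega> * indicator B (Y \<omega>) \<partial>M)"
        by (intro nn_integral_cong) (auto simp: indicator_def)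
      finally show ?thesis .
    qed
    show "emeasure (distr (density M W1) S Y1) B = emeasure (distr (density M W2) S Y2) B"
      by (simp add: e eq)
  qed simp
  then have "(\<integral>\<^sup>+x. f x \<partial>distr (density M W1) S Y1) = (\<integral>\<^sup>+x. f x \<partial>distr (density M W2) S Y2)"
    by simp
  then show ?thesis
    by (simp add: nn_integral_distr nn_integral_density)
qed

locale exchangeable_markov =
  fixes M :: "'a measure"
    and p :: "real \<Rightarrow> (nat \<Rightarrow> 'k::finite) \<Rightarrow> (nat \<Rightarrow> 'k) measure"
    and X :: "real \<Rightarrow> 'a \<Rightarrow> nat \<Rightarrow> 'k"
  assumes exchangeable_markov_process: "exchangeable_markov_process M p X"
begin

sublocale prob_space M
  using exchangeable_markov_process by (simp add: exchangeable_markov_process_def markov_process_def)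

lemma X_measurable: "0 \<le> t \<Longrightarrow> X t \<in> M \<rightarrow>\<^sub>M seq_space"
  using exchangeable_markov_process by (simp add: exchangeable_markov_process_def markov_process_def)

lemma kernel_measurable: "0 \<le> t \<Longrightarrow> p t \<in> seq_space \<rightarrow>\<^sub>M prob_algebra seq_space"
  using exchangeable_markov_process by (simp add: exchangeable_markov_process_def markov_process_def)

lemma measure_kernel_measurable:
  assumes "0 \<le> t" "A \<in> sets seq_space"
  shows "(\<lambda>x. measure (p t x) A) \<in> borel_measurable seq_space"
  by (rule measurable_compose[OF measurable_prob_algebraD[OF kernel_measurable[OF assms(1)]]
        measurable_measure_subprob_algebra[OF assms(2)]])

lemma prob_space_kernel: "0 \<le> t \<Longrightarrow> prob_space (p t x)"
  using measurable_space[OF kernel_measurable, of t x] by (simp add: space_prob_algebra)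

lemma kernel_equivariant:
  assumes "0 \<le> t" "A \<in> sets seq_space" "permutation \<sigma>"
  shows "measure (p t (perm_act \<sigma> x)) A = measure (p t x) (perm_act \<sigma> -` A)"
proof -
  have "perm_act \<sigma> -` A \<in> sets seq_space"
    using measurable_sets[OF measurable_perm_act_seq_space assms(2), of \<sigma>] by simp
  then have "measure (p t (perm_act \<sigma> x)) (perm_act \<sigma> ` (perm_act \<sigma> -` A)) = measure (p t x) (perm_act \<sigma> -` A)"
    using exchangeable_markov_process assms unfolding exchangeable_markov_process_def by blast
  then show ?thesis by (simp only: image_perm_act_eq_vimage[OF assms(3)])
qed

definition "past s = generated_algebra M seq_space {0..s} X"

lemma space_past [simp]: "space (past s) = space M"
  by (simp add: past_def generated_algebra_def)

lemma X_measurable_past: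
  assumes "0 \<le> u" "u \<le> s"
  shows "X u \<in> past s \<rightarrow>\<^sub>M seq_space"
proof -
  have "(\<lambda>\<omega>. \<lambda>t\<in>{0..s}. X t \<omega>) \<in> past s \<rightarrow>\<^sub>M (\<Pi>\<^sub>M t\<in>{0..s}. seq_space)"
    unfolding past_def generated_algebra_def
    by (rule measurable_vimage_algebra1) (auto simp: space_PiM)
  from measurable_compose[OF this measurable_component_singleton[of u]] assms show ?thesis
    by simp
qed

lemma subalgebra_past: "subalgebra M (past s)"
proof -
  have m: "(\<lambda>\<omega>. \<lambda>t\<in>{0..s}. X t \<omega>) \<in> M \<rightarrow>\<^sub>M (\<Pi>\<^sub>M t\<in>{0..s}. seq_space)"
    by (intro measurable_restrict X_measurable) auto
  have "sets (past s) \<subseteq> sets M"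
    unfolding past_def generated_algebra_def
    by (rule sets_image_in_sets) (use m in simp_all)
  then show ?thesis by (simp add: subalgebra_def)
qed

lemma markov_indicator:
  assumes s: "0 \<le> s" "s \<le> t" and D: "D \<in> sets (past s)" and A [measurable]: "A \<in> sets seq_space"
  shows "(\<integral>\<^sup>+\<omega>. indicator D \<omega> * indicator A (X t \<omega>) \<partial>M)
    = (\<integral>\<^sup>+\<omega>. indicator D \<omega> * ennreal (measure (p (t - s) (X s \<omega>)) A) \<partial>M)"
proof -
  interpret past: finite_measure_subalgebra M "past s"
    by unfold_locales (rule subalgebra_past)
  have t: "0 \<le> t - s" "0 \<le> t" using s by auto
  have DM [measurable]: "D \<in> sets M" using D subalgebra_past by (auto simp: subalgebra_def)
  note [measurable] = X_measurable[OF s(1)] X_measurable[OF t(2)] measure_kernel_measurable[OF t(1) A]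
  have ev [measurable]: "{\<omega>\<in>space M. X t \<omega> \<in> A} \<in> sets M" by measurable
  have ae: "AE \<omega> in M. real_cond_exp M (past s) (indicat_real {\<omega>\<in>space M. X t \<omega> \<in> A}) \<omega>
      = measure (p (t - s) (X s \<omega>)) A"
  proof -
    have "AE \<omega> in M. cond_pr M (generated_algebra M seq_space {0..s} X) {\<omega>\<in>space M. X (s + (t - s)) \<omega> \<in> A} \<omega>
        = measure (p (t - s) (X s \<omega>)) A"
      using exchangeable_markov_process s(1) t(1) A
      unfolding exchangeable_markov_process_def markov_process_def by blast
    then show ?thesis by (simp add: cond_pr_def past_def)
  qed
  have "(\<integral>\<omega>. indicat_real D \<omega> * indicat_real {\<omega>\<in>space M. X t \<omega> \<in> A} \<omega> \<partial>M) =
      (\<integral>\<omega>. indicat_real D \<omega> * real_cond_exp M (past s) (indicat_real {\<omega>\<in>space M. X t \<omega> \<in> A}) \<omega> \<partial>M)"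
  proof (rule past.real_cond_exp_intg(2)[symmetric])
    show "integrable M (\<lambda>\<omega>. indicat_real D \<omega> * indicat_real {\<omega>\<in>space M. X t \<omega> \<in> A} \<omega>)"
      by (rule integrable_const_bound[where B = 1]) (auto simp: indicator_def)
  qed (use D in measurable)
  also have "\<dots> = (\<integral>\<omega>. indicat_real D \<omega> * measure (p (t - s) (X s \<omega>)) A \<partial>M)"
    using ae by (intro integral_cong_AE) auto
  finally have eq: "(\<integral>\<omega>. indicat_real D \<omega> * indicat_real {\<omega>\<in>space M. X t \<omega> \<in> A} \<omega> \<partial>M) =
      (\<integral>\<omega>. indicat_real D \<omega> * measure (p (t - s) (X s \<omega>)) A \<partial>M)" .
  have le1: "measure (p (t - s) x) A \<le> 1" for x
    using prob_space.prob_le_1[OF prob_space_kernel[OF t(1)]] .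
  have "(\<integral>\<^sup>+\<omega>. indicator D \<omega> * indicator A (X t \<omega>) \<partial>M) =
      (\<integral>\<^sup>+\<omega>. ennreal (indicat_real D \<omega> * indicat_real {\<omega>\<in>space M. X t \<omega> \<in> A} \<omega>) \<partial>M)"
    by (intro nn_integral_cong) (auto simp: indicator_def)
  also have "\<dots> = ennreal (\<integral>\<omega>. indicat_real D \<omega> * indicat_real {\<omega>\<in>space M. X t \<omega> \<in> A} \<omega> \<partial>M)"
    by (rule nn_integral_eq_integral)
      (auto intro!: integrable_const_bound[where B = 1] simp: indicator_def)
  also have "\<dots> = ennreal (\<integral>\<omega>. indicat_real D \<omega> * measure (p (t - s) (X s \<omega>)) A \<partial>M)"
    by (simp add: eq)
  also have "\<dots> = (\<integral>\<^sup>+\<omega>. ennreal (indicat_real D \<omega> * measure (p (t - s) (X s \<omega>)) A) \<partial>M)"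
    by (rule nn_integral_eq_integral[symmetric])
      (auto intro!: integrable_const_bound[where B = 1] simp: indicator_def le1)
  also have "\<dots> = (\<integral>\<^sup>+\<omega>. indicator D \<omega> * ennreal (measure (p (t - s) (X s \<omega>)) A) \<partial>M)"
    by (intro nn_integral_cong) (auto simp: indicator_def)
  finally show ?thesis .
qed

text \<open>
  Induction on the times, from the last one backwards. Conditioning on the past of the last time \<open>b\<close>
  in \<open>J\<close> replaces the event at the later time \<open>s\<close> by a function of the state at \<open>b\<close>, which has the same
  form on both sides because the kernel commutes with \<open>\<sigma>\<close>.
  This is the reason for carrying along a function \<open>f\<close> of the state at \<open>s\<close>.
\<close>

lemma finite_dimensional_exchangeable:
  assumes "finite J" "\<And>u. u \<in> J \<Longrightarrow> 0 \<le> u" "\<And>u. u \<in> J \<Longrightarrow> A u \<in> sets seq_space"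
    and "0 \<le> s" "\<And>u. u \<in> J \<Longrightarrow> u \<le> s" and f: "f \<in> borel_measurable seq_space" and \<sigma>: "permutation \<sigma>"
  shows "(\<integral>\<^sup>+\<omega>. indicator {\<omega>\<in>space M. \<forall>u\<in>J. perm_act \<sigma> (X u \<omega>) \<in> A u} \<omega> * f (perm_act \<sigma> (X s \<omega>)) \<partial>M)
    = (\<integral>\<^sup>+\<omega>. indicator {\<omega>\<in>space M. \<forall>u\<in>J. X u \<omega> \<in> A u} \<omega> * f (X s \<omega>) \<partial>M)"
  using assms
proof (induction J arbitrary: s f rule: finite_linorder_max_induct)
  case empty
  have base: "(\<integral>\<^sup>+\<omega>. g (perm_act \<sigma> (X 0 \<omega>)) \<partial>M) = (\<integral>\<^sup>+\<omega>. g (X 0 \<omega>) \<partial>M)"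
    if [measurable]: "g \<in> borel_measurable seq_space" for g :: "_ \<Rightarrow> ennreal"
  proof -
    note [measurable] = X_measurable[of 0, simplified]
    have "distr M seq_space (\<lambda>\<omega>. perm_act \<sigma> (X 0 \<omega>)) = distr M seq_space (X 0)"
      using exchangeable_markov_process \<sigma>
      by (simp add: exchangeable_markov_process_def exchangeable_def)
    then have "(\<integral>\<^sup>+x. g x \<partial>distr M seq_space (\<lambda>\<omega>. perm_act \<sigma> (X 0 \<omega>))) = (\<integral>\<^sup>+x. g x \<partial>distr M seq_space (X 0))"
      by simp
    then show ?thesis by (simp add: nn_integral_distr)
  qed
  note [measurable] = X_measurable[OF \<open>0 \<le> s\<close>] \<open>f \<in> borel_measurable seq_space\<close>
  have "(\<integral>\<^sup>+\<omega>. 1 * f (perm_act \<sigma> (X s \<omega>)) \<partial>M) = (\<integral>\<^sup>+\<omega>. 1 * f (X s \<omega>) \<partial>M)"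
  proof (rule nn_integral_cong_of_indicators[where S = seq_space])
    fix B :: "(nat \<Rightarrow> 'k) set" assume B [measurable]: "B \<in> sets seq_space"
    have sB: "perm_act \<sigma> -` B \<in> sets seq_space"
      using measurable_sets[OF measurable_perm_act_seq_space B, of \<sigma>] by simp
    have top: "space M \<in> sets (past 0)" using sets.top[of "past 0"] by simp
    have mk: "(\<integral>\<^sup>+\<omega>. indicator C (X s \<omega>) \<partial>M) = (\<integral>\<^sup>+\<omega>. ennreal (measure (p s (X 0 \<omega>)) C) \<partial>M)"
      if "C \<in> sets seq_space" for C
      using markov_indicator[OF order_refl \<open>0 \<le> s\<close> top that] by (simp cong: nn_integral_cong_simp)
    have "(\<integral>\<^sup>+\<omega>. indicator B (perm_act \<sigma> (X s \<omega>)) \<partial>M) = (\<integral>\<^sup>+\<omega>. indicator (perm_act \<sigma> -` B) (X s \<omega>) \<partial>M)"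
      by (intro nn_integral_cong) (simp add: indicator_def)
    also have "\<dots> = (\<integral>\<^sup>+\<omega>. ennreal (measure (p s (X 0 \<omega>)) (perm_act \<sigma> -` B)) \<partial>M)"
      by (rule mk[OF sB])
    also have "\<dots> = (\<integral>\<^sup>+\<omega>. ennreal (measure (p s (perm_act \<sigma> (X 0 \<omega>))) B) \<partial>M)"
      by (simp add: kernel_equivariant[OF \<open>0 \<le> s\<close> B \<sigma>])
    also have "\<dots> = (\<integral>\<^sup>+\<omega>. ennreal (measure (p s (X 0 \<omega>)) B) \<partial>M)"
      by (rule base) (intro measurable_compose[OF measure_kernel_measurable[OF \<open>0 \<le> s\<close> B]] measurable_ennreal)
    also have "\<dots> = (\<integral>\<^sup>+\<omega>. indicator B (X s \<omega>) \<partial>M)" by (rule mk[OF B, symmetric])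
    finally show "(\<integral>\<^sup>+\<omega>. 1 * indicator B (perm_act \<sigma> (X s \<omega>)) \<partial>M) = (\<integral>\<^sup>+\<omega>. 1 * indicator B (X s \<omega>) \<partial>M)"
      by simp
  qed measurable
  then show ?case by (simp cong: nn_integral_cong_simp)
next
  case (insert b J)
  have b: "0 \<le> b" "b \<le> s" using insert.prems by auto
  have J0: "\<And>u. u \<in> J \<Longrightarrow> 0 \<le> u" and A: "\<And>u. u \<in> insert b J \<Longrightarrow> A u \<in> sets seq_space"
    using insert.prems by auto
  note Ab [measurable] = A[of b, simplified]
  have J_le: "u \<le> b" if "u \<in> J" for u using insert.hyps that by auto
  note [measurable] = X_measurable[OF \<open>0 \<le> s\<close>] X_measurable[OF b(1)] \<open>f \<in> borel_measurable seq_space\<close>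
  let ?W1 = "{\<omega>\<in>space M. \<forall>u\<in>insert b J. perm_act \<sigma> (X u \<omega>) \<in> A u}"
  let ?W2 = "{\<omega>\<in>space M. \<forall>u\<in>insert b J. X u \<omega> \<in> A u}"
  let ?V1 = "{\<omega>\<in>space M. \<forall>u\<in>J. perm_act \<sigma> (X u \<omega>) \<in> A u}"
  let ?V2 = "{\<omega>\<in>space M. \<forall>u\<in>J. X u \<omega> \<in> A u}"
  have pset: "{\<omega>\<in>space M. \<forall>u\<in>K. g (X u \<omega>) \<in> A u} \<in> sets (past b)"
    if "K \<subseteq> insert b J" and [measurable]: "g \<in> seq_space \<rightarrow>\<^sub>M seq_space" for K and g :: "(nat \<Rightarrow> 'k) \<Rightarrow> _"
  proof -
    have "{\<omega>\<in>space (past b). \<forall>u\<in>K. g (X u \<omega>) \<in> A u} \<in> sets (past b)"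
    proof (rule sets.sets_Collect_finite_All)
      show "finite K" using that insert.hyps by (auto intro: finite_subset)
      fix u assume u: "u \<in> K"
      then have uu: "0 \<le> u" "u \<le> b" "u \<in> insert b J" using that(1) J_le J0 b by auto
      note [measurable] = X_measurable_past[OF uu(1,2)] A[OF uu(3)]
      show "{\<omega>\<in>space (past b). g (X u \<omega>) \<in> A u} \<in> sets (past b)" by measurable
    qed
    then show ?thesis by simp
  qed
  have W: "?W1 \<in> sets (past b)" "?W2 \<in> sets (past b)"
    using pset[of "insert b J" "perm_act \<sigma>"] pset[of "insert b J" "\<lambda>x. x"] by auto
  then have WM [measurable]: "?W1 \<in> sets M" "?W2 \<in> sets M"
    using subalgebra_past by (auto simp: subalgebra_def)
  show ?case
  proof (rule nn_integral_cong_of_indicators[where S = seq_space])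
    fix B :: "(nat \<Rightarrow> 'k) set" assume B [measurable]: "B \<in> sets seq_space"
    have sB: "perm_act \<sigma> -` B \<in> sets seq_space"
      using measurable_sets[OF measurable_perm_act_seq_space B, of \<sigma>] by simp
    have sb: "0 \<le> s - b" using b by simp
    define g where "g x = indicator (A b) x * ennreal (measure (p (s - b) x) B)" for x
    have g [measurable]: "g \<in> borel_measurable seq_space"
      unfolding g_def using measure_kernel_measurable[OF sb B] by measurable
    have "(\<integral>\<^sup>+\<omega>. indicator ?W1 \<omega> * indicator B (perm_act \<sigma> (X s \<omega>)) \<partial>M)
        = (\<integral>\<^sup>+\<omega>. indicator ?W1 \<omega> * indicator (perm_act \<sigma> -` B) (X s \<omega>) \<partial>M)"
      by (intro nn_integral_cong) (simp add: indicator_def)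
    also have "\<dots> = (\<integral>\<^sup>+\<omega>. indicator ?W1 \<omega> * ennreal (measure (p (s - b) (X b \<omega>)) (perm_act \<sigma> -` B)) \<partial>M)"
      by (rule markov_indicator[OF b W(1) sB])
    also have "\<dots> = (\<integral>\<^sup>+\<omega>. indicator ?V1 \<omega> * g (perm_act \<sigma> (X b \<omega>)) \<partial>M)"
      unfolding kernel_equivariant[OF sb B \<sigma>, symmetric] g_def
      by (intro nn_integral_cong) (auto simp: indicator_def)
    also have "\<dots> = (\<integral>\<^sup>+\<omega>. indicator ?V2 \<omega> * g (X b \<omega>) \<partial>M)"
      by (rule insert.IH) (use J0 A J_le b \<sigma> g in auto)
    also have "\<dots> = (\<integral>\<^sup>+\<omega>. indicator ?W2 \<omega> * ennreal (measure (p (s - b) (X b \<omega>)) B) \<partial>M)"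
      unfolding g_def by (intro nn_integral_cong) (auto simp: indicator_def)
    also have "\<dots> = (\<integral>\<^sup>+\<omega>. indicator ?W2 \<omega> * indicator B (X s \<omega>) \<partial>M)"
      by (rule markov_indicator[OF b W(2) B, symmetric])
    finally show "(\<integral>\<^sup>+\<omega>. indicator ?W1 \<omega> * indicator B (perm_act \<sigma> (X s \<omega>)) \<partial>M)
        = (\<integral>\<^sup>+\<omega>. indicator ?W2 \<omega> * indicator B (X s \<omega>) \<partial>M)" .
  qed measurable
qed

text \<open>
  The process as a sequence of coordinate paths instead of a path of sequences.
\<close>

definition "paths \<omega> = (\<lambda>i. coord_path X {0..} i \<omega>)"

lemma law_exchangeable:
  assumes \<sigma>: "permutation \<sigma>"
  shows "distr M (\<Pi>\<^sub>M t\<in>{0..}. seq_space) (\<lambda>\<omega>. \<lambda>t\<in>{0..}. perm_act \<sigma> (X t \<omega>))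
    = distr M (\<Pi>\<^sub>M t\<in>{0..}. seq_space) (\<lambda>\<omega>. \<lambda>t\<in>{0..}. X t \<omega>)" (is "?L1 = ?L2")
proof (rule measure_eqI_PiM_infinite)
  let ?L = "\<Pi>\<^sub>M t\<in>{0::real..}. (seq_space :: (nat \<Rightarrow> 'k) measure)"
  have m1: "(\<lambda>\<omega>. \<lambda>t\<in>{0..}. perm_act \<sigma> (X t \<omega>)) \<in> M \<rightarrow>\<^sub>M ?L"
    and m2: "(\<lambda>\<omega>. \<lambda>t\<in>{0..}. X t \<omega>) \<in> M \<rightarrow>\<^sub>M ?L"
    by (intro measurable_restrict measurable_compose[OF X_measurable measurable_perm_act_seq_space]
        X_measurable; simp)+
  show "finite_measure ?L1"
    using prob_space_distr[OF m1] by (simp add: prob_space_def)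
  fix A and J :: "real set" assume J: "finite J" "J \<subseteq> {0..}" "\<And>i. i \<in> J \<Longrightarrow> A i \<in> sets (seq_space :: (nat \<Rightarrow> 'k) measure)"
  (* Any time after those in J would do; 0 makes the maximum exist when J is empty. *)
  define s where "s = Max (insert 0 J)"
  have s: "0 \<le> s" "\<And>u. u \<in> J \<Longrightarrow> u \<le> s" using J(1) by (auto simp: s_def)
  have emb: "prod_emb {0..} (\<lambda>_. seq_space) J (Pi\<^sub>E J A) \<in> sets ?L"
    using J by (intro sets_PiM_I) auto
  have ev: "(\<lambda>\<omega>. \<lambda>t\<in>{0..}. Y t \<omega>) -` prod_emb {0..} (\<lambda>_. seq_space) J (Pi\<^sub>E J A) \<inter> space M
      = {\<omega>\<in>space M. \<forall>u\<in>J. Y u \<omega> \<in> A u}" for Y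
    using J(2) by (auto simp: prod_emb_def PiE_iff restrict_def extensional_def subset_eq)
  have em: "emeasure M {\<omega>\<in>space M. \<forall>u\<in>J. Y u \<omega> \<in> A u}
      = (\<integral>\<^sup>+\<omega>. indicator {\<omega>\<in>space M. \<forall>u\<in>J. Y u \<omega> \<in> A u} \<omega> * 1 \<partial>M)"
    if "\<And>u. u \<in> J \<Longrightarrow> Y u \<in> M \<rightarrow>\<^sub>M seq_space" for Y
  proof -
    have "{\<omega>\<in>space M. \<forall>u\<in>J. Y u \<omega> \<in> A u} \<in> sets M"
      using J that by (intro sets.sets_Collect_finite_All) (auto intro: measurable_sets_Collect)
    then show ?thesis by simp
  qed
  show "emeasure ?L1 (prod_emb {0..} (\<lambda>_. seq_space) J (Pi\<^sub>E J A))
      = emeasure ?L2 (prod_emb {0..} (\<lambda>_. seq_space) J (Pi\<^sub>E J A))"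
    unfolding emeasure_distr[OF m1 emb] emeasure_distr[OF m2 emb] ev
  proof (subst (1 2) em)
    show "(\<integral>\<^sup>+\<omega>. indicator {\<omega>\<in>space M. \<forall>u\<in>J. perm_act \<sigma> (X u \<omega>) \<in> A u} \<omega> * 1 \<partial>M)
        = (\<integral>\<^sup>+\<omega>. indicator {\<omega>\<in>space M. \<forall>u\<in>J. X u \<omega> \<in> A u} \<omega> * 1 \<partial>M)"
      by (rule finite_dimensional_exchangeable[OF J(1) _ J(3) s]) (use J(2) \<sigma> in auto)
  qed (use J(2) in \<open>auto intro!: measurable_compose[OF X_measurable measurable_perm_act_seq_space] X_measurable\<close>)
qed simp_all

sublocale exchangeable_sequence M "path_space {0..}" paths
proof unfold_locales
  let ?L = "\<Pi>\<^sub>M t\<in>{0::real..}. (seq_space :: (nat \<Rightarrow> 'k) measure)"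
  let ?P = "PiM (UNIV :: nat set) (\<lambda>_. path_space {0..} :: (real \<Rightarrow> 'k) measure)"
  define tr :: "(real \<Rightarrow> nat \<Rightarrow> 'k) \<Rightarrow> nat \<Rightarrow> real \<Rightarrow> 'k" where "tr y = (\<lambda>i. \<lambda>t\<in>{0..}. y t i)" for y
  have tr [measurable]: "tr \<in> ?L \<rightarrow>\<^sub>M ?P"
  proof (rule measurable_PiM_single')
    show "(\<lambda>y. tr y i) \<in> ?L \<rightarrow>\<^sub>M path_space {0..}" for i
      unfolding tr_def path_space_def
    proof (rule measurable_restrict)
      show "(\<lambda>y. y t i) \<in> ?L \<rightarrow>\<^sub>M count_space UNIV" if "t \<in> {0..}" for t
        using measurable_compose[OF measurable_component_singleton[OF that] measurable_seq_space_component] .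
    qed
  qed (auto simp: space_PiM tr_def path_space_def)
  have m: "(\<lambda>\<omega>. \<lambda>t\<in>{0..}. X t \<omega>) \<in> M \<rightarrow>\<^sub>M ?L"
    by (intro measurable_restrict X_measurable) simp
  have ms: "(\<lambda>\<omega>. \<lambda>t\<in>{0..}. perm_act \<sigma> (X t \<omega>)) \<in> M \<rightarrow>\<^sub>M ?L" for \<sigma>
    by (intro measurable_restrict measurable_compose[OF X_measurable measurable_perm_act_seq_space]) simp
  have paths: "paths = (\<lambda>\<omega>. tr (\<lambda>t\<in>{0..}. X t \<omega>))"
    by (auto simp: paths_def coord_path_def tr_def fun_eq_iff)
  have perm_paths: "(\<lambda>\<omega>. perm_act \<sigma> (paths \<omega>)) = (\<lambda>\<omega>. tr (\<lambda>t\<in>{0..}. perm_act \<sigma> (X t \<omega>)))" for \<sigma>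
    by (auto simp: paths_def coord_path_def tr_def perm_act_def fun_eq_iff)
  show "paths \<in> M \<rightarrow>\<^sub>M ?P"
    unfolding paths by (rule measurable_compose[OF m tr])
  show "distr M ?P (\<lambda>\<omega>. perm_act \<sigma> (paths \<omega>)) = distr M ?P paths" if "permutation \<sigma>" for \<sigma>
  proof -
    have "distr M ?P (\<lambda>\<omega>. perm_act \<sigma> (paths \<omega>)) = distr (distr M ?L (\<lambda>\<omega>. \<lambda>t\<in>{0..}. perm_act \<sigma> (X t \<omega>))) ?P tr"
      by (subst distr_distr[OF tr ms]) (simp add: perm_paths o_def)
    also have "\<dots> = distr (distr M ?L (\<lambda>\<omega>. \<lambda>t\<in>{0..}. X t \<omega>)) ?P tr"
      by (simp add: law_exchangeable[OF that])
    also have "\<dots> = distr M ?P paths"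
      by (subst distr_distr[OF tr m]) (simp add: paths o_def)
    finally show ?thesis .
  qed
qed

lemma E_eq: "E = exch_algebra M X {0..}"
proof -
  have paths: "paths = (\<lambda>\<omega> i. coord_path X {0..} i \<omega>)"
    by (simp add: paths_def fun_eq_iff)
  have "E = vimage_algebra (space M) paths (invariant_algebra (path_space {0..}))"
    by (rule E_def)
  then show ?thesis by (simp only: exch_algebra_def paths)
qed

text \<open>
  The transposition fixes the state at time \<open>s\<close> on \<open>D\<close>, so that by equivariance of the kernel it
  preserves the conditional law of the state at time \<open>t\<close>.
\<close>

lemma swap_future:
  assumes s: "0 \<le> s" "s \<le> t" and D: "D \<in> sets (past s)" and A: "A \<in> sets seq_space"
    and eq: "\<And>\<omega>. \<omega> \<in> D \<Longrightarrow> X s \<omega> i = X s \<omega> j"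
  shows "prob {\<omega>\<in>D. X t \<omega> \<in> A} = prob {\<omega>\<in>D. perm_act (Transposition.transpose i j) (X t \<omega>) \<in> A}"
proof -
  let ?\<sigma> = "Transposition.transpose i j"
  have sA: "perm_act ?\<sigma> -` A \<in> sets seq_space"
    using measurable_sets[OF measurable_perm_act_seq_space A, of ?\<sigma>] by simp
  have ts: "0 \<le> t - s" "0 \<le> t" using s by auto
  have DM: "D \<in> sets M" using D subalgebra_past by (auto simp: subalgebra_def)
  have ev: "emeasure M {\<omega>\<in>D. X t \<omega> \<in> C} = (\<integral>\<^sup>+\<omega>. indicator D \<omega> * indicator C (X t \<omega>) \<partial>M)"
    if "C \<in> sets seq_space" for C
  proof -
    have "{\<omega>\<in>D. X t \<omega> \<in> C} = D \<inter> (X t -` C \<inter> space M)" using sets.sets_into_space[OF DM] by auto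
    then have "{\<omega>\<in>D. X t \<omega> \<in> C} \<in> sets M"
      using DM measurable_sets[OF X_measurable[OF ts(2)] that] by auto
    then have "emeasure M {\<omega>\<in>D. X t \<omega> \<in> C} = (\<integral>\<^sup>+\<omega>. indicator {\<omega>\<in>D. X t \<omega> \<in> C} \<omega> \<partial>M)" by simp
    also have "\<dots> = (\<integral>\<^sup>+\<omega>. indicator D \<omega> * indicator C (X t \<omega>) \<partial>M)"
      by (intro nn_integral_cong) (auto simp: indicator_def)
    finally show ?thesis .
  qed
  have "measure (p (t - s) (X s \<omega>)) A = measure (p (t - s) (X s \<omega>)) (perm_act ?\<sigma> -` A)" if "\<omega> \<in> D" for \<omega>
  proof -
    have "perm_act ?\<sigma> (X s \<omega>) = X s \<omega>"
      using eq[OF that] by (auto simp: perm_act_def fun_eq_iff Transposition.transpose_def)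
    then show ?thesis using kernel_equivariant[OF ts(1) A permutation_swap_id[of i j], of "X s \<omega>"] by simp
  qed
  then have "(\<integral>\<^sup>+\<omega>. indicator D \<omega> * ennreal (measure (p (t - s) (X s \<omega>)) A) \<partial>M) =
      (\<integral>\<^sup>+\<omega>. indicator D \<omega> * ennreal (measure (p (t - s) (X s \<omega>)) (perm_act ?\<sigma> -` A)) \<partial>M)"
    by (intro nn_integral_cong) (auto simp: indicator_def)
  then have "emeasure M {\<omega>\<in>D. X t \<omega> \<in> A} = emeasure M {\<omega>\<in>D. X t \<omega> \<in> perm_act ?\<sigma> -` A}"
    by (simp only: ev[OF A] ev[OF sA] markov_indicator[OF s D A] markov_indicator[OF s D sA])
  then show ?thesis by (simp add: measure_def)
qed

end

section \<open>The Markov property of the directing measure\<close>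

context exchangeable_markov
begin

lemma space_paths_measure [simp]: "space (path_space T) = (\<Pi>\<^sub>E t\<in>T. UNIV)"
  by (simp add: path_space_def space_PiM)

lemma paths_apply: "0 \<le> t \<Longrightarrow> paths \<omega> i t = X t \<omega> i"
  by (simp add: paths_def coord_path_def)

lemma paths_in_space [simp]: "paths \<omega> i \<in> (\<Pi>\<^sub>E t\<in>{0..}. UNIV)"
  by (auto simp: paths_def coord_path_def)

definition state_at :: "real \<Rightarrow> 'k \<Rightarrow> (real \<Rightarrow> 'k) set" where
  "state_at t a = {y \<in> space (path_space {0..}). y t = a}"

lemma state_at_sets [measurable]:
  assumes "0 \<le> t"
  shows "state_at t a \<in> sets (path_space {0..})"
proof -
  have [measurable]: "(\<lambda>y. y t) \<in> path_space {0..} \<rightarrow>\<^sub>M count_space UNIV"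
    unfolding path_space_def using assms by (intro measurable_component_singleton) auto
  show ?thesis unfolding state_at_def by measurable
qed

lemma paths_in_state_at: "0 \<le> t \<Longrightarrow> paths \<omega> i \<in> state_at t a \<longleftrightarrow> X t \<omega> i = a"
  by (simp add: state_at_def paths_apply)

text \<open>
  A product of directing measures is integrated by giving each factor an index of its own. The square
  of a difference of products of two factors takes four indices.
\<close>

lemma integral_directing_four:
  assumes A: "A0 \<in> sets (path_space {0..})" "A1 \<in> sets (path_space {0..})"
    "A2 \<in> sets (path_space {0..})" "A3 \<in> sets (path_space {0..})"
  shows "(\<integral>\<omega>. directing A0 \<omega> * directing A1 \<omega> * (directing A2 \<omega> * directing A3 \<omega>) \<partial>M)
    = prob {\<omega>\<in>space M. paths \<omega> 0 \<in> A0 \<and> paths \<omega> 1 \<in> A1 \<and> paths \<omega> 2 \<in> A2 \<and> paths \<omega> 3 \<in> A3}"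
proof -
  define A where "A j = [A0, A1, A2, A3] ! j" for j
  let ?J = "{0, 1, 2, 3 :: nat}"
  let ?S = "{\<omega>\<in>space M. \<forall>j\<in>?J. paths \<omega> j \<in> A j}"
  have AJ: "A j \<in> sets (path_space {0..})" if "j \<in> ?J" for j
    using that A by (auto simp: A_def)
  have S [measurable]: "?S \<in> sets M"
    using AJ measurable_component
    by (intro sets.sets_Collect_finite_All) (auto intro: measurable_sets_Collect)
  have "?S \<inter> space M = ?S" by auto
  then have "prob ?S = (\<integral>\<omega>. indicat_real ?S \<omega> \<partial>M)" by (simp only: Bochner_Integration.integral_indicator)
  also have "\<dots> = (\<integral>\<omega>. cond_pr M E ?S \<omega> \<partial>M)"
    unfolding cond_pr_def
    by (rule real_cond_exp_int(2)[symmetric], rule integrable_real_indicator[OF S])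
      (simp add: less_top[symmetric])
  also have "\<dots> = (\<integral>\<omega>. (\<Prod>j\<in>?J. directing (A j) \<omega>) \<partial>M)"
    using cond_pr_Ball_directing[of ?J A] AJ by (intro integral_cong_AE) (auto simp: cond_pr_def)
  finally show ?thesis by (simp add: A_def mult_ac conj_ac)
qed

text \<open>
  For an event \<open>G\<close> of the past of one path that fixes the state \<open>a\<close> at time \<open>s\<close>, this says that the
  proportion of \<open>G\<close> moving on to \<open>b\<close> equals the proportion of all coordinates in state \<open>a\<close> doing so.
  The expected square of the difference expands into four probabilities about coordinates
  0, 1, 2, 3, all of which are in state \<open>a\<close> at time \<open>s\<close>. Swapping the futures of 0 and 1 identifies
  them in pairs of opposite sign.
\<close>

lemma directing_markov:
  assumes s: "0 \<le> s" "s \<le> t"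
    and G: "G \<in> sets (path_space {0..})" "G \<subseteq> state_at s a"
    and G_past: "\<And>i. {\<omega>\<in>space M. paths \<omega> i \<in> G} \<in> sets (past s)"
  shows "AE \<omega> in M. directing (state_at s a) \<omega> * directing (G \<inter> state_at t b) \<omega>
    = directing G \<omega> * directing (state_at s a \<inter> state_at t b) \<omega>"
proof -
  let ?H = "state_at s a" and ?B = "state_at t b"
  have t: "0 \<le> t" using s by simp
  note HB = state_at_sets[OF s(1), of a] state_at_sets[OF t, of b]
  have sets: "G \<inter> ?B \<in> sets (path_space {0..})" "?H \<inter> ?B \<in> sets (path_space {0..})"
    using HB G(1) by auto
  have H_past: "{\<omega>\<in>space M. paths \<omega> i \<in> ?H} \<in> sets (past s)" for i
  proof -
    note [measurable] = X_measurable_past[OF s(1) order_refl]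
    have "{\<omega>\<in>space (past s). X s \<omega> i = a} \<in> sets (past s)" by measurable
    then show ?thesis using s(1) by (simp add: paths_in_state_at)
  qed
  define D where "D = {\<omega>\<in>space M. paths \<omega> 0 \<in> G \<and> paths \<omega> 1 \<in> ?H \<and> paths \<omega> 2 \<in> G \<and> paths \<omega> 3 \<in> ?H}"
  have D: "D \<in> sets (past s)"
  proof -
    have "D = {\<omega>\<in>space M. paths \<omega> 0 \<in> G} \<inter> {\<omega>\<in>space M. paths \<omega> 1 \<in> ?H} \<inter>
        ({\<omega>\<in>space M. paths \<omega> 2 \<in> G} \<inter> {\<omega>\<in>space M. paths \<omega> 3 \<in> ?H})"
      by (auto simp: D_def)
    then show ?thesis using G_past H_past by auto
  qed
  have D_eq: "X s \<omega> 0 = X s \<omega> 1" if "\<omega> \<in> D" for \<omega>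
    using that G(2) s(1) by (auto simp: D_def paths_in_state_at[symmetric])
      (metis paths_in_state_at subsetD)
  have A: "{x. x i = b \<and> x j = b} \<in> sets (seq_space :: (nat \<Rightarrow> 'k) measure)" for i j
  proof -
    have "{x \<in> space seq_space. x i = b \<and> x j = b} \<in> sets (seq_space :: (nat \<Rightarrow> 'k) measure)" by measurable
    then show ?thesis by simp
  qed
  have swap: "prob {\<omega>\<in>D. X t \<omega> 0 = b \<and> X t \<omega> j = b} = prob {\<omega>\<in>D. X t \<omega> 1 = b \<and> X t \<omega> j = b}"
    if "j \<in> {2, 3}" for j
    using swap_future[OF s D A[of 0 j] D_eq] that
    by (auto simp: perm_act_def Transposition.transpose_def)
  have ev: "{\<omega>\<in>space M. paths \<omega> 0 \<in> G \<inter> ?B \<and> paths \<omega> 1 \<in> ?H \<and> paths \<omega> 2 \<in> G \<inter> ?B \<and> paths \<omega> 3 \<in> ?H}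
        = {\<omega>\<in>D. X t \<omega> 0 = b \<and> X t \<omega> 2 = b}"
    "{\<omega>\<in>space M. paths \<omega> 0 \<in> G \<inter> ?B \<and> paths \<omega> 1 \<in> ?H \<and> paths \<omega> 2 \<in> G \<and> paths \<omega> 3 \<in> ?H \<inter> ?B}
        = {\<omega>\<in>D. X t \<omega> 0 = b \<and> X t \<omega> 3 = b}"
    "{\<omega>\<in>space M. paths \<omega> 0 \<in> G \<and> paths \<omega> 1 \<in> ?H \<inter> ?B \<and> paths \<omega> 2 \<in> G \<inter> ?B \<and> paths \<omega> 3 \<in> ?H}
        = {\<omega>\<in>D. X t \<omega> 1 = b \<and> X t \<omega> 2 = b}"
    "{\<omega>\<in>space M. paths \<omega> 0 \<in> G \<and> paths \<omega> 1 \<in> ?H \<inter> ?B \<and> paths \<omega> 2 \<in> G \<and> paths \<omega> 3 \<in> ?H \<inter> ?B}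
        = {\<omega>\<in>D. X t \<omega> 1 = b \<and> X t \<omega> 3 = b}"
    using t by (auto simp: D_def paths_in_state_at)
  let ?h = "directing ?H" and ?g = "directing G" and ?hb = "directing (?H \<inter> ?B)" and ?gb = "directing (G \<inter> ?B)"
  have int: "integrable M (\<lambda>\<omega>. directing A0 \<omega> * directing A1 \<omega> * (directing A2 \<omega> * directing A3 \<omega>))" for A0 A1 A2 A3
    by (rule integrable_bounded_measurable[where C = 1])
      (auto simp: abs_mult intro!: mult_le_one mult_nonneg_nonneg directing_bounds simp: directing_bounds abs_of_nonneg)
  have sq: "(?h \<omega> * ?gb \<omega> - ?g \<omega> * ?hb \<omega>)\<^sup>2 =
      (?gb \<omega> * ?h \<omega> * (?gb \<omega> * ?h \<omega>) - ?gb \<omega> * ?h \<omega> * (?g \<omega> * ?hb \<omega>))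
      - (?g \<omega> * ?hb \<omega> * (?gb \<omega> * ?h \<omega>) - ?g \<omega> * ?hb \<omega> * (?g \<omega> * ?hb \<omega>))" for \<omega>
    by (simp add: power2_eq_square algebra_simps)
  have "(\<integral>\<omega>. (?h \<omega> * ?gb \<omega> - ?g \<omega> * ?hb \<omega>)\<^sup>2 \<partial>M) = 0"
    unfolding sq
    by (simp only: Bochner_Integration.integral_diff Bochner_Integration.integrable_diff int
        integral_directing_four HB G(1) sets ev swap insert_iff simp_thms)
  moreover have "integrable M (\<lambda>\<omega>. (?h \<omega> * ?gb \<omega> - ?g \<omega> * ?hb \<omega>)\<^sup>2)"
    unfolding sq by (intro Bochner_Integration.integrable_diff int)
  ultimately have "AE \<omega> in M. (?h \<omega> * ?gb \<omega> - ?g \<omega> * ?hb \<omega>)\<^sup>2 = 0"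
    by (subst (asm) integral_nonneg_eq_0_iff_AE) auto
  then show ?thesis by eventually_elim simp
qed

end

section \<open>Right-continuity of the directing measure at all times\<close>

text \<open>
  The path is seen to change in \<open>(u, v]\<close>. Looking at rational times only makes this an event of the
  product algebra; a jump exactly at \<open>u\<close> is excluded on purpose, for \<open>u\<close> will be a time at which many
  coordinates jump.
\<close>

definition jumps :: "(real \<Rightarrow> 'k) \<Rightarrow> real \<Rightarrow> real \<Rightarrow> bool" where
  "jumps y u v \<longleftrightarrow> (\<exists>p\<in>\<rat> \<inter> {0..}. \<exists>q\<in>\<rat> \<inter> {0..}. u < p \<and> p \<le> v \<and> u < q \<and> q \<le> v \<and> y p \<noteq> y q)"

lemma jumps_mono: "jumps y u v \<Longrightarrow> u' \<le> u \<Longrightarrow> v \<le> v' \<Longrightarrow> jumps y u' v'"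
  unfolding jumps_def by (meson le_less_trans order_trans)

lemma constant_if_no_jumps:
  assumes y: "cadlag_coordinate y" and u: "0 \<le> u" "u \<le> w" "w < v" and n: "\<not> jumps y u v"
  shows "y w = y u"
proof -
  have right: "\<exists>p\<in>\<rat> \<inter> {0..}. x < p \<and> p < v \<and> y p = y x" if x: "u \<le> x" "x < v" for x
  proof -
    have "eventually (\<lambda>r. y r = y x) (at_right x)"
      using y u x unfolding cadlag_coordinate_def by auto
    then obtain d where d: "d > x" "\<And>r. x < r \<Longrightarrow> r < d \<Longrightarrow> y r = y x"
      unfolding eventually_at_right_field by blast
    obtain p where "p \<in> \<rat>" "x < p" "p < min d v" using Rats_dense_in_real[of x "min d v"] d(1) x by auto
    then show ?thesis using d u x by (intro bexI[of _ p]) auto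
  qed
  obtain p where p: "p \<in> \<rat> \<inter> {0..}" "w < p" "p < v" "y p = y w" using right[of w] u by auto
  obtain q where q: "q \<in> \<rat> \<inter> {0..}" "u < q" "q < v" "y q = y u" using right[of u] u by auto
  have "y p = y q"
  proof (rule ccontr)
    assume "y p \<noteq> y q"
    then have "jumps y u v" unfolding jumps_def using p q u by (intro bexI[of _ p] bexI[of _ q]) auto
    with n show False by simp
  qed
  with p q show ?thesis by simp
qed

text \<open>
  The upper density of the coordinates that jump in \<open>(u, v]\<close> is essentially at most \<open>\<epsilon>\<close>. Stating it
  through \<open>eventually\<close> makes it exactly invariant under finitary permutations.
\<close>

definition thin :: "real \<Rightarrow> real \<Rightarrow> real \<Rightarrow> (nat \<Rightarrow> real \<Rightarrow> 'k) \<Rightarrow> bool" where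
  "thin \<epsilon> u v z \<longleftrightarrow> eventually (\<lambda>n. running_mean (\<lambda>i. of_bool (jumps (z i) u v)) n \<le> \<epsilon>) sequentially"

lemma thin_mono:
  assumes "thin \<epsilon> u v z" "u \<le> u'" "v' \<le> v"
  shows "thin \<epsilon> u' v' z"
  using assms(1) unfolding thin_def
proof eventually_elim
  case (elim n)
  have "running_mean (\<lambda>i. of_bool (jumps (z i) u' v')) n \<le> running_mean (\<lambda>i. of_bool (jumps (z i) u v)) n"
    by (rule running_mean_mono) (use jumps_mono assms in \<open>auto simp: of_bool_def\<close>)
  with elim show ?case by simp
qed

lemma thin_perm_act:
  assumes "permutation \<sigma>"
  shows "thin \<epsilon> u v (perm_act \<sigma> z) \<longleftrightarrow> thin \<epsilon> u v z"
  unfolding thin_def perm_act_def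
  by (rule eventually_cong[OF eventually_mono[OF running_mean_permutation[OF assms,
        where c = "\<lambda>i. of_bool (jumps (z i) u v)"]] ]) auto

lemma thin_of_limit:
  assumes "running_mean (\<lambda>i. of_bool (jumps (z i) u v)) \<longlonglongrightarrow> l" "l < \<epsilon>"
  shows "thin \<epsilon> u v z"
  using order_tendstoD(2)[OF assms] unfolding thin_def by (rule eventually_mono) simp

text \<open>
  Candidate lengths of a time step. The maximal length exceeds \<open>T\<close>, so that a step that ends before
  \<open>T\<close> has not been cut off.
\<close>

definition steps :: "real \<Rightarrow> real set" where "steps T = \<rat> \<inter> {0<..T + 1}"

text \<open>
  The next time is as late as possible subject to \<open>thin\<close> on every shorter step. Using a supremum of
  lengths lets the time land exactly on a simultaneous jump of many coordinates, which no
  approximation from below could pass.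
\<close>

fun stop :: "real \<Rightarrow> real \<Rightarrow> nat \<Rightarrow> (nat \<Rightarrow> real \<Rightarrow> 'k) \<Rightarrow> real" where
  "stop \<epsilon> T 0 z = 0"
| "stop \<epsilon> T (Suc j) z = stop \<epsilon> T j z +
    (SUP h\<in>steps T. if thin \<epsilon> (stop \<epsilon> T j z) (stop \<epsilon> T j z + h) z then h else 0)"

declare stop.simps(2) [simp del]

lemma steps_bdd: "bdd_above ((\<lambda>h. if Q h then h else 0) ` steps T)"
proof (cases "steps T = {}")
  case False
  then have "0 \<le> T + 1" by (auto simp: steps_def)
  then show ?thesis by (intro bdd_aboveI[of _ "T + 1"]) (auto simp: steps_def)
qed simp

lemma steps_nonempty: "0 \<le> T \<Longrightarrow> steps T \<noteq> {}"
  using Rats_dense_in_real[of 0 "T + 1"] by (auto simp: steps_def)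

lemma steps_SUP_nonneg:
  assumes "0 \<le> T"
  shows "0 \<le> (SUP h\<in>steps T. if Q h then h else 0)"
proof -
  obtain h where h: "h \<in> steps T" using steps_nonempty[OF assms] by blast
  have "0 \<le> (if Q h then h else 0)" using h by (auto simp: steps_def)
  also have "\<dots> \<le> (SUP h\<in>steps T. if Q h then h else 0)" by (rule cSUP_upper[OF h steps_bdd])
  finally show ?thesis .
qed

lemma stop_Suc_ge: "0 \<le> T \<Longrightarrow> stop \<epsilon> T j z \<le> stop \<epsilon> T (Suc j) z"
  unfolding stop.simps using steps_SUP_nonneg by simp

lemma stop_incseq: "0 \<le> T \<Longrightarrow> incseq (\<lambda>j. stop \<epsilon> T j z)"
  by (rule incseq_SucI) (rule stop_Suc_ge)

lemma stop_nonneg: "0 \<le> T \<Longrightarrow> 0 \<le> stop \<epsilon> T j z"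
  using incseqD[OF stop_incseq, of T 0 j \<epsilon> z] by simp

lemma stop_perm_act:
  assumes "permutation \<sigma>"
  shows "stop \<epsilon> T j (perm_act \<sigma> z) = stop \<epsilon> T j z"
  by (induction j) (simp_all add: stop.simps(2) thin_perm_act[OF assms])

text \<open>
  By maximality more than a proportion \<open>\<epsilon>\<close> jumps, once the step is prolonged beyond the next time.
\<close>

lemma not_thin_after_stop:
  assumes T: "0 \<le> T" "stop \<epsilon> T (Suc j) z \<le> T" and c: "0 < c"
  shows "\<not> thin \<epsilon> (stop \<epsilon> T j z) (stop \<epsilon> T (Suc j) z + c) z"
proof
  let ?u = "stop \<epsilon> T j z"
  let ?d = "SUP h\<in>steps T. if thin \<epsilon> ?u (?u + h) z then h else 0"
  assume th: "thin \<epsilon> ?u (stop \<epsilon> T (Suc j) z + c) z"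
  have Suc_eq: "stop \<epsilon> T (Suc j) z = ?u + ?d" by (rule stop.simps)
  have d: "?d \<le> T" using T(2) stop_nonneg[OF T(1), of \<epsilon> j z] unfolding Suc_eq by linarith
  have d0: "0 \<le> ?d" by (rule steps_SUP_nonneg[OF T(1)])
  obtain h where h: "h \<in> \<rat>" "?d < h" "h < min (T + 1) (?d + c)"
    using Rats_dense_in_real[of ?d "min (T + 1) (?d + c)"] d c by auto
  then have hs: "h \<in> steps T" using d0 by (auto simp: steps_def)
  have "thin \<epsilon> ?u (?u + h) z"
    using th by (rule thin_mono) (use h in \<open>simp_all only: Suc_eq min_less_iff_conj, linarith+\<close>)
  then have "h \<le> ?d" using cSUP_upper[OF hs steps_bdd, of "\<lambda>h. thin \<epsilon> ?u (?u + h) z"] by simp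
  with h show False by simp
qed

text \<open>
  The time \<open>t\<close> lies in a step \<open>[u, u + d)\<close>, and some admissible length \<open>h\<close> satisfies \<open>t < u + h\<close>; then
  \<open>(t, u + h]\<close> is contained in the thin interval \<open>(u, u + h]\<close>.
\<close>

lemma thin_before_stop:
  assumes T: "0 \<le> T" and t: "0 \<le> t" "t < stop \<epsilon> T j z"
  shows "\<exists>t'>t. thin \<epsilon> t t' z"
  using t(2)
proof (induction j)
  case 0
  with t show ?case by simp
next
  case (Suc j)
  show ?case
  proof (cases "t < stop \<epsilon> T j z")
    case True
    with Suc.IH show ?thesis by blast
  next
    case False
    let ?u = "stop \<epsilon> T j z"
    have "t - ?u < (SUP h\<in>steps T. if thin \<epsilon> ?u (?u + h) z then h else 0)"
      using Suc.prems unfolding stop.simps by linarith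
    from less_cSUP_iff[OF steps_nonempty[OF T] steps_bdd, THEN iffD1, OF this]
    obtain h where h: "h \<in> steps T" "t - ?u < (if thin \<epsilon> ?u (?u + h) z then h else 0)" ..
    have "thin \<epsilon> ?u (?u + h) z" using h(2) False by (cases "thin \<epsilon> ?u (?u + h) z") simp_all
    moreover have "t < ?u + h" using h(2) calculation by simp
    moreover have "thin \<epsilon> t (?u + h) z" by (rule thin_mono[OF calculation(1)]) (use False in auto)
    ultimately show ?thesis by blast
  qed
qed

text \<open>
  A cadlag path with finitely many jumps in bounded time is constant just before the limit of the
  times, and just after it by right-continuity. The second is used when the times become stationary.
\<close>

lemma eventually_no_jumps_below_limit:
  assumes y: "cadlag_coordinate y" and inc: "incseq \<tau>" and nn: "\<And>j. 0 \<le> \<tau> j" and bd: "\<And>j. \<tau> j \<le> T"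
  shows "eventually (\<lambda>j. \<exists>k. \<not> jumps y (\<tau> j) (\<tau> (Suc j) + 1 / real (Suc k))) sequentially"
proof -
  obtain l where l: "\<tau> \<longlonglongrightarrow> l" "\<And>j. \<tau> j \<le> l"
    using incseq_convergent[OF inc, of T] bd by blast
  have l0: "0 \<le> l" using l(2)[of 0] nn[of 0] by simp
  show ?thesis
  proof (cases "\<exists>j. \<tau> j = l")
    case True
    then obtain j0 where j0: "\<tau> j0 = l" by blast
    have tl: "\<tau> j = l" if "j \<ge> j0" for j
      using incseqD[OF inc that] l(2)[of j] j0 by simp
    have "eventually (\<lambda>r. y r = y l) (at_right l)"
      using y l0 unfolding cadlag_coordinate_def by auto
    then obtain d where d: "d > l" "\<And>r. l < r \<Longrightarrow> r < d \<Longrightarrow> y r = y l"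
      unfolding eventually_at_right_field by blast
    obtain k where k: "1 / real (Suc k) < d - l" using d(1) nat_approx_posE[of "d - l"] by auto
    have "\<not> jumps y l (l + 1 / real (Suc k))"
      unfolding jumps_def
    proof (intro notI, elim bexE conjE)
      fix p q assume pq: "l < p" "p \<le> l + 1 / real (Suc k)" "l < q" "q \<le> l + 1 / real (Suc k)" "y p \<noteq> y q"
      then have "p < d" "q < d" using k by linarith+
      then have "y p = y l" "y q = y l" using pq by (auto intro: d(2))
      with pq show False by simp
    qed
    then show ?thesis
      unfolding eventually_sequentially using tl by (intro exI[of _ j0] allI impI exI[of _ k]) simp
  next
    case False
    then have lt: "\<tau> j < l" for j using l(2)[of j] by (metis less_le)
    obtain D where D: "finite D" "\<And>s t. 0 \<le> s \<Longrightarrow> s \<le> t \<Longrightarrow> t \<le> l \<Longrightarrow> {s..t} \<inter> D = {} \<Longrightarrow> y s = y t"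
      using y l0 unfolding cadlag_coordinate_def by metis
    (* The last jump time before l; the value -1, below all times, covers the case of no jump. *)
    define m where "m = Max (insert (-1) (D \<inter> {..<l}))"
    have m: "m < l" "\<And>x. x \<in> D \<Longrightarrow> x < l \<Longrightarrow> x \<le> m"
    proof -
      have "m \<in> insert (-1) (D \<inter> {..<l})" unfolding m_def by (rule Max_in) (use D(1) in auto)
      then show "m < l" using l0 by auto
      show "x \<le> m" if "x \<in> D" "x < l" for x
        unfolding m_def by (rule Max_ge) (use D(1) that in auto)
    qed
    have "eventually (\<lambda>j. m < \<tau> j) sequentially" using order_tendstoD(1)[OF l(1) m(1)] .
    then show ?thesis
    proof eventually_elim
      case (elim j)
      obtain k where k: "1 / real (Suc k) < l - \<tau> (Suc j)"
        using lt[of "Suc j"] nat_approx_posE[of "l - \<tau> (Suc j)"] by auto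
      have const: "y x = y (\<tau> j)" if "\<tau> j < x" "x < l" for x
      proof (rule D(2)[symmetric])
        show "{\<tau> j..x} \<inter> D = {}" using m(2) elim that by fastforce
      qed (use nn that in auto)
      have "\<not> jumps y (\<tau> j) (\<tau> (Suc j) + 1 / real (Suc k))"
        unfolding jumps_def
      proof (intro notI, elim bexE conjE)
        fix p q assume pq: "\<tau> j < p" "p \<le> \<tau> (Suc j) + 1 / real (Suc k)"
          "\<tau> j < q" "q \<le> \<tau> (Suc j) + 1 / real (Suc k)" "y p \<noteq> y q"
        then have "p < l" "q < l" using k by linarith+
        then have "y p = y (\<tau> j)" "y q = y (\<tau> j)" using pq by (auto intro!: const)
        with pq show False by simp
      qed
      then show ?case by blast
    qed
  qed
qed

context exchangeable_markov
begin

lemma measurable_path_component: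
  assumes "0 \<le> t"
  shows "(\<lambda>z. z i t) \<in> P \<rightarrow>\<^sub>M count_space UNIV"
proof (rule measurable_compose[of "\<lambda>z. z i" P "path_space {0..}"])
  show "(\<lambda>y. y t) \<in> path_space {0..} \<rightarrow>\<^sub>M count_space UNIV"
    unfolding path_space_def using assms by (intro measurable_component_singleton) auto
qed simp

lemma pred_jumps:
  assumes [measurable]: "f \<in> borel_measurable P" "g \<in> borel_measurable P"
  shows "Measurable.pred P (\<lambda>z. jumps (z i) (f z) (g z))"
proof -
  have ne: "Measurable.pred P (\<lambda>z. z i q \<noteq> z i r)" if "0 \<le> q" "0 \<le> r" for q r
  proof -
    note [measurable] = measurable_path_component[OF that(1)] measurable_path_component[OF that(2)]
    have "Measurable.pred P (\<lambda>z. \<exists>a\<in>UNIV. z i q = a \<and> z i r \<noteq> a)"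
      by (intro pred_intros_finite) measurable
    then show ?thesis by simp
  qed
  have c: "countable (\<rat> \<inter> {0::real..})" by (simp add: countable_rat)
  have "{z \<in> space P. \<exists>q\<in>\<rat> \<inter> {0..}. \<exists>r\<in>\<rat> \<inter> {0..}.
      f z < q \<and> q \<le> g z \<and> f z < r \<and> r \<le> g z \<and> z i q \<noteq> z i r} \<in> sets P"
  proof (intro sets.sets_Collect_countable_Ex'[OF _ c])
    fix q r :: real assume "q \<in> \<rat> \<inter> {0..}" "r \<in> \<rat> \<inter> {0..}"
    then have [measurable]: "Measurable.pred P (\<lambda>z. z i q \<noteq> z i r)" by (intro ne) auto
    show "{z \<in> space P. f z < q \<and> q \<le> g z \<and> f z < r \<and> r \<le> g z \<and> z i q \<noteq> z i r} \<in> sets P"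
      by measurable
  qed
  then show ?thesis unfolding jumps_def pred_def .
qed

lemma pred_thin:
  assumes "f \<in> borel_measurable P" "g \<in> borel_measurable P"
  shows "Measurable.pred P (\<lambda>z. thin \<epsilon> (f z) (g z) z)"
proof -
  note [measurable] = pred_jumps[OF assms]
  show ?thesis unfolding thin_def eventually_sequentially running_mean_def by measurable
qed

lemma countable_steps: "countable (steps T)"
  unfolding steps_def by (simp add: countable_rat)

lemma stop_measurable: "stop \<epsilon> T j \<in> borel_measurable P"
proof (induction j)
  case (Suc j)
  note [measurable] = Suc
  have "(\<lambda>z. if thin \<epsilon> (stop \<epsilon> T j z) (stop \<epsilon> T j z + h) z then h else 0) \<in> borel_measurable P" for h
  proof -
    have [measurable]: "Measurable.pred P (\<lambda>z. thin \<epsilon> (stop \<epsilon> T j z) (stop \<epsilon> T j z + h) z)"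
      by (intro pred_thin) measurable
    show ?thesis by measurable
  qed
  then have "(\<lambda>z. SUP h\<in>steps T. if thin \<epsilon> (stop \<epsilon> T j z) (stop \<epsilon> T j z + h) z then h else 0)
      \<in> borel_measurable P"
    by (intro borel_measurable_cSUP countable_steps steps_bdd)
  then have "(\<lambda>z. stop \<epsilon> T (Suc j) z) \<in> borel_measurable P"
    unfolding stop.simps by (intro borel_measurable_add Suc)
  then show ?case .
qed simp

text \<open>
  The law of large numbers for jumps between two symmetric random times: where the density of the
  jumping coordinates exceeds \<open>\<epsilon>\<close>, so does the conditional probability that coordinate 0 jumps.
\<close>

lemma not_thin_prob:
  assumes f: "f \<in> borel_measurable P" "\<And>\<sigma> z. permutation \<sigma> \<Longrightarrow> f (perm_act \<sigma> z) = f z"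
    and g: "g \<in> borel_measurable P" "\<And>\<sigma> z. permutation \<sigma> \<Longrightarrow> g (perm_act \<sigma> z) = g z"
    and B: "B \<in> sets E" "\<And>\<omega>. \<omega> \<in> B \<Longrightarrow> \<not> thin \<epsilon> (f (paths \<omega>)) (g (paths \<omega>)) (paths \<omega>)"
  shows "\<epsilon> * prob B \<le> prob {\<omega>\<in>B. jumps (paths \<omega> 0) (f (paths \<omega>)) (g (paths \<omega>))}"
proof -
  let ?J = "{\<omega>\<in>B. jumps (paths \<omega> 0) (f (paths \<omega>)) (g (paths \<omega>))}"
  define h :: "nat \<Rightarrow> (nat \<Rightarrow> real \<Rightarrow> 'k) \<Rightarrow> real" where "h i z = of_bool (jumps (z i) (f z) (g z))" for i z
  note [measurable] = pred_jumps[OF f(1) g(1)]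
  have h: "equivariant (path_space {0..}) h"
    unfolding equivariant_def
  proof (intro conjI allI ballI impI)
    show "h i \<in> borel_measurable P" for i unfolding h_def by measurable
    show "\<exists>C. \<forall>i z. \<bar>h i z\<bar> \<le> C" by (rule exI[of _ 1]) (simp add: h_def)
  qed (simp add: h_def f(2) g(2), simp add: perm_act_def)
  note [measurable] = equivariant_measurable_M[OF h]
  have BM [measurable]: "B \<in> sets M" using B subalgebra_E by (auto simp: subalgebra_def)
  have h_int: "integrable M (\<lambda>\<omega>. h 0 (paths \<omega>))"
    by (rule integrable_bounded_measurable[where C = 1]) (auto simp: h_def)
  let ?L = "real_cond_exp M E (\<lambda>\<omega>. h 0 (paths \<omega>))"
  have L_int: "integrable M ?L" by (rule real_cond_exp_int(1)[OF h_int])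
  have "AE \<omega> in M. \<epsilon> * indicat_real B \<omega> \<le> indicat_real B \<omega> * ?L \<omega>"
    using law_of_large_numbers[OF h, of 0]
  proof eventually_elim
    case (elim \<omega>)
    have "\<epsilon> \<le> ?L \<omega>" if "\<omega> \<in> B"
      using B(2)[OF that] thin_of_limit[OF elim[unfolded h_def]] unfolding h_def by (meson not_le)
    then show ?case by (auto simp: indicator_def)
  qed
  then have "(\<integral>\<omega>. \<epsilon> * indicat_real B \<omega> \<partial>M) \<le> (\<integral>\<omega>. indicat_real B \<omega> * ?L \<omega> \<partial>M)"
    using integrable_mult_indicator[OF BM L_int]
    by (intro integral_mono_AE) (auto simp: less_top[symmetric])
  also have "\<dots> = (\<integral>\<omega>. indicat_real B \<omega> * h 0 (paths \<omega>) \<partial>M)"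
    using real_cond_exp_intA[OF h_int B(1)] by (simp add: set_lebesgue_integral_def)
  also have "\<dots> = (\<integral>\<omega>. indicat_real ?J \<omega> \<partial>M)"
    by (intro Bochner_Integration.integral_cong) (auto simp: h_def indicator_def)
  also have "\<dots> = prob ?J"
  proof -
    have "?J \<inter> space M =
        ?J"
      using sets.sets_into_space[OF BM] by auto
    then show ?thesis by simp
  qed
  finally show ?thesis using sets.sets_into_space[OF BM] by (simp add: Int_absorb2)
qed

end

locale cadlag_exchangeable_markov = exchangeable_markov +
  assumes cadlag: "AE \<omega> in M. cadlag_path (\<lambda>t. X t \<omega>)"
begin

lemma cadlag_paths: "AE \<omega> in M. \<forall>i. cadlag_coordinate (paths \<omega> i)"
  using cadlag
proof eventually_elim
  case (elim \<omega>)
  have "cadlag_coordinate (paths \<omega> i)" for i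
  proof -
    have c: "cadlag_coordinate (\<lambda>t. X t \<omega> i)" using elim by (simp add: cadlag_path_def)
    show ?thesis
      unfolding cadlag_coordinate_def
    proof (intro conjI allI impI)
      fix T :: real assume "0 \<le> T"
      then obtain D where D: "finite D"
        "\<And>s t. 0 \<le> s \<Longrightarrow> s \<le> t \<Longrightarrow> t \<le> T \<Longrightarrow> {s..t} \<inter> D = {} \<Longrightarrow> X s \<omega> i = X t \<omega> i"
        using c unfolding cadlag_coordinate_def by metis
      show "\<exists>D. finite D \<and> (\<forall>s t. 0 \<le> s \<and> s \<le> t \<and> t \<le> T \<and> {s..t} \<inter> D = {} \<longrightarrow> paths \<omega> i s = paths \<omega> i t)"
        using D by (intro exI[of _ D]) (auto simp: paths_apply)
    next
      fix t :: real assume t: "0 \<le> t"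
      then have "eventually (\<lambda>u. X u \<omega> i = X t \<omega> i) (at_right t)"
        using c unfolding cadlag_coordinate_def by auto
      moreover have "eventually (\<lambda>u. t < u) (at_right t)" by (rule eventually_at_right_less)
      ultimately show "eventually (\<lambda>u. paths \<omega> i u = paths \<omega> i t) (at_right t)"
        by eventually_elim (use t in \<open>simp add: paths_apply\<close>)
    qed
  qed
  then show ?case by blast
qed

text \<open>
  On the event \<open>B\<close> that the times stay below \<open>T\<close>, every step sees coordinate 0 jump with conditional
  probability at least \<open>\<epsilon>\<close>. But coordinate 0 jumps in finitely many steps only, and so the probability
  of a jump in the \<open>j\<close>-th step within \<open>B\<close> tends to 0.
\<close>

lemma stop_unbounded:
  assumes \<epsilon>: "0 < \<epsilon>" and T: "0 \<le> T"
  shows "AE \<omega> in M. \<exists>j. T < stop \<epsilon> T j (paths \<omega>)"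
proof -
  let ?J = "\<lambda>j k \<omega>. jumps (paths \<omega> 0) (stop \<epsilon> T j (paths \<omega>))
      (stop \<epsilon> T (Suc j) (paths \<omega>) + 1 / real (Suc k))"
  note [measurable] = stop_measurable
  define B where "B = {\<omega>\<in>space M. \<forall>j. stop \<epsilon> T j (paths \<omega>) \<le> T}"
  have BE: "B \<in> sets E"
  proof -
    have "(\<lambda>\<omega>. \<forall>j. stop \<epsilon> T j (paths \<omega>) \<le> T) \<in> E \<rightarrow>\<^sub>M count_space UNIV"
      by (rule invariant_measurable_E) (measurable, simp add: stop_perm_act)
    then have "{\<omega>\<in>space E. \<forall>j. stop \<epsilon> T j (paths \<omega>) \<le> T} \<in> sets E" by (rule predE)
    then show ?thesis by (simp add: B_def)
  qed
  have BM [measurable]: "B \<in> sets M" using BE subalgebra_E by (auto simp: subalgebra_def)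
  define S where "S j k = {\<omega>\<in>B. ?J j k \<omega>}" for j k
  have S_sets [measurable]: "S j k \<in> sets M" for j k
  proof -
    have [measurable]: "Measurable.pred P (\<lambda>z. jumps (z 0) (stop \<epsilon> T j z) (stop \<epsilon> T (Suc j) z + 1 / real (Suc k)))"
      by (intro pred_jumps borel_measurable_add stop_measurable borel_measurable_const)
    have "Measurable.pred M (\<lambda>\<omega>. ?J j k \<omega>)"
      by (rule measurable_compose[OF Z_measurable]) measurable
    then have "B \<inter> {\<omega>\<in>space M. ?J j k \<omega>} \<in> sets M"
      by (intro sets.Int BM predE)
    moreover have "S j k = B \<inter> {\<omega>\<in>space M. ?J j k \<omega>}"
      unfolding S_def using sets.sets_into_space[OF BM] by blast
    ultimately show ?thesis by (simp only:)
  qed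
  have le: "\<epsilon> * prob B \<le> prob (S j k)" for j k
    unfolding S_def
  proof (rule not_thin_prob[OF _ _ _ _ BE])
    show "(\<lambda>z. stop \<epsilon> T (Suc j) z + 1 / real (Suc k)) \<in> borel_measurable P"
      by (intro borel_measurable_add stop_measurable borel_measurable_const)
    show "\<not> thin \<epsilon> (stop \<epsilon> T j (paths \<omega>)) (stop \<epsilon> T (Suc j) (paths \<omega>) + 1 / real (Suc k)) (paths \<omega>)"
      if "\<omega> \<in> B" for \<omega>
    proof (rule not_thin_after_stop[OF T])
      show "stop \<epsilon> T (Suc j) (paths \<omega>) \<le> T" using that unfolding B_def by blast
    qed simp
  qed (simp_all only: stop_measurable stop_perm_act)
  define R where "R j = (\<Inter>k. S j k)" for j
  have R_sets [measurable]: "R j \<in> sets M" for j unfolding R_def by measurable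
  (* The prolongation 1 / Suc k of the step is removed: R j is the event that coordinate 0 jumps
     in the j-th step or exactly at its end. *)
  have leR: "\<epsilon> * prob B \<le> prob (R j)" for j
  proof -
    have "decseq (S j)"
    proof (rule decseq_SucI)
      show "S j (Suc k) \<subseteq> S j k" for k
        unfolding S_def by (auto elim!: jumps_mono intro!: divide_left_mono)
    qed
    then have "(\<lambda>k. prob (S j k)) \<longlonglongrightarrow> prob (R j)"
      unfolding R_def by (intro finite_Lim_measure_decseq) auto
    then show ?thesis by (rule LIMSEQ_le_const) (use le in auto)
  qed
  have "(\<lambda>j. \<integral>\<omega>. indicat_real (R j) \<omega> \<partial>M) \<longlonglongrightarrow> (\<integral>\<omega>. 0 \<partial>M)"
  proof (rule integral_dominated_convergence[where w = "\<lambda>_. 1"])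
    show "AE \<omega> in M. (\<lambda>j. indicat_real (R j) \<omega>) \<longlonglongrightarrow> 0"
      using cadlag_paths
    proof eventually_elim
      case (elim \<omega>)
      show ?case
      proof (cases "\<omega> \<in> B")
        case False
        then have "\<omega> \<notin> R j" for j by (auto simp: R_def S_def)
        then show ?thesis by simp
      next
        case True
        then have "stop \<epsilon> T j (paths \<omega>) \<le> T" for j unfolding B_def by blast
        then have "eventually (\<lambda>j. \<exists>k. \<not> ?J j k \<omega>) sequentially"
          by (intro eventually_no_jumps_below_limit[where T = T] stop_incseq[OF T] stop_nonneg[OF T])
            (use elim in auto)
        then have "eventually (\<lambda>j. indicat_real (R j) \<omega> = 0) sequentially"
          by eventually_elim (auto simp: R_def S_def)
        then show ?thesis by (rule tendsto_eventually)
      qed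
    qed
  qed (auto simp: indicator_def)
  then have "(\<lambda>j. prob (R j)) \<longlonglongrightarrow> 0"
    using sets.sets_into_space[OF R_sets] by (simp add: Int_absorb2)
  then have "\<epsilon> * prob B \<le> 0" by (rule LIMSEQ_le_const) (use leR in auto)
  then have "prob B = 0" using \<epsilon> measure_nonneg[of M B] by (simp add: mult_le_0_iff)
  then have "AE \<omega> in M. \<omega> \<notin> B" using prob_eq_0[OF BM] by simp
  with AE_space show ?thesis
    by eventually_elim (auto simp: B_def not_le)
qed

lemma thin_everywhere:
  "AE \<omega> in M. \<forall>t\<ge>0. \<forall>\<epsilon>>0. \<exists>t'>t. thin \<epsilon> t t' (paths \<omega>)"
proof -
  have "AE \<omega> in M. \<forall>n. \<exists>j. real n < stop (1 / real (Suc n)) (real n) j (paths \<omega>)"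
    unfolding AE_all_countable by (intro allI stop_unbounded) auto
  then show ?thesis
  proof eventually_elim
    case (elim \<omega>)
    show ?case
    proof (intro allI impI)
      fix t \<epsilon> :: real assume t: "0 \<le> t" and e: "0 < \<epsilon>"
      obtain k where k: "1 / real (Suc k) < \<epsilon>" using nat_approx_posE[OF e] by auto
      obtain m :: nat where m: "t \<le> real m" using real_arch_simple by blast
      define n where "n = max k m"
      have "1 / real (Suc n) \<le> 1 / real (Suc k)" by (rule divide_left_mono) (auto simp: n_def)
      then have n: "t \<le> real n" "1 / real (Suc n) \<le> \<epsilon>" using k m by (auto simp: n_def)
      obtain j where "real n < stop (1 / real (Suc n)) (real n) j (paths \<omega>)" using elim by blast
      then obtain t' where t': "t' > t" "thin (1 / real (Suc n)) t t' (paths \<omega>)"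
        using thin_before_stop[of "real n" t "1 / real (Suc n)" j "paths \<omega>"] n t by auto
      from t'(2) have "thin \<epsilon> t t' (paths \<omega>)"
        unfolding thin_def by (rule eventually_mono) (use n(2) in linarith)
      with t' show "\<exists>t'>t. thin \<epsilon> t t' (paths \<omega>)" by blast
    qed
  qed
qed

lemma right_stable:
  "AE \<omega> in M. \<forall>t\<ge>0. \<forall>\<epsilon>>0. \<exists>t'>t. \<forall>\<^sub>F n in sequentially.
    running_mean (\<lambda>i. of_bool (\<exists>w\<in>{t..<t'}. X w \<omega> i \<noteq> X t \<omega> i)) n \<le> \<epsilon>"
  using thin_everywhere cadlag_paths
proof eventually_elim
  case (elim \<omega>)
  show ?case
  proof (intro allI impI)
    fix t \<epsilon> :: real assume t: "0 \<le> t" and e: "0 < \<epsilon>"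
    then obtain t' where t': "t' > t" "thin \<epsilon> t t' (paths \<omega>)" using elim(1) by blast
    have "(\<exists>w\<in>{t..<t'}. X w \<omega> i \<noteq> X t \<omega> i) \<longrightarrow> jumps (paths \<omega> i) t t'" for i
    proof (intro impI, rule ccontr)
      assume "\<exists>w\<in>{t..<t'}. X w \<omega> i \<noteq> X t \<omega> i" and nj: "\<not> jumps (paths \<omega> i) t t'"
      then obtain w where w: "t \<le> w" "w < t'" "X w \<omega> i \<noteq> X t \<omega> i" by auto
      have "paths \<omega> i w = paths \<omega> i t"
        using elim(2) t w nj by (intro constant_if_no_jumps[where v = t']) auto
      with w t show False by (simp add: paths_apply)
    qed
    then have le: "running_mean (\<lambda>i. of_bool (\<exists>w\<in>{t..<t'}. X w \<omega> i \<noteq> X t \<omega> i)) n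
        \<le> running_mean (\<lambda>i. of_bool (jumps (paths \<omega> i) t t')) n" for n
      by (intro running_mean_mono of_bool_mono)
    have "\<forall>\<^sub>F n in sequentially.
        running_mean (\<lambda>i. of_bool (\<exists>w\<in>{t..<t'}. X w \<omega> i \<noteq> X t \<omega> i)) n \<le> \<epsilon>"
      using t'(2) unfolding thin_def by (rule eventually_mono) (rule order_trans[OF le])
    with t'(1) show "\<exists>t'>t. \<forall>\<^sub>F n in sequentially.
        running_mean (\<lambda>i. of_bool (\<exists>w\<in>{t..<t'}. X w \<omega> i \<noteq> X t \<omega> i)) n \<le> \<epsilon>"
      by blast
  qed
qed

end

section \<open>Limiting frequencies at all times and their transition matrices\<close>

definition has_freq :: "(nat \<Rightarrow> bool) \<Rightarrow> bool" where
  "has_freq A \<longleftrightarrow> convergent (running_mean (\<lambda>i. of_bool (A i)))"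

definition freq :: "(nat \<Rightarrow> bool) \<Rightarrow> real" where
  "freq A = lim (running_mean (\<lambda>i. of_bool (A i)))"

lemma has_freqD: "has_freq A \<Longrightarrow> running_mean (\<lambda>i. of_bool (A i)) \<longlonglongrightarrow> freq A"
  by (simp add: has_freq_def freq_def convergent_LIMSEQ_iff)

lemma freqI:
  assumes "running_mean (\<lambda>i. of_bool (A i)) \<longlonglongrightarrow> l"
  shows "has_freq A" "freq A = l"
  using assms by (auto simp: has_freq_def freq_def convergent_def limI)

lemma freq_permutation:
  assumes "permutation \<sigma>"
  shows "freq (\<lambda>i. A (\<sigma> i)) = freq A"
  unfolding freq_def
  by (intro lim_cong_eventually running_mean_permutation[OF assms, where c = "\<lambda>i. of_bool (A i)"])

lemma freq_mono:
  assumes "has_freq A" "has_freq B" "\<And>i. A i \<Longrightarrow> B i"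
  shows "freq A \<le> freq B"
  by (rule LIMSEQ_le[OF has_freqD[OF assms(1)] has_freqD[OF assms(2)]])
    (use assms(3) in \<open>auto intro!: running_mean_mono of_bool_mono\<close>)

lemma freq_False: "has_freq (\<lambda>i. False)" "freq (\<lambda>i. False) = 0"
proof -
  have "running_mean (\<lambda>i. of_bool False) = (\<lambda>_. 0)" by (simp add: running_mean_def fun_eq_iff)
  then have "running_mean (\<lambda>i. of_bool False) \<longlonglongrightarrow> 0" by simp
  then show "has_freq (\<lambda>i. False)" "freq (\<lambda>i. False) = 0" by (rule freqI)+
qed

lemma freq_True: "has_freq (\<lambda>i. True)" "freq (\<lambda>i. True) = 1"
proof -
  have "running_mean (\<lambda>i. of_bool True) \<longlonglongrightarrow> 1"
    by (rule running_mean_eventually_const[of 0]) simp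
  then show "has_freq (\<lambda>i. True)" "freq (\<lambda>i. True) = 1" by (rule freqI)+
qed

lemma freq_nonneg: "has_freq A \<Longrightarrow> 0 \<le> freq A"
  using freq_mono[OF freq_False(1), of A] by (simp add: freq_False)

lemma freq_le_1: "has_freq A \<Longrightarrow> freq A \<le> 1"
  using freq_mono[OF _ freq_True(1), of A] by (simp add: freq_True)

text \<open>
  Marginals: the finitely many values of \<open>y\<close> partition the indices.
\<close>

lemma freq_sum:
  fixes y :: "nat \<Rightarrow> 'k::finite"
  assumes "\<And>c. has_freq (\<lambda>i. A i \<and> y i = c)"
  shows "has_freq A" "(\<Sum>c\<in>UNIV. freq (\<lambda>i. A i \<and> y i = c)) = freq A"
proof -
  have "running_mean (\<lambda>i. of_bool (A i)) = (\<lambda>n. \<Sum>c\<in>UNIV. running_mean (\<lambda>i. of_bool (A i \<and> y i = c)) n)"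
  proof
    fix n
    have "(\<Sum>c\<in>UNIV. running_mean (\<lambda>i. of_bool (A i \<and> y i = c)) n)
        = (\<Sum>i<n. \<Sum>c\<in>UNIV. of_bool (A i \<and> y i = c)) / real n"
      unfolding running_mean_def sum_divide_distrib[symmetric] by (subst sum.swap) (rule refl)
    also have "(\<Sum>i<n. \<Sum>c\<in>UNIV. of_bool (A i \<and> y i = c)) = (\<Sum>i<n. of_bool (A i) :: real)"
    proof (rule sum.cong)
      fix i
      have "(\<Sum>c\<in>UNIV. of_bool (A i \<and> y i = c)) = (\<Sum>c\<in>{y i}. of_bool (A i) :: real)"
        by (rule sum.mono_neutral_cong_right) auto
      then show "(\<Sum>c\<in>UNIV. of_bool (A i \<and> y i = c)) = (of_bool (A i) :: real)" by simp
    qed simp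
    finally show "running_mean (\<lambda>i. of_bool (A i)) n = (\<Sum>c\<in>UNIV. running_mean (\<lambda>i. of_bool (A i \<and> y i = c)) n)"
      by (simp add: running_mean_def)
  qed
  moreover have "(\<lambda>n. \<Sum>c\<in>UNIV. running_mean (\<lambda>i. of_bool (A i \<and> y i = c)) n)
      \<longlonglongrightarrow> (\<Sum>c\<in>UNIV. freq (\<lambda>i. A i \<and> y i = c))"
    by (intro tendsto_sum has_freqD assms)
  ultimately have "running_mean (\<lambda>i. of_bool (A i)) \<longlonglongrightarrow> (\<Sum>c\<in>UNIV. freq (\<lambda>i. A i \<and> y i = c))"
    by simp
  then show "has_freq A" "(\<Sum>c\<in>UNIV. freq (\<lambda>i. A i \<and> y i = c)) = freq A"
    by (rule freqI, rule freqI(2)[symmetric])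
qed

lemma convergent_of_uniform_approximations:
  fixes c :: "nat \<Rightarrow> real"
  assumes "\<And>\<epsilon>. 0 < \<epsilon> \<Longrightarrow> \<exists>d. convergent d \<and> (\<forall>\<^sub>F n in sequentially. \<bar>c n - d n\<bar> \<le> \<epsilon>)"
  shows "convergent c"
proof (rule Cauchy_convergent, rule metric_CauchyI)
  fix e :: real assume e: "0 < e"
  then obtain d where d: "convergent d" "\<forall>\<^sub>F n in sequentially. \<bar>c n - d n\<bar> \<le> e / 4"
    using assms[of "e / 4"] by auto
  obtain N1 where N1: "\<And>n. n \<ge> N1 \<Longrightarrow> \<bar>c n - d n\<bar> \<le> e / 4"
    using d(2) unfolding eventually_sequentially by blast
  have "Cauchy d" using d(1) by (rule convergent_Cauchy)
  then obtain N2 where N2: "\<And>m n. m \<ge> N2 \<Longrightarrow> n \<ge> N2 \<Longrightarrow> dist (d m) (d n) < e / 4"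
    using metric_CauchyD[of d "e / 4"] e by auto
  show "\<exists>N. \<forall>m\<ge>N. \<forall>n\<ge>N. dist (c m) (c n) < e"
  proof (intro exI[of _ "max N1 N2"] allI impI)
    fix m n assume "max N1 N2 \<le> m" "max N1 N2 \<le> n"
    then have "\<bar>c m - d m\<bar> \<le> e / 4" "\<bar>c n - d n\<bar> \<le> e / 4" "\<bar>d m - d n\<bar> < e / 4"
      using N1[of m] N1[of n] N2[of m n] by (auto simp: dist_real_def)
    then show "dist (c m) (c n) < e" unfolding dist_real_def using e by linarith
  qed
qed

text \<open>
  Right-continuity in a form that transfers limits from rational to real times: few coordinates
  change immediately after any given time.
\<close>

definition right_stable_array :: "(real \<Rightarrow> nat \<Rightarrow> 'k) \<Rightarrow> bool" where
  "right_stable_array x \<longleftrightarrow> (\<forall>t\<ge>0. \<forall>\<epsilon>>0. \<exists>t'>t. \<forall>\<^sub>F n in sequentially.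
    running_mean (\<lambda>i. of_bool (\<exists>w\<in>{t..<t'}. x w i \<noteq> x t i)) n \<le> \<epsilon>)"

abbreviation triple_mean ::
    "(real \<Rightarrow> nat \<Rightarrow> 'k) \<Rightarrow> ('k \<Rightarrow> 'k \<Rightarrow> 'k \<Rightarrow> bool) \<Rightarrow> real \<Rightarrow> real \<Rightarrow> real \<Rightarrow> nat \<Rightarrow> real" where
  "triple_mean x \<phi> r s t \<equiv> running_mean (\<lambda>i. of_bool (\<phi> (x r i) (x s i) (x t i)))"

text \<open>
  All rational times are taken slightly to the right of the given ones, in the same order. The bound
  is uniform in \<open>\<phi>\<close>: both sides differ only at indices that change state in between.
\<close>

lemma rational_approximation:
  fixes x :: "real \<Rightarrow> nat \<Rightarrow> 'k"
  assumes stable: "right_stable_array x" and rst: "0 \<le> r" "r \<le> s" "s \<le> t" and \<epsilon>: "0 < \<epsilon>"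
  obtains r' s' t' where "r' \<in> \<rat>" "s' \<in> \<rat>" "t' \<in> \<rat>" "0 \<le> r'" "r' \<le> s'" "s' \<le> t'"
    "\<And>\<phi>. \<forall>\<^sub>F n in sequentially. \<bar>triple_mean x \<phi> r s t n
        - triple_mean x \<phi> r' s' t' n\<bar> \<le> \<epsilon>"
proof -
  (* e u v marks the indices that leave their state at time u before time v. *)
  define e where "e u v i = (of_bool (\<exists>w\<in>{u..<v}. x w i \<noteq> x u i) :: real)" for u v i
  have e_nonneg: "0 \<le> e u v i" for u v i unfolding e_def by (rule zero_less_eq_of_bool)
  have e_1: "e u v i = 1" if "w \<in> {u..<v}" "x w i \<noteq> x u i" for u v w i
    unfolding e_def using that by (subst of_bool_eq_1_iff) blast
  have st: "\<exists>v>u. \<forall>\<^sub>F n in sequentially. running_mean (e u v) n \<le> \<epsilon> / 3" if "0 \<le> u" for u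
    using stable[unfolded right_stable_array_def, rule_format, OF that, of "\<epsilon> / 3"] \<epsilon>
    unfolding e_def by simp
  obtain vr where vr: "vr > r" "\<forall>\<^sub>F n in sequentially. running_mean (e r vr) n \<le> \<epsilon> / 3" using st rst by blast
  obtain vs where vs: "vs > s" "\<forall>\<^sub>F n in sequentially. running_mean (e s vs) n \<le> \<epsilon> / 3" using st[of s] rst by auto
  obtain vt where vt: "vt > t" "\<forall>\<^sub>F n in sequentially. running_mean (e t vt) n \<le> \<epsilon> / 3" using st[of t] rst by auto
  define \<delta> where "\<delta> = min (vr - r) (min (vs - s) (vt - t))"
  have \<delta>: "0 < \<delta>" "r + \<delta> \<le> vr" "s + \<delta> \<le> vs" "t + \<delta> \<le> vt" using vr vs vt by (auto simp: \<delta>_def)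
  have "r < r + \<delta>" using \<delta>(1) by simp
  then obtain r' where r': "r' \<in> \<rat>" "r < r'" "r' < r + \<delta>" using Rats_dense_in_real by blast
  have "max s r' < s + \<delta>" using \<delta>(1) r' rst by simp
  then obtain s' where s': "s' \<in> \<rat>" "max s r' < s'" "s' < s + \<delta>" using Rats_dense_in_real by blast
  have "max t s' < t + \<delta>" using \<delta>(1) s' rst by simp
  then obtain t' where t': "t' \<in> \<rat>" "max t s' < t'" "t' < t + \<delta>" using Rats_dense_in_real by blast
  show thesis
  proof (rule that[OF r'(1) s'(1) t'(1)])
    show "0 \<le> r'" "r' \<le> s'" "s' \<le> t'" using r' s' t' rst by auto
    fix \<phi> :: "'k \<Rightarrow> 'k \<Rightarrow> 'k \<Rightarrow> bool"
    have "\<bar>of_bool (\<phi> (x r i) (x s i) (x t i)) - (of_bool (\<phi> (x r' i) (x s' i) (x t' i)) :: real)\<bar>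
        \<le> e r vr i + (e s vs i + e t vt i)" for i
    proof (cases "x r' i = x r i \<and> x s' i = x s i \<and> x t' i = x t i")
      case True
      then have "\<bar>of_bool (\<phi> (x r i) (x s i) (x t i)) - (of_bool (\<phi> (x r' i) (x s' i) (x t' i)) :: real)\<bar> = 0"
        by (simp only: diff_self abs_zero)
      also have "0 \<le> e r vr i + (e s vs i + e t vt i)" by (intro add_nonneg_nonneg e_nonneg)
      finally show ?thesis .
    next
      case False
      have "e r vr i = 1 \<or> e s vs i = 1 \<or> e t vt i = 1"
      proof -
        have "r' \<in> {r..<vr}" "s' \<in> {s..<vs}" "t' \<in> {t..<vt}" using r' s' t' \<delta> by auto
        with False show ?thesis using e_1 by metis
      qed
      moreover have "0 \<le> e r vr i" "0 \<le> e s vs i" "0 \<le> e t vt i" by (rule e_nonneg)+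
      ultimately have "1 \<le> e r vr i + (e s vs i + e t vt i)"
        by (elim disjE) linarith+
      moreover have "\<bar>of_bool p - (of_bool q :: real)\<bar> \<le> 1" for p q by simp
      ultimately show ?thesis by (meson order_trans)
    qed
    then have le: "\<bar>triple_mean x \<phi> r s t n
        - triple_mean x \<phi> r' s' t' n\<bar>
        \<le> running_mean (e r vr) n + (running_mean (e s vs) n + running_mean (e t vt) n)" for n
      unfolding running_mean_add[symmetric] by (rule abs_running_mean_diff_le)
    show "\<forall>\<^sub>F n in sequentially. \<bar>triple_mean x \<phi> r s t n
        - triple_mean x \<phi> r' s' t' n\<bar> \<le> \<epsilon>"
      using vr(2) vs(2) vt(2)
    proof eventually_elim
      case (elim n)
      then show ?case using le[of n] by linarith
    qed
  qed
qed

text \<open>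
  The empirical three-time law of the array exists and makes the past and the future conditionally
  independent given the present. The identity is written without division since \<open>x s i = c\<close> may have
  frequency 0.
\<close>

definition markov_at :: "(real \<Rightarrow> nat \<Rightarrow> 'k) \<Rightarrow> real \<Rightarrow> real \<Rightarrow> real \<Rightarrow> bool" where
  "markov_at x r s t \<longleftrightarrow>
     (\<forall>\<phi>. has_freq (\<lambda>i. \<phi> (x r i) (x s i) (x t i))) \<and>
     (\<forall>a b c. freq (\<lambda>i. x s i = c) * freq (\<lambda>i. x r i = a \<and> x s i = c \<and> x t i = b)
        = freq (\<lambda>i. x r i = a \<and> x s i = c) * freq (\<lambda>i. x s i = c \<and> x t i = b))"

lemma markov_at_real_times:
  fixes x :: "real \<Rightarrow> nat \<Rightarrow> 'k"
  assumes stable: "right_stable_array x"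
    and rational: "\<And>r s t. r \<in> \<rat> \<Longrightarrow> s \<in> \<rat> \<Longrightarrow> t \<in> \<rat> \<Longrightarrow> 0 \<le> r \<Longrightarrow> r \<le> s \<Longrightarrow> s \<le> t \<Longrightarrow> markov_at x r s t"
    and rst: "0 \<le> r" "r \<le> s" "s \<le> t"
  shows "markov_at x r s t"
proof -
  have approx: "\<exists>r' s' t'. markov_at x r' s' t' \<and>
      (\<forall>\<phi>. \<forall>\<^sub>F n in sequentially. \<bar>triple_mean x \<phi> r s t n
        - triple_mean x \<phi> r' s' t' n\<bar> \<le> \<epsilon>)" if e: "0 < \<epsilon>" for \<epsilon>
  proof -
    obtain r' s' t' where "r' \<in> \<rat>" "s' \<in> \<rat>" "t' \<in> \<rat>" "0 \<le> r'" "r' \<le> s'" "s' \<le> t'"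
      "\<And>\<phi>. \<forall>\<^sub>F n in sequentially. \<bar>triple_mean x \<phi> r s t n
        - triple_mean x \<phi> r' s' t' n\<bar> \<le> \<epsilon>"
      using rational_approximation[OF stable rst e] by blast
    then show ?thesis using rational by blast
  qed
  have conv: "has_freq (\<lambda>i. \<phi> (x r i) (x s i) (x t i))" for \<phi>
    unfolding has_freq_def
  proof (rule convergent_of_uniform_approximations)
    fix \<epsilon> :: real assume "0 < \<epsilon>"
    then obtain r' s' t' where *: "markov_at x r' s' t'"
      "\<forall>\<^sub>F n in sequentially. \<bar>triple_mean x \<phi> r s t n
        - triple_mean x \<phi> r' s' t' n\<bar> \<le> \<epsilon>"
      using approx by blast
    have "convergent (triple_mean x \<phi> r' s' t')"
      using *(1) unfolding markov_at_def has_freq_def by blast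
    with *(2) show "\<exists>d. convergent d \<and> (\<forall>\<^sub>F n in sequentially.
        \<bar>triple_mean x \<phi> r s t n - d n\<bar> \<le> \<epsilon>)" by blast
  qed
  show ?thesis
    unfolding markov_at_def
  proof (intro conjI allI conv)
    fix a b c :: 'k
    define F where "F u v w \<phi> = freq (\<lambda>i. \<phi> (x u i) (x v i) (x w i))" for u v w and \<phi> :: "'k \<Rightarrow> 'k \<Rightarrow> 'k \<Rightarrow> bool"
    let ?h = "\<lambda>(r' :: 'k) s' (t' :: 'k). s' = c" and ?k = "\<lambda>r' s' t'. r' = a \<and> s' = c \<and> t' = b"
    let ?g = "\<lambda>r' s' (t' :: 'k). r' = a \<and> s' = c" and ?m = "\<lambda>(r' :: 'k) s' t'. s' = c \<and> t' = b"
    have "\<bar>F r s t ?h * F r s t ?k - F r s t ?g * F r s t ?m\<bar> \<le> \<epsilon>" if "0 < \<epsilon>" for \<epsilon>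
    proof -
      obtain r' s' t' where m: "markov_at x r' s' t'" and
        d: "\<And>\<phi>. \<forall>\<^sub>F n in sequentially. \<bar>triple_mean x \<phi> r s t n
          - triple_mean x \<phi> r' s' t' n\<bar> \<le> \<epsilon> / 4"
        using approx[of "\<epsilon> / 4"] \<open>0 < \<epsilon>\<close> by auto
      have conv': "has_freq (\<lambda>i. \<phi> (x r' i) (x s' i) (x t' i))" for \<phi>
        using m unfolding markov_at_def by blast
      have close: "\<bar>F r s t \<phi> - F r' s' t' \<phi>\<bar> \<le> \<epsilon> / 4" for \<phi>
        unfolding F_def
        by (rule tendsto_upperbound[OF tendsto_rabs[OF tendsto_diff[OF has_freqD[OF conv] has_freqD[OF conv']]] d])
          simp
      have b01: "0 \<le> F r s t \<phi>" "F r s t \<phi> \<le> 1" "0 \<le> F r' s' t' \<phi>" "F r' s' t' \<phi> \<le> 1" for \<phi>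
        unfolding F_def using freq_nonneg freq_le_1 conv conv' by auto
      have prod: "\<bar>F r s t \<phi> * F r s t \<psi> - F r' s' t' \<phi> * F r' s' t' \<psi>\<bar> \<le> \<epsilon> / 2" for \<phi> \<psi>
      proof -
        have "F r s t \<phi> * F r s t \<psi> - F r' s' t' \<phi> * F r' s' t' \<psi> =
            F r s t \<phi> * (F r s t \<psi> - F r' s' t' \<psi>) + (F r s t \<phi> - F r' s' t' \<phi>) * F r' s' t' \<psi>"
          by (simp add: algebra_simps)
        also have "\<bar>\<dots>\<bar> \<le> \<bar>F r s t \<phi>\<bar> * \<bar>F r s t \<psi> - F r' s' t' \<psi>\<bar> + \<bar>F r s t \<phi> - F r' s' t' \<phi>\<bar> * \<bar>F r' s' t' \<psi>\<bar>"
          unfolding abs_mult[symmetric] by (rule abs_triangle_ineq)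
        also have "\<dots> \<le> 1 * (\<epsilon> / 4) + \<epsilon> / 4 * 1"
          using b01 \<open>0 < \<epsilon>\<close> by (intro add_mono mult_mono close) auto
        finally show ?thesis by simp
      qed
      have "F r' s' t' ?h * F r' s' t' ?k = F r' s' t' ?g * F r' s' t' ?m"
        using m unfolding markov_at_def F_def by blast
      then show ?thesis using prod[of ?h ?k] prod[of ?g ?m] by linarith
    qed
    then have "\<bar>F r s t ?h * F r s t ?k - F r s t ?g * F r s t ?m\<bar> \<le> 0"
      by (rule field_le_epsilon[of _ 0, simplified])
    then show "freq (\<lambda>i. x s i = c) * freq (\<lambda>i. x r i = a \<and> x s i = c \<and> x t i = b)
        = freq (\<lambda>i. x r i = a \<and> x s i = c) * freq (\<lambda>i. x s i = c \<and> x t i = b)"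
      by (simp add: F_def)
  qed
qed

text \<open>
  Conditional law of the second component under the joint law \<open>J\<close>. Null rows are given the second
  marginal, for which the cocycle relation holds in null rows as well. Where \<open>J\<close> fails to be a
  probability distribution, some stochastic matrix is returned.
\<close>

definition transition_of :: "real ^ 'k ^ 'k::finite \<Rightarrow> real ^ 'k ^ 'k" where
  "transition_of J =
     (if (\<forall>a b. 0 \<le> J $ a $ b) \<and> (\<Sum>a\<in>UNIV. \<Sum>b\<in>UNIV. J $ a $ b) = 1
      then \<chi> a b. if (\<Sum>c\<in>UNIV. J $ a $ c) = 0 then \<Sum>c\<in>UNIV. J $ c $ b
                 else J $ a $ b / (\<Sum>c\<in>UNIV. J $ a $ c)
      else mat 1)"

lemma stochastic_transition_of: "stochastic_matrix (transition_of J)"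
proof (cases "(\<forall>a b. 0 \<le> J $ a $ b) \<and> (\<Sum>a\<in>UNIV. \<Sum>b\<in>UNIV. J $ a $ b) = 1")
  case True
  then have nn: "0 \<le> J $ a $ b" for a b by blast
  have "transition_of J $ a \<in> prob_simplex" for a
  proof (cases "(\<Sum>c\<in>UNIV. J $ a $ c) = 0")
    case z: True
    have "(\<Sum>b\<in>UNIV. \<Sum>c\<in>UNIV. J $ c $ b) = 1" using True sum.swap[of "\<lambda>a b. J $ a $ b" UNIV UNIV] by simp
    then show ?thesis using True z nn by (simp add: transition_of_def prob_simplex_def sum_nonneg)
  next
    case z: False
    have "0 \<le> (\<Sum>c\<in>UNIV. J $ a $ c)" using nn by (simp add: sum_nonneg)
    then show ?thesis using True z nn
      by (simp add: transition_of_def prob_simplex_def sum_divide_distrib[symmetric])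
  qed
  then show ?thesis by (simp add: stochastic_matrix_def)
next
  case False
  have "(mat 1 :: real ^ 'k ^ 'k) $ a \<in> prob_simplex" for a
    by (simp add: prob_simplex_def mat_def)
  then show ?thesis using False by (auto simp: stochastic_matrix_def transition_of_def)
qed

definition empirical_transition :: "(nat \<Rightarrow> 'k::finite) \<Rightarrow> (nat \<Rightarrow> 'k) \<Rightarrow> real ^ 'k ^ 'k" where
  "empirical_transition y z = transition_of (\<chi> a b. freq (\<lambda>i. y i = a \<and> z i = b))"

lemma empirical_transition_nth:
  fixes y z :: "nat \<Rightarrow> 'k::finite"
  assumes conv: "\<And>a b. has_freq (\<lambda>i. y i = a \<and> z i = b)"
  shows "empirical_transition y z $ a $ b =
    (if freq (\<lambda>i. y i = a) = 0 then freq (\<lambda>i. z i = b)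
     else freq (\<lambda>i. y i = a \<and> z i = b) / freq (\<lambda>i. y i = a))"
proof -
  have row: "(\<Sum>b\<in>UNIV. freq (\<lambda>i. y i = a \<and> z i = b)) = freq (\<lambda>i. y i = a)"
    and hrow: "has_freq (\<lambda>i. y i = a)" for a
    using freq_sum[of "\<lambda>i. y i = a" z] conv by auto
  have col: "(\<Sum>a\<in>UNIV. freq (\<lambda>i. y i = a \<and> z i = b)) = freq (\<lambda>i. z i = b)" for b
    using freq_sum(2)[of "\<lambda>i. z i = b" y] conv by (simp add: conj_commute)
  have total: "(\<Sum>a\<in>UNIV. freq (\<lambda>i. y i = a)) = 1"
    using freq_sum(2)[of "\<lambda>i. True" y] hrow by (simp add: freq_True)
  show ?thesis
    by (simp add: empirical_transition_def transition_of_def row col total freq_nonneg[OF conv])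
qed

text \<open>
  In a row \<open>a\<close> of positive frequency, the cocycle relation is the Chapman-Kolmogorov equation, summed
  over the state \<open>c\<close> at time \<open>s\<close> from the identity in \<open>markov_at\<close>. A null row is the marginal at time
  \<open>s\<close>, which is mapped to the marginal at time \<open>t\<close> by compatibility.
\<close>

lemma empirical_transition_semigroup:
  fixes x :: "real \<Rightarrow> nat \<Rightarrow> 'k::finite"
  assumes m: "markov_at x r s t"
  shows "empirical_transition (x r) (x t) = empirical_transition (x r) (x s) ** empirical_transition (x s) (x t)"
    and "(\<chi> j. freq (\<lambda>i. x s i = j)) v* empirical_transition (x s) (x t) = (\<chi> j. freq (\<lambda>i. x t i = j))"
proof -
  have conv: "has_freq (\<lambda>i. \<phi> (x r i) (x s i) (x t i))" for \<phi>
    using m unfolding markov_at_def by blast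
  note conv_rt = conv[of "\<lambda>r s t. r = a \<and> t = b" for a b]
  note conv_rs = conv[of "\<lambda>r s t. r = a \<and> s = b" for a b]
  note conv_st = conv[of "\<lambda>r s t. s = a \<and> t = b" for a b]
  note conv_r = conv[of "\<lambda>r s t. r = a" for a] and conv_s = conv[of "\<lambda>r s t. s = a" for a]
  note conv_rst = conv[of "\<lambda>r s t. r = a \<and> s = c \<and> t = b" for a b c]
  note nth_rt = empirical_transition_nth[OF conv_rt]
    and nth_rs = empirical_transition_nth[OF conv_rs]
    and nth_st = empirical_transition_nth[OF conv_st]
  have zero: "freq (\<lambda>i. A i) = 0" if "freq (\<lambda>i. B i) = 0" "has_freq A" "has_freq B" "\<And>i. A i \<Longrightarrow> B i" for A B
    using freq_mono[OF that(2,3)] freq_nonneg[OF that(2)] that(1,4) by fastforce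
  have mult_st: "freq (\<lambda>i. x s i = a) * empirical_transition (x s) (x t) $ a $ b = freq (\<lambda>i. x s i = a \<and> x t i = b)" for a b
    using zero[of "\<lambda>i. x s i = a" "\<lambda>i. x s i = a \<and> x t i = b"] conv_s conv_st by (simp add: nth_st)
  have col: "(\<Sum>a\<in>UNIV. freq (\<lambda>i. x s i = a \<and> x t i = b)) = freq (\<lambda>i. x t i = b)" for b
    using freq_sum(2)[of "\<lambda>i. x t i = b" "x s"] conv_st by (simp add: conj_commute)
  show "(\<chi> j. freq (\<lambda>i. x s i = j)) v* empirical_transition (x s) (x t) = (\<chi> j. freq (\<lambda>i. x t i = j))"
    by (simp add: vec_eq_iff vector_matrix_mult_def mult.commute[of "_ $ _ $ _"] mult_st col)
  have step: "empirical_transition (x r) (x t) $ a $ b =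
      (\<Sum>c\<in>UNIV. empirical_transition (x r) (x s) $ a $ c * empirical_transition (x s) (x t) $ c $ b)" for a b
  proof (cases "freq (\<lambda>i. x r i = a) = 0")
    case True
    then show ?thesis by (simp add: nth_rt nth_rs mult_st col)
  next
    case False
    have term_eq: "freq (\<lambda>i. x r i = a \<and> x s i = c) * empirical_transition (x s) (x t) $ c $ b
        = freq (\<lambda>i. x r i = a \<and> x s i = c \<and> x t i = b)" for c
    proof (cases "freq (\<lambda>i. x s i = c) = 0")
      case z: True
      have "freq (\<lambda>i. x r i = a \<and> x s i = c) = 0"
        by (rule zero[OF z conv_rs conv_s]) simp
      moreover have "freq (\<lambda>i. x r i = a \<and> x s i = c \<and> x t i = b) = 0"
        by (rule zero[OF z conv_rst conv_s]) simp
      ultimately show ?thesis by simp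
    next
      case nz: False
      have "freq (\<lambda>i. x s i = c) * freq (\<lambda>i. x r i = a \<and> x s i = c \<and> x t i = b)
        = freq (\<lambda>i. x r i = a \<and> x s i = c) * freq (\<lambda>i. x s i = c \<and> x t i = b)"
        using m unfolding markov_at_def by blast
      then show ?thesis using nz by (simp add: nth_st field_simps)
    qed
    have "(\<Sum>c\<in>UNIV. freq (\<lambda>i. x r i = a \<and> x s i = c \<and> x t i = b)) = freq (\<lambda>i. x r i = a \<and> x t i = b)"
      using freq_sum(2)[of "\<lambda>i. x r i = a \<and> x t i = b" "x s"] conv_rst by (simp add: conj_ac)
    then have "(\<Sum>c\<in>UNIV. freq (\<lambda>i. x r i = a \<and> x s i = c) * empirical_transition (x s) (x t) $ c $ b)
        = freq (\<lambda>i. x r i = a \<and> x t i = b)"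
      by (simp add: term_eq)
    then show ?thesis using False
      by (simp add: nth_rt nth_rs sum_divide_distrib[symmetric])
  qed
  show "empirical_transition (x r) (x t) = empirical_transition (x r) (x s) ** empirical_transition (x s) (x t)"
    by (simp add: vec_eq_iff matrix_matrix_mult_def step)
qed

section \<open>Conditional law of one coordinate and the random semigroup\<close>

lemma borel_measurable_matrixI:
  fixes f :: "'a \<Rightarrow> real ^ 'n::finite ^ 'm::finite"
  assumes "\<And>a b. (\<lambda>\<omega>. f \<omega> $ a $ b) \<in> borel_measurable N"
  shows "f \<in> borel_measurable N"
proof -
  have row: "(\<lambda>\<omega>. f \<omega> $ a) \<in> borel_measurable N" for a
    by (subst borel_measurable_euclidean_space) (auto simp: Basis_vec_def inner_axis assms)
  then show ?thesis
    by (subst borel_measurable_euclidean_space)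
      (auto simp: Basis_vec_def inner_axis assms)
qed

lemma transition_of_measurable:
  fixes J :: "'a \<Rightarrow> 'k::finite \<Rightarrow> 'k \<Rightarrow> real"
  assumes [measurable]: "\<And>a b. (\<lambda>\<omega>. J \<omega> a b) \<in> borel_measurable N"
  shows "(\<lambda>\<omega>. transition_of (\<chi> a b. J \<omega> a b)) \<in> borel_measurable N"
proof (rule borel_measurable_matrixI)
  fix a b
  have "(\<lambda>\<omega>. transition_of (\<chi> a b. J \<omega> a b) $ a $ b) =
    (\<lambda>\<omega>. if (\<forall>a\<in>UNIV. \<forall>b\<in>UNIV. 0 \<le> J \<omega> a b) \<and> (\<Sum>a\<in>UNIV. \<Sum>b\<in>UNIV. J \<omega> a b) = 1
      then (if (\<Sum>c\<in>UNIV. J \<omega> a c) = 0 then \<Sum>c\<in>UNIV. J \<omega> c b else J \<omega> a b / (\<Sum>c\<in>UNIV. J \<omega> a c))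
      else mat 1 $ a $ b)"
    by (rule ext) (simp add: transition_of_def)
  also have "\<dots> \<in> borel_measurable N" by measurable
  finally show "(\<lambda>\<omega>. transition_of (\<chi> a b. J \<omega> a b) $ a $ b) \<in> borel_measurable N" .
qed

lemma empirical_transition_perm:
  assumes "permutation \<sigma>"
  shows "empirical_transition (\<lambda>i. y (\<sigma> i)) (\<lambda>i. z (\<sigma> i)) = empirical_transition y z"
proof -
  have "freq (\<lambda>i. y (\<sigma> i) = a \<and> z (\<sigma> i) = b) = freq (\<lambda>i. y i = a \<and> z i = b)" for a b
    by (rule freq_permutation[OF assms, of "\<lambda>i. y i = a \<and> z i = b"])
  then show ?thesis by (simp only: empirical_transition_def)
qed

lemma empirical_transition_measurable:
  fixes X :: "real \<Rightarrow> 'a \<Rightarrow> nat \<Rightarrow> 'k::finite"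
  assumes "s \<in> T" "t \<in> T"
  shows "(\<lambda>\<omega>. empirical_transition (X s \<omega>) (X t \<omega>)) \<in> borel_measurable (exch_algebra M X T)"
proof -
  let ?R = "PiM (UNIV :: nat set) (\<lambda>_. path_space T :: (real \<Rightarrow> 'k) measure)"
  define q where "q z = empirical_transition (\<lambda>i. z i s) (\<lambda>i. z i t)" for z :: "nat \<Rightarrow> real \<Rightarrow> 'k"
  have comp [measurable]: "(\<lambda>z. z i u) \<in> ?R \<rightarrow>\<^sub>M count_space UNIV" if "u \<in> T" for i u
  proof (rule measurable_compose[of "\<lambda>z. z i" ?R "path_space T"])
    show "(\<lambda>y. y u) \<in> path_space T \<rightarrow>\<^sub>M count_space UNIV"
      unfolding path_space_def using that by (rule measurable_component_singleton)
  qed simp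
  note [measurable] = comp[OF assms(1)] comp[OF assms(2)]
  have q_meas: "q \<in> borel_measurable ?R"
    unfolding q_def empirical_transition_def
    by (intro transition_of_measurable) (unfold freq_def running_mean_def, measurable)
  have q_perm: "q (perm_act \<sigma> z) = q z" if "permutation \<sigma>" for \<sigma> z
    unfolding q_def perm_act_def by (rule empirical_transition_perm[OF that])
  have "q \<in> borel_measurable (invariant_algebra (path_space T))"
    by (rule measurable_invariant_algebraI[OF q_meas]) (rule q_perm)
  moreover have "(\<lambda>\<omega> i. coord_path X T i \<omega>) \<in> exch_algebra M X T \<rightarrow>\<^sub>M invariant_algebra (path_space T)"
    unfolding exch_algebra_def
    by (rule measurable_vimage_algebra1) (auto simp: space_PiM path_space_def coord_path_def)
  ultimately have "(\<lambda>\<omega>. q (\<lambda>i. coord_path X T i \<omega>)) \<in> borel_measurable (exch_algebra M X T)"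
    by (rule measurable_compose[rotated])
  then show ?thesis using assms by (simp add: q_def coord_path_def)
qed

context exchangeable_markov
begin

lemma directing_freq:
  assumes "A \<in> sets (path_space {0..})"
  shows "AE \<omega> in M. has_freq (\<lambda>i. paths \<omega> i \<in> A) \<and> freq (\<lambda>i. paths \<omega> i \<in> A) = directing A \<omega>"
  using directing_limit[OF assms]
proof eventually_elim
  case (elim \<omega>)
  then have "running_mean (\<lambda>i. of_bool (paths \<omega> i \<in> A)) \<longlonglongrightarrow> directing A \<omega>"
    by (simp add: indicator_def[abs_def])
  then show ?case by (simp add: freqI)
qed

lemma integral_directing:
  assumes A: "A \<in> sets (path_space {0..})" and W: "W \<in> borel_measurable E" "\<And>\<omega>. \<omega> \<in> space M \<Longrightarrow> \<bar>W \<omega>\<bar> \<le> 1"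
  shows "(\<integral>\<omega>. W \<omega> * indicat_real A (paths \<omega> i) \<partial>M) = (\<integral>\<omega>. W \<omega> * directing A \<omega> \<partial>M)"
proof -
  have WM [measurable]: "W \<in> borel_measurable M" by (rule measurable_from_subalg[OF subalgebra_E W(1)])
  have [measurable]: "(\<lambda>\<omega>. indicat_real A (paths \<omega> i)) \<in> borel_measurable M"
    using A measurable_component[of i] by measurable
  have "(\<integral>\<omega>. W \<omega> * indicat_real A (paths \<omega> i) \<partial>M)
      = (\<integral>\<omega>. W \<omega> * real_cond_exp M E (\<lambda>\<omega>. indicat_real A (paths \<omega> i)) \<omega> \<partial>M)"
  proof (rule real_cond_exp_intg(2)[symmetric])
    show "integrable M (\<lambda>\<omega>. W \<omega> * indicat_real A (paths \<omega> i))"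
    proof (rule integrable_bounded_measurable[where C = 1])
      show "(\<lambda>\<omega>. W \<omega> * indicat_real A (paths \<omega> i)) \<in> borel_measurable M" by measurable
      show "\<bar>W \<omega> * indicat_real A (paths \<omega> i)\<bar> \<le> 1" if "\<omega> \<in> space M" for \<omega>
        using W(2)[OF that] by (simp add: indicator_def)
    qed
  qed (use W in measurable)
  also have "\<dots> = (\<integral>\<omega>. W \<omega> * directing A \<omega> \<partial>M)"
    using real_cond_exp_directing[OF A, of i] by (intro integral_cong_AE) auto
  finally show ?thesis .
qed

text \<open>
  The empirical laws are the values of the directing measure, for which the identity is
  \<open>directing_markov\<close> with the past event that the path is in \<open>a\<close> at time \<open>r\<close> and in \<open>c\<close> at time \<open>s\<close>.
\<close>

lemma markov_at_AE:
  assumes rst: "0 \<le> r" "r \<le> s" "s \<le> t"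
  shows "AE \<omega> in M. markov_at (\<lambda>u. X u \<omega>) r s t"
proof -
  let ?M = "\<lambda>a b c \<omega>. freq (\<lambda>i. X s \<omega> i = c) * freq (\<lambda>i. X r \<omega> i = a \<and> X s \<omega> i = c \<and> X t \<omega> i = b)
        = freq (\<lambda>i. X r \<omega> i = a \<and> X s \<omega> i = c) * freq (\<lambda>i. X s \<omega> i = c \<and> X t \<omega> i = b)"
  have nn: "0 \<le> s" "0 \<le> t" using rst by auto
  have comp: "(\<lambda>y. y u) \<in> path_space {0..} \<rightarrow>\<^sub>M count_space UNIV" if "0 \<le> u" for u
    unfolding path_space_def using that by (intro measurable_component_singleton) auto
  note [measurable] = comp[OF rst(1)] comp[OF nn(1)] comp[OF nn(2)]
  have "AE \<omega> in M. \<forall>\<phi>\<in>UNIV. has_freq (\<lambda>i. \<phi> (X r \<omega> i) (X s \<omega> i) (X t \<omega> i))"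
  proof (rule AE_finite_allI)
    fix \<phi> :: "'k \<Rightarrow> 'k \<Rightarrow> 'k \<Rightarrow> bool"
    let ?A = "{y \<in> space (path_space {0..}). \<exists>a\<in>UNIV. \<exists>c\<in>UNIV. \<exists>b\<in>UNIV. y r = a \<and> y s = c \<and> y t = b \<and> \<phi> a c b}"
    have "?A \<in> sets (path_space {0..})" by measurable
    from directing_freq[OF this] show "AE \<omega> in M. has_freq (\<lambda>i. \<phi> (X r \<omega> i) (X s \<omega> i) (X t \<omega> i))"
      by eventually_elim (use rst nn in \<open>simp add: paths_apply\<close>)
  qed simp
  moreover have "AE \<omega> in M. \<forall>a\<in>UNIV. \<forall>b\<in>UNIV. \<forall>c\<in>UNIV. ?M a b c \<omega>"
  proof (intro AE_finite_allI finite)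
    fix a b c
    let ?H = "state_at s c" and ?G = "state_at r a \<inter> state_at s c" and ?B = "state_at t b"
    have sets: "?H \<in> sets (path_space {0..})" "?G \<in> sets (path_space {0..})" "?B \<in> sets (path_space {0..})"
      using rst nn by auto
    have past: "{\<omega>\<in>space M. paths \<omega> i \<in> ?G} \<in> sets (past s)" for i
    proof -
      have "(\<lambda>\<omega>. X u \<omega> i) -` {e} \<inter> space (past s) \<in> sets (past s)" if "0 \<le> u" "u \<le> s" for u e
        by (rule measurable_sets[OF measurable_compose[OF X_measurable_past[OF that] measurable_seq_space_component]])
          simp
      from sets.Int[OF this[OF rst(1,2), of a] this[OF nn(1) order_refl, of c]]
      show ?thesis
        by (rule arg_cong[where f = "\<lambda>A. A \<in> sets (past s)", THEN iffD1, rotated])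
          (use rst nn in \<open>auto simp: paths_in_state_at\<close>)
    qed
    show "AE \<omega> in M. ?M a b c \<omega>"
      using directing_markov[OF nn(1) rst(3) sets(2) Int_lower2 past, of b]
        directing_freq[OF sets(1)] directing_freq[OF sets(2)]
        directing_freq[OF sets.Int[OF sets(2,3)]] directing_freq[OF sets.Int[OF sets(1,3)]]
    proof eventually_elim
      case (elim \<omega>)
      then show ?case using rst nn by (simp add: paths_in_state_at conj_ac)
    qed
  qed
  ultimately show ?thesis
  proof eventually_elim
    case (elim \<omega>)
    then show ?case unfolding markov_at_def by blast
  qed
qed

text \<open>
  The set \<open>T\<close> of observed times is arbitrary to cover both the whole past and the single time \<open>s\<close>.
  The join of the exchangeable algebra and the algebra of coordinate \<open>i\<close> is generated by the
  intersections \<open>B \<inter> C\<close> of their members. Given the exchangeable algebra, the probability of \<open>C\<close> with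
  state \<open>a\<close> at time \<open>s\<close> and \<open>b\<close> at time \<open>t\<close> is a value of the directing measure, which
  \<open>directing_markov\<close> factors into \<open>Q s t (a,b)\<close> and the value for \<open>C\<close> with state \<open>a\<close>.
\<close>

lemma cond_markov:
  assumes s: "s \<in> T" "T \<subseteq> {0..s}" "s \<le> t"
  shows "AE \<omega> in M. cond_pr M (join_algebra M (exch_algebra M X {0..})
      (generated_algebra M (count_space UNIV) T (\<lambda>u \<omega>. X u \<omega> i))) {\<omega>\<in>space M. X t \<omega> i = b} \<omega>
    = empirical_transition (X s \<omega>) (X t \<omega>) $ X s \<omega> i $ b"
proof -
  define gen where "gen = generated_algebra M (count_space UNIV) T (\<lambda>u \<omega>. X u \<omega> i)"
  define F where "F = join_algebra M E gen"
  define Q where "Q \<omega> = empirical_transition (X s \<omega>) (X t \<omega>)" for \<omega>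
  have s0: "0 \<le> s" and t0: "0 \<le> t" and T0: "\<And>u. u \<in> T \<Longrightarrow> 0 \<le> u \<and> u \<le> s" using s by auto
  have X_comp: "(\<lambda>\<omega>. X u \<omega> j) \<in> M \<rightarrow>\<^sub>M count_space UNIV" if "0 \<le> u" for u j
    by (rule measurable_compose[OF X_measurable[OF that] measurable_seq_space_component])
  note [measurable] = X_comp[OF s0] X_comp[OF t0]
  have space_gen [simp]: "space gen = space M" by (simp add: gen_def generated_algebra_def)
  have gen_map: "(\<lambda>\<omega>. \<lambda>u\<in>T. X u \<omega> i) \<in> gen \<rightarrow>\<^sub>M path_space T"
    unfolding gen_def generated_algebra_def path_space_def
    by (rule measurable_vimage_algebra1) (auto simp: space_PiM)
  have gen_sub: "sets gen \<subseteq> sets M"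
    unfolding gen_def generated_algebra_def
    by (rule sets_image_in_sets) (auto intro!: measurable_restrict X_comp simp: T0)
  have E_sub: "sets E \<subseteq> sets M" using subalgebra_E by (simp add: subalgebra_def)
  have pow: "sets E \<union> sets gen \<subseteq> Pow (space M)"
    using E_sub gen_sub sets.sets_into_space by blast
  have space_F [simp]: "space F = space M"
    unfolding F_def join_algebra_def by (rule space_measure_of[OF pow])
  have sets_F: "sets F = sigma_sets (space M) (sets E \<union> sets gen)"
    unfolding F_def join_algebra_def by (rule sets_measure_of[OF pow])
  have F_sub: "subalgebra M F"
    unfolding subalgebra_def sets_F
    by (intro conjI sets.sigma_sets_subset Un_least E_sub gen_sub) simp
  have FE: "subalgebra F E" and Fgen: "subalgebra F gen"
    unfolding subalgebra_def sets_F by (simp_all add: sigma_sets_superset_generator[THEN order_trans[rotated]])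
  interpret F: finite_measure_subalgebra M F
    by unfold_locales (rule F_sub)
  have QE: "Q \<in> borel_measurable E"
    unfolding Q_def E_eq using s0 t0 by (intro empirical_transition_measurable) auto
  have Qab_E [measurable]: "(\<lambda>\<omega>. Q \<omega> $ a $ c) \<in> borel_measurable E" for a c
    by (rule measurable_compose[OF QE borel_measurable_continuous_onI]) (intro continuous_intros)
  have Qab_M [measurable]: "(\<lambda>\<omega>. Q \<omega> $ a $ c) \<in> borel_measurable M" for a c
    by (rule measurable_from_subalg[OF subalgebra_E Qab_E])
  have Q01: "0 \<le> Q \<omega> $ a $ c" "Q \<omega> $ a $ c \<le> 1" for \<omega> a c
  proof -
    have st: "Q \<omega> $ a \<in> prob_simplex"
      using stochastic_transition_of unfolding Q_def empirical_transition_def stochastic_matrix_def by blast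
    then have nn: "\<And>c. 0 \<le> Q \<omega> $ a $ c" and sum: "(\<Sum>c\<in>UNIV. Q \<omega> $ a $ c) = 1"
      by (auto simp: prob_simplex_def)
    show "0 \<le> Q \<omega> $ a $ c" by (rule nn)
    show "Q \<omega> $ a $ c \<le> 1"
      using member_le_sum[of c UNIV "\<lambda>c. Q \<omega> $ a $ c"] nn sum by simp
  qed
  define f where "f \<omega> = indicat_real {\<omega>\<in>space M. X t \<omega> i = b} \<omega>" for \<omega>
  define g where "g \<omega> = Q \<omega> $ X s \<omega> i $ b" for \<omega>
  have g_sum: "g \<omega> = (\<Sum>a\<in>UNIV. of_bool (X s \<omega> i = a) * Q \<omega> $ a $ b)" for \<omega>
    by (simp add: g_def of_bool_def if_distrib[of "\<lambda>x. x * _"] cong: if_cong)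
  have g_F: "g \<in> borel_measurable F"
  proof -
    have "(\<lambda>\<omega>. (\<lambda>u\<in>T. X u \<omega> i) s) \<in> gen \<rightarrow>\<^sub>M count_space UNIV"
      by (rule measurable_compose[OF gen_map]) (use s in \<open>simp add: path_space_def\<close>)
    then have "(\<lambda>\<omega>. X s \<omega> i) \<in> gen \<rightarrow>\<^sub>M count_space UNIV" using s by simp
    then have [measurable]: "(\<lambda>\<omega>. X s \<omega> i) \<in> F \<rightarrow>\<^sub>M count_space UNIV" by (rule measurable_from_subalg[OF Fgen])
    have [measurable]: "(\<lambda>\<omega>. Q \<omega> $ a $ b) \<in> borel_measurable F" for a by (rule measurable_from_subalg[OF FE Qab_E])
    show ?thesis unfolding g_sum by measurable
  qed
  have g_M [measurable]: "g \<in> borel_measurable M" by (rule measurable_from_subalg[OF F_sub g_F])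
  have f_M [measurable]: "f \<in> borel_measurable M" unfolding f_def by measurable
  have fg01: "0 \<le> f \<omega>" "f \<omega> \<le> 1" "0 \<le> g \<omega>" "g \<omega> \<le> 1" for \<omega>
    by (auto simp: f_def g_def Q01 indicator_def)
  have f_int: "integrable M f" and g_int: "integrable M g"
    by (rule integrable_bounded_measurable[where C = 1]; simp add: fg01)+
  have em: "emeasure (density M (\<lambda>\<omega>. ennreal (k \<omega>))) A = ennreal (\<integral>\<omega>. indicat_real A \<omega> * k \<omega> \<partial>M)"
    if [measurable]: "A \<in> sets M" "k \<in> borel_measurable M" and k: "integrable M k" "\<And>\<omega>. 0 \<le> k \<omega>" for A k
  proof -
    have "emeasure (density M (\<lambda>\<omega>. ennreal (k \<omega>))) A = (\<integral>\<^sup>+\<omega>. ennreal (indicat_real A \<omega> * k \<omega>) \<partial>M)"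
      by (subst emeasure_density) (auto intro!: nn_integral_cong simp: indicator_def)
    also have "\<dots> = ennreal (\<integral>\<omega>. indicat_real A \<omega> * k \<omega> \<partial>M)"
      using integrable_mult_indicator[OF that(1) k(1)] k(2) by (intro nn_integral_eq_integral) auto
    finally show ?thesis .
  qed
  have base: "(\<integral>\<omega>. indicat_real (B \<inter> C) \<omega> * f \<omega> \<partial>M) = (\<integral>\<omega>. indicat_real (B \<inter> C) \<omega> * g \<omega> \<partial>M)"
    if B: "B \<in> sets E" and C: "C \<in> sets gen" for B C
  proof -
    obtain C' where C': "C' \<in> sets (path_space T)" "C = (\<lambda>\<omega>. \<lambda>u\<in>T. X u \<omega> i) -` C' \<inter> space M"
    proof -
      have "(\<lambda>\<omega>. \<lambda>u\<in>T. X u \<omega> i) \<in> space M \<rightarrow> space (\<Pi>\<^sub>M u\<in>T. count_space UNIV)"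
        by (auto simp: space_PiM)
      then show thesis using C that unfolding gen_def generated_algebra_def
        by (auto simp: sets_vimage_algebra2 path_space_def)
    qed
    have BM [measurable]: "B \<in> sets M" using B E_sub by blast
    define G where "G a = {y \<in> space (path_space {0..}). restrict y T \<in> C' \<and> y s = a}" for a
    have restr: "(\<lambda>y. restrict y T) \<in> path_space {0..} \<rightarrow>\<^sub>M path_space T"
      unfolding path_space_def by (rule measurable_restrict_subset) (use T0 in auto)
    have G_sets: "G a \<in> sets (path_space {0..})" for a
    proof -
      have "G a = ((\<lambda>y. restrict y T) -` C' \<inter> space (path_space {0..})) \<inter> state_at s a"
        by (auto simp: G_def state_at_def)
      then show ?thesis using measurable_sets[OF restr C'(1)] state_at_sets[OF s0, of a] by auto
    qed
    have G_sub: "G a \<subseteq> state_at s a" for a by (auto simp: G_def state_at_def)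
    have restr_paths: "restrict (paths \<omega> j) T = (\<lambda>u\<in>T. X u \<omega> j)" for \<omega> j
      using T0 by (auto simp: restrict_def paths_apply)
    have paths_G: "paths \<omega> j \<in> G a \<longleftrightarrow> (\<lambda>u\<in>T. X u \<omega> j) \<in> C' \<and> X s \<omega> j = a" for \<omega> j a
      by (simp add: G_def restr_paths paths_apply[OF s0])
    have G_past: "{\<omega>\<in>space M. paths \<omega> j \<in> G a} \<in> sets (past s)" for j a
    proof -
      have "(\<lambda>\<omega>. \<lambda>u\<in>T. X u \<omega> j) \<in> past s \<rightarrow>\<^sub>M path_space T"
        unfolding path_space_def
        by (intro measurable_restrict measurable_compose[OF X_measurable_past measurable_seq_space_component])
          (use T0 in auto)
      from measurable_sets[OF this C'(1)]
      have 1: "(\<lambda>\<omega>. \<lambda>u\<in>T. X u \<omega> j) -` C' \<inter> space M \<in> sets (past s)" by simp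
      note [measurable] = measurable_compose[OF X_measurable_past[OF s0 order_refl] measurable_seq_space_component]
      have "{\<omega>\<in>space (past s). X s \<omega> j = a} \<in> sets (past s)" by measurable
      then have "((\<lambda>\<omega>. \<lambda>u\<in>T. X u \<omega> j) -` C' \<inter> space M) \<inter> {\<omega>\<in>space M. X s \<omega> j = a} \<in> sets (past s)"
        using 1 by auto
      moreover have "((\<lambda>\<omega>. \<lambda>u\<in>T. X u \<omega> j) -` C' \<inter> space M) \<inter> {\<omega>\<in>space M. X s \<omega> j = a} = {\<omega>\<in>space M. paths \<omega> j \<in> G a}"
        by (auto simp: paths_G)
      ultimately show ?thesis by simp
    qed
    let ?B = "state_at t b"
    have B_sets: "?B \<in> sets (path_space {0..})" by (rule state_at_sets[OF t0])
    have GB_sets: "G a \<inter> ?B \<in> sets (path_space {0..})" for a using G_sets B_sets by auto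
    (* If state a has frequency 0 at time s then both sides vanish, whatever the row of Q is. *)
    have key: "AE \<omega> in M. directing (G a \<inter> ?B) \<omega> = Q \<omega> $ a $ b * directing (G a) \<omega>" for a
      using directing_markov[OF s0 s(3) G_sets G_sub G_past, where a = a and b = b]
        directing_freq[OF state_at_sets[OF s0, of a]] directing_freq[OF G_sets[of a]]
        directing_freq[OF GB_sets[of a]] directing_freq[OF sets.Int[OF state_at_sets[OF s0, of a] B_sets]]
        markov_at_AE[OF s0 order_refl s(3)]
    proof eventually_elim
      case (elim \<omega>)
      have conv: "has_freq (\<lambda>i. \<phi> (X s \<omega> i) (X t \<omega> i))" for \<phi>
        using elim(6)[unfolded markov_at_def, THEN conjunct1, rule_format, of "\<lambda>_. \<phi>"] .
      have H: "directing (state_at s a) \<omega> = freq (\<lambda>i. X s \<omega> i = a)"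
        and HB: "directing (state_at s a \<inter> ?B) \<omega> = freq (\<lambda>i. X s \<omega> i = a \<and> X t \<omega> i = b)"
        using elim(2,5) s0 t0 by (simp_all add: paths_in_state_at)
      have Qab: "Q \<omega> $ a $ b = (if freq (\<lambda>i. X s \<omega> i = a) = 0 then freq (\<lambda>i. X t \<omega> i = b)
          else freq (\<lambda>i. X s \<omega> i = a \<and> X t \<omega> i = b) / freq (\<lambda>i. X s \<omega> i = a))"
        unfolding Q_def by (rule empirical_transition_nth) (rule conv)
      have le: "directing (G a) \<omega> \<le> directing (state_at s a) \<omega>"
        "directing (G a \<inter> ?B) \<omega> \<le> directing (state_at s a) \<omega>"
        using elim(2-4) freq_mono[of "\<lambda>i. paths \<omega> i \<in> G a" "\<lambda>i. paths \<omega> i \<in> state_at s a"]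
          freq_mono[of "\<lambda>i. paths \<omega> i \<in> G a \<inter> ?B" "\<lambda>i. paths \<omega> i \<in> state_at s a"] G_sub[of a] by auto
      show ?case
      proof (cases "freq (\<lambda>i. X s \<omega> i = a) = 0")
        case True
        then have "directing (G a) \<omega> = 0" "directing (G a \<inter> ?B) \<omega> = 0"
          using le directing_bounds(1)[of "G a" \<omega>] directing_bounds(1)[of "G a \<inter> ?B" \<omega>] H by auto
        then show ?thesis by simp
      next
        case False
        then show ?thesis using elim(1) by (simp add: Qab H HB field_simps)
      qed
    qed
    have paths_M [measurable]: "(\<lambda>\<omega>. indicat_real A (paths \<omega> i)) \<in> borel_measurable M"
      if "A \<in> sets (path_space {0..})" for A
      using that measurable_component[of i] by measurable
    have int: "integrable M (\<lambda>\<omega>. W \<omega> * indicat_real A (paths \<omega> i))"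
      if "A \<in> sets (path_space {0..})" "W \<in> borel_measurable M" "\<And>\<omega>. \<bar>W \<omega>\<bar> \<le> 1" for W A
    proof (rule integrable_bounded_measurable[where C = 1])
      show "(\<lambda>\<omega>. W \<omega> * indicat_real A (paths \<omega> i)) \<in> borel_measurable M"
        by (intro borel_measurable_times that paths_M)
      show "\<bar>W \<omega> * indicat_real A (paths \<omega> i)\<bar> \<le> 1" for \<omega>
        using that(3)[of \<omega>] by (simp add: indicator_def)
    qed
    have W1: "indicat_real B \<in> borel_measurable E" "\<And>\<omega>. \<bar>indicat_real B \<omega>\<bar> \<le> 1"
      using B by (auto simp: indicator_def)
    have W2: "(\<lambda>\<omega>. indicat_real B \<omega> * Q \<omega> $ a $ b) \<in> borel_measurable E"
      "\<And>\<omega>. \<bar>indicat_real B \<omega> * Q \<omega> $ a $ b\<bar> \<le> 1" for a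
      using B Q01 by (measurable, auto simp: indicator_def)
    let ?gb = "\<lambda>a \<omega>. indicat_real B \<omega> * indicat_real (G a \<inter> ?B) (paths \<omega> i)"
      and ?qg = "\<lambda>a \<omega>. (indicat_real B \<omega> * Q \<omega> $ a $ b) * indicat_real (G a) (paths \<omega> i)"
    have "(\<integral>\<omega>. indicat_real (B \<inter> C) \<omega> * f \<omega> \<partial>M) =
        (\<integral>\<omega>. (\<Sum>a\<in>UNIV. ?gb a \<omega>) \<partial>M)"
    proof (intro Bochner_Integration.integral_cong refl)
      fix \<omega> assume w: "\<omega> \<in> space M"
      have "(\<Sum>a\<in>UNIV. ?gb a \<omega>) =
          (\<Sum>a\<in>UNIV. if a = X s \<omega> i then indicat_real (B \<inter> C) \<omega> * f \<omega> else 0)"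
        by (intro sum.cong refl) (use w in \<open>auto simp: indicator_def f_def paths_G C'(2) paths_in_state_at[OF t0]\<close>)
      then show "indicat_real (B \<inter> C) \<omega> * f \<omega> = (\<Sum>a\<in>UNIV. ?gb a \<omega>)"
        by simp
    qed
    also have "\<dots> = (\<Sum>a\<in>UNIV. \<integral>\<omega>. ?gb a \<omega> \<partial>M)"
      by (intro Bochner_Integration.integral_sum int GB_sets W1 measurable_from_subalg[OF subalgebra_E W1(1)])
    also have "\<dots> = (\<Sum>a\<in>UNIV. \<integral>\<omega>. ?qg a \<omega> \<partial>M)"
    proof (rule sum.cong[OF refl])
      fix a
      have "(\<integral>\<omega>. ?gb a \<omega> \<partial>M)
          = (\<integral>\<omega>. indicat_real B \<omega> * directing (G a \<inter> ?B) \<omega> \<partial>M)"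
        by (rule integral_directing[OF GB_sets W1])
      also have "\<dots> = (\<integral>\<omega>. (indicat_real B \<omega> * Q \<omega> $ a $ b) * directing (G a) \<omega> \<partial>M)"
        using key[of a] by (intro integral_cong_AE) auto
      also have "\<dots> = (\<integral>\<omega>. ?qg a \<omega> \<partial>M)"
        by (rule integral_directing[OF G_sets W2, symmetric])
      finally show "(\<integral>\<omega>. ?gb a \<omega> \<partial>M) =
          (\<integral>\<omega>. ?qg a \<omega> \<partial>M)" .
    qed
    also have "\<dots> = (\<integral>\<omega>. (\<Sum>a\<in>UNIV. ?qg a \<omega>) \<partial>M)"
      by (intro Bochner_Integration.integral_sum[symmetric] int G_sets W2 measurable_from_subalg[OF subalgebra_E W2(1)])
    also have "\<dots> = (\<integral>\<omega>. indicat_real (B \<inter> C) \<omega> * g \<omega> \<partial>M)"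
    proof (intro Bochner_Integration.integral_cong refl)
      fix \<omega> assume w: "\<omega> \<in> space M"
      have "(\<Sum>a\<in>UNIV. ?qg a \<omega>) =
          (\<Sum>a\<in>UNIV. if a = X s \<omega> i then indicat_real (B \<inter> C) \<omega> * g \<omega> else 0)"
        by (intro sum.cong refl) (use w in \<open>auto simp: indicator_def g_def paths_G C'(2)\<close>)
      then show "(\<Sum>a\<in>UNIV. ?qg a \<omega>) = indicat_real (B \<inter> C) \<omega> * g \<omega>"
        by simp
    qed
    finally show ?thesis .
  qed
  let ?I = "\<lambda>A k. \<integral>\<omega>. indicat_real A \<omega> * k \<omega> \<partial>M"
  have all_F: "?I A f = ?I A g" if A: "A \<in> sets F" for A
  proof -
    let ?K = "{B \<inter> C | B C. B \<in> sets E \<and> C \<in> sets gen}"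
    let ?m = "\<lambda>k. restr_to_subalg (density M (\<lambda>\<omega>. ennreal (k \<omega>))) F"
    have sub: "subalgebra (density M (\<lambda>\<omega>. ennreal (k \<omega>))) F" for k
      using F_sub by (simp add: subalgebra_def)
    have K_M: "D \<in> sets M" "D \<in> sets F" if "D \<in> ?K" for D
    proof -
      from that obtain B C where "D = B \<inter> C" "B \<in> sets E" "C \<in> sets gen"
        unfolding mem_Collect_eq by (elim exE conjE)
      then show "D \<in> sets F" using FE Fgen unfolding subalgebra_def by blast
      then show "D \<in> sets M" using F_sub unfolding subalgebra_def by blast
    qed
    have val: "emeasure (?m f) D = ennreal (?I D f)"
      "emeasure (?m g) D = ennreal (?I D g)" if D: "D \<in> sets F" for D
    proof -
      have DM: "D \<in> sets M" using D F_sub unfolding subalgebra_def by blast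
      show "emeasure (?m f) D = ennreal (?I D f)"
        unfolding emeasure_restr_to_subalg[OF sub D] by (rule em[OF DM f_M f_int fg01(1)])
      show "emeasure (?m g) D = ennreal (?I D g)"
        unfolding emeasure_restr_to_subalg[OF sub D] by (rule em[OF DM g_M g_int fg01(3)])
    qed
    have top: "space M \<in> ?K"
      using sets.top[of E] sets.top[of gen] by (intro CollectI exI[of _ "space M"]) auto
    have K_sigma: "sets F = sigma_sets (space M) ?K"
      unfolding sets_F
    proof (rule sigma_sets_eqI)
      fix D assume "D \<in> sets E \<union> sets gen"
      then have "D = D \<inter> space M" "D = space M \<inter> D" "D \<in> sets E \<or> D \<in> sets gen"
        using pow by auto
      then have "D \<in> ?K"
        using sets.top[of E] sets.top[of gen] unfolding space_E space_gen by blast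
      then show "D \<in> sigma_sets (space M) ?K" by (rule sigma_sets.Basic)
    next
      fix D assume "D \<in> ?K"
      then show "D \<in> sigma_sets (space M) (sets E \<union> sets gen)" using K_M(2) unfolding sets_F by blast
    qed
    have "?m f = ?m g"
    proof (rule measure_eqI_generator_eq[of ?K "space M" _ _ "\<lambda>_. space M"])
      show "Int_stable ?K"
      proof (rule Int_stableI)
        fix D1 D2 assume "D1 \<in> ?K" "D2 \<in> ?K"
        then obtain B1 C1 B2 C2 where "D1 = B1 \<inter> C1" "D2 = B2 \<inter> C2"
          "B1 \<in> sets E" "C1 \<in> sets gen" "B2 \<in> sets E" "C2 \<in> sets gen"
          unfolding mem_Collect_eq by (elim exE conjE)
        then have "D1 \<inter> D2 = (B1 \<inter> B2) \<inter> (C1 \<inter> C2)" "B1 \<inter> B2 \<in> sets E" "C1 \<inter> C2 \<in> sets gen" by auto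
        then show "D1 \<inter> D2 \<in> ?K" by blast
      qed
      show "?K \<subseteq> Pow (space M)" using K_M(1) sets.sets_into_space by blast
      show "emeasure (?m f) D = emeasure (?m g) D" if "D \<in> ?K" for D
      proof -
        from that obtain B C where BC: "D = B \<inter> C" "B \<in> sets E" "C \<in> sets gen"
          unfolding mem_Collect_eq by (elim exE conjE)
        show ?thesis
          unfolding val[OF K_M(2)[OF that]] unfolding BC(1) base[OF BC(2,3)] ..
      qed
      show "sets (?m f) = sigma_sets (space M) ?K" "sets (?m g) = sigma_sets (space M) ?K"
        by (simp_all only: sets_restr_to_subalg[OF sub] K_sigma)
      show "range (\<lambda>_. space M) \<subseteq> ?K" using top by auto
      show "emeasure (?m f) (space M) \<noteq> \<infinity>"
        unfolding val(1)[OF K_M(2)[OF top]] by simp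
    qed simp
    then have "emeasure (?m f) A = emeasure (?m g) A" by simp
    then have "ennreal (?I A f) = ennreal (?I A g)"
      unfolding val[OF A] .
    moreover have "0 \<le> ?I A f" "0 \<le> ?I A g"
      by (intro integral_nonneg_AE AE_I2 mult_nonneg_nonneg fg01; simp)+
    ultimately show ?thesis by simp
  qed
  have "AE \<omega> in M. real_cond_exp M F f \<omega> = g \<omega>"
    by (rule F.real_cond_exp_charact) (use all_F f_int g_int g_F in \<open>auto simp: set_lebesgue_integral_def\<close>)
  then show ?thesis
    by (simp add: cond_pr_def F_def gen_def f_def[abs_def] g_def Q_def E_eq)
qed

end

context cadlag_exchangeable_markov
begin

text \<open>
  Rational times are countable; right-continuity of the empirical laws takes care of the others.
\<close>

lemma markov_at_all_times:
  "AE \<omega> in M. \<forall>r s t. 0 \<le> r \<and> r \<le> s \<and> s \<le> t \<longrightarrow> markov_at (\<lambda>u. X u \<omega>) r s t"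
proof -
  have "AE \<omega> in M. \<forall>r\<in>\<rat>. \<forall>s\<in>\<rat>. \<forall>t\<in>\<rat>. 0 \<le> r \<and> r \<le> s \<and> s \<le> t \<longrightarrow> markov_at (\<lambda>u. X u \<omega>) r s t"
  proof (intro AE_ball_countable[THEN iffD2, OF countable_rat] ballI)
    fix r s t :: real
    show "AE \<omega> in M. 0 \<le> r \<and> r \<le> s \<and> s \<le> t \<longrightarrow> markov_at (\<lambda>u. X u \<omega>) r s t"
    proof (cases "0 \<le> r \<and> r \<le> s \<and> s \<le> t")
      case True
      then have "AE \<omega> in M. markov_at (\<lambda>u. X u \<omega>) r s t" by (intro markov_at_AE) auto
      then show ?thesis by eventually_elim simp
    qed (auto intro!: AE_I2)
  qed
  with right_stable show ?thesis
  proof eventually_elim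
    case (elim \<omega>)
    have "right_stable_array (\<lambda>u. X u \<omega>)" using elim(1) unfolding right_stable_array_def .
    then show ?case using elim(2) by (blast intro: markov_at_real_times)
  qed
qed

end

lemma projection_eq_freq: "projection X t \<omega> = (\<chi> j. freq (\<lambda>i. X t \<omega> i = j))"
  by (simp add: projection_def freq_def running_mean_def[abs_def])

theorem theorem2p13:
  fixes M :: "'a measure"
    and p :: "real \<Rightarrow> (nat \<Rightarrow> 'k::finite) \<Rightarrow> (nat \<Rightarrow> 'k) measure"
    and X :: "real \<Rightarrow> 'a \<Rightarrow> nat \<Rightarrow> 'k"
  assumes "exchangeable_markov_process M p X"
    and "AE \<omega> in M. cadlag_path (\<lambda>t. X t \<omega>)"
  shows "\<exists>Q :: real \<Rightarrow> real \<Rightarrow> 'a \<Rightarrow> real ^ 'k ^ 'k.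
    compatible_random_semigroup M (projection X) Q \<and>
    (\<forall>s t. 0 \<le> s \<and> s \<le> t \<longrightarrow> Q s t \<in> borel_measurable (exch_algebra M X {s, t})) \<and>
    cond_indep_vars M (exch_algebra M X {0..}) (path_space {0..}) (coord_path X {0..}) UNIV \<and>
    cond_ident_distributed M (exch_algebra M X {0..}) (path_space {0..}) (coord_path X {0..}) UNIV \<and>
    (\<forall>i. cond_markov_chain M (exch_algebra M X {0..}) Q (\<lambda>t \<omega>. X t \<omega> i)) \<and>
    (\<forall>i s t a b. 0 \<le> s \<and> s \<le> t \<longrightarrow>
      (AE \<omega> in M. X s \<omega> i = a \<longrightarrow>
        cond_pr M (join_algebra M (exch_algebra M X {0..})
            (generated_algebra M (count_space UNIV) {s} (\<lambda>u \<omega>. X u \<omega> i)))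
          {\<omega>\<in>space M. X t \<omega> i = b} \<omega>
        = Q s t \<omega> $ a $ b))"
proof -
  interpret cadlag_exchangeable_markov M p X
    by unfold_locales (rule assms)+
  define Q where "Q s t \<omega> = empirical_transition (X s \<omega>) (X t \<omega>)" for s t \<omega>
  have coord: "coord_path X {0..} = (\<lambda>i \<omega>. paths \<omega> i)" by (simp add: paths_def fun_eq_iff)
  show ?thesis
  proof (intro exI[of _ Q] conjI allI impI)
    show "Q s t \<in> borel_measurable (exch_algebra M X {s, t})" for s t
      unfolding Q_def[abs_def] by (rule empirical_transition_measurable) auto
    show "compatible_random_semigroup M (projection X) Q"
      unfolding compatible_random_semigroup_def
    proof (intro conjI allI impI ballI)
      fix s t :: real assume "0 \<le> s \<and> s \<le> t"
      then have "Q s t \<in> borel_measurable E"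
        unfolding Q_def[abs_def] E_eq by (intro empirical_transition_measurable) auto
      then show "Q s t \<in> borel_measurable M" by (rule measurable_from_subalg[OF subalgebra_E])
      show "stochastic_matrix (Q s t \<omega>)" for \<omega>
        unfolding Q_def empirical_transition_def by (rule stochastic_transition_of)
    next
      show "AE \<omega> in M. (\<forall>r s t. 0 \<le> r \<and> r \<le> s \<and> s \<le> t \<longrightarrow> Q r t \<omega> = Q r s \<omega> ** Q s t \<omega>) \<and>
          (\<forall>s t. 0 \<le> s \<and> s \<le> t \<longrightarrow> projection X s \<omega> v* Q s t \<omega> = projection X t \<omega>)"
        using markov_at_all_times
      proof eventually_elim
        case (elim \<omega>)
        show ?case
        proof (intro conjI allI impI)
          fix r s t :: real assume "0 \<le> r \<and> r \<le> s \<and> s \<le> t"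
          then have "markov_at (\<lambda>u. X u \<omega>) r s t" using elim by blast
          then show "Q r t \<omega> = Q r s \<omega> ** Q s t \<omega>"
            unfolding Q_def by (rule empirical_transition_semigroup(1))
        next
          fix s t :: real assume "0 \<le> s \<and> s \<le> t"
          then have "markov_at (\<lambda>u. X u \<omega>) s s t" using elim by auto
          then show "projection X s \<omega> v* Q s t \<omega> = projection X t \<omega>"
            unfolding Q_def projection_eq_freq by (rule empirical_transition_semigroup(2))
        qed
      qed
    qed
    show "cond_indep_vars M (exch_algebra M X {0..}) (path_space {0..}) (coord_path X {0..}) UNIV"
      using cond_indep unfolding E_eq coord .
    show "cond_ident_distributed M (exch_algebra M X {0..}) (path_space {0..}) (coord_path X {0..}) UNIV"
      using cond_ident unfolding E_eq coord .
    show "cond_markov_chain M (exch_algebra M X {0..}) Q (\<lambda>t \<omega>. X t \<omega> i)" for i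
      unfolding cond_markov_chain_def Q_def by (intro allI impI cond_markov) auto
    show "AE \<omega> in M. X s \<omega> i = a \<longrightarrow>
        cond_pr M (join_algebra M (exch_algebra M X {0..})
            (generated_algebra M (count_space UNIV) {s} (\<lambda>u \<omega>. X u \<omega> i)))
          {\<omega>\<in>space M. X t \<omega> i = b} \<omega> = Q s t \<omega> $ a $ b"
      if "0 \<le> s \<and> s \<le> t" for i s t a b
      by (rule eventually_mono[OF cond_markov[OF singletonI _ conjunct2[OF that]]])
        (use that in \<open>auto simp: Q_def\<close>)
  qed
qed

end
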